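(* Consider the CTMDP model and the associated DTMDP model described in the context, and suppose Condition 1 holds. Let $\pi=(\pi_n)\in\Pi$ be a feasible policy with a finite value for the CTMDP problem such that $\pi_{n+1}(da|x_0,\theta_1,\dots,x_n,s)=\delta_{f^\ast(x_n)}(da)$ whenever $x_n\in S_2$. Then there is a Markov policy $\sigma=(\sigma_n)$ for the DTMDP $\{S_\infty,A,p,\gamma\}$ such that for each $n=0,1,\dots$, $\sigma_{n+1}(da|x)=\delta_{f^\ast(x)}(da)$ for each $x\in S_2$ (if $S_2\neq\emptyset$), and $$M^{n,\pi}_\gamma(\Gamma_S\times\Gamma_A)=\mathbf P^\sigma_\gamma(X_n\in\Gamma_S,\ A_{n+1}\in\Gamma_A)\quad\forall\,\Gamma_S\in\mathcal B(S\setminus S_2),\ \Gamma_A\in\mathcal B(A).$$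
   Context: CTMDP model. $S$ and $A$ are nonempty Borel spaces, $\gamma$ is a probability measure on $\mathcal B(S)$, and $q(dy|x,a)$ is a signed kernel on $\mathcal B(S)$ given $(x,a)\in S\times A$ such that $\tilde q(\Gamma|x,a):=q(\Gamma\setminus\{x\}|x,a)\ge0$ for all $\Gamma\in\mathcal B(S)$, $q(S|x,a)=0$, and, with $q_x(a):=-q(\{x\}|x,a)\ge0$, $\sup_{a\in A}q_x(a)<\infty$ for each $x\in S$. Conventions: $0/0:=0$, $0\cdot\infty:=0$, $c/0:=+\infty$ for $c>0$. Let $x_\infty\notin S$ be an isolated point, $S_\infty:=S\cup\{x_\infty\}$. The sample space $\Omega$ consists of sequences $\omega=(x_0,\theta_1,x_1,\theta_2,\dots)$ with $x_n\in S$, $\theta_n\in(0,\infty)$, together with sequences $(x_0,\theta_1,\dots,\theta_n,x_n,\infty,x_\infty,\infty,x_\infty,\dots)$; $t_0:=0$, $t_n:=t_{n-1}+\theta_n$, $t_\infty:=\lim_n t_n$, $\xi_t:=\sum_{n\ge0}I\{t_n\le t<t_{n+1}\}x_n+I\{t_\infty\le t\}x_\infty$. A policy $\pi=(\pi_n)_{n\ge1}$ is a sequence of stochastic kernels $\pi_n(da|x_0,\theta_1,\dots,x_{n-1},s)$ on $A$ ($s>0$ is the time since the last jump), and $\pi(da|\omega,t):=\sum_{n\ge0}I\{t_n<t\le t_{n+1}\}\pi_{n+1}(da|x_0,\theta_1,\dots,x_n,t-t_n)$ for $t<t_\infty$ (after $t_\infty$ a dummy action at which all rates and costs vanish is used).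 $\Pi$ is the set of all policies. Under $\pi$, $P^\pi_\gamma$ is the unique probability on $\Omega$ with $x_0\sim\gamma$, $P^\pi_\gamma(\theta_{n+1}\ge t|x_0,\theta_1,\dots,x_n)=\exp(-\int_0^t\int_A q_{x_n}(a)\pi_{n+1}(da|x_0,\dots,x_n,s)ds)$, and $P^\pi_\gamma(x_{n+1}\in\Gamma|x_0,\dots,x_n,\theta_{n+1})=\frac{\int_A\tilde q(\Gamma|x_n,a)\pi_{n+1}(da|x_0,\dots,x_n,\theta_{n+1})}{\int_A q_{x_n}(a)\pi_{n+1}(da|x_0,\dots,x_n,\theta_{n+1})}$ for $\Gamma\in\mathcal B(S)$, the remaining probability going to $x_\infty$; $E^\pi_\gamma$ is its expectation. Costs: measurable $c_0,\dots,c_N:S\times A\to[0,\infty)$, $c_i(x_\infty,\cdot):=0$; constants $d_1,\dots,d_N\in[0,\infty)$. $\pi$ is feasible if $E^\pi_\gamma[\int_0^\infty\int_A c_j(\xi_t,a)\pi(da|\omega,t)dt]\le d_j$ for $j=1,\dots,N$, and feasible with a finite value if moreover the same expression with $c_0$ is finite. Occupancy measures: $M^{n,\pi}_\gamma(\Gamma_S\times\Gamma_A):=E^\pi_\gamma[\int_{t_n}^{t_{n+1}}I\{\xi_t\in\Gamma_S\}\int_{\Gamma_A}q_{\xi_t}(a)\pi(da|\omega,t)dt]$, $n=0,1,\dots$. DTMDP model $\{S_\infty,A,p,\gamma\}$: state space $S_\infty$, action space $A$, initial distribution $\gamma$, transition probability $p(\Gamma|x,a):=\tilde q(\Gamma|x,a)/q_x(a)$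 for $x\in S$, $\Gamma\in\mathcal B(S)$, with $p(\{x_\infty\}|x,a):=1-p(S|x,a)$, and $p(\cdot|x_\infty,a):=\delta_{x_\infty}$. Its policies $\sigma=(\sigma_n)$ are stochastic kernels $\sigma_n(da|X_0,A_1,\dots,X_{n-1})$ (Markov if $\sigma_n=\sigma_n(da|X_{n-1})$), with strategic measure $\mathbf P^\sigma_\gamma$ on trajectories $(X_0,A_1,X_1,A_2,\dots)$. Condition 1: (a) $A$ is compact; (b) for each bounded continuous $f$ on $S$, $(x,a)\mapsto\int_S f(y)\tilde q(dy|x,a)/q_x(a)$ is continuous; (c) $(x,a)\mapsto q_x(a)$ is continuous; (d) each $c_i$ is lower semicontinuous. $S_2:=\{x\in S:\inf_{a\in A}(q_x(a)+\sum_{i=0}^Nc_i(x,a))=0\}$, and $f^\ast:S\to A$ is a fixed measurable map with $\sum_{i=0}^Nc_i(x,f^\ast(x))+q_x(f^\ast(x))=0$ for all $x\in S_2$ (it exists under Condition 1). *)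

theory Defs
  imports "HOL-Probability.Probability"
begin

text \<open>S and A are Borel subsets of Polish spaces (i.e. Borel spaces), with the
  relative topology and the trace Borel sigma-algebra. The isolated point x_inf
  is encoded as None in the type 's option; S_inf = insert None (Some ` S).\<close>

definition MS :: "'s::topological_space set \<Rightarrow> 's measure" where
  "MS S = restrict_space borel S"

definition MA :: "'a::topological_space set \<Rightarrow> 'a measure" where
  "MA A = restrict_space borel A"

definition MSi :: "'s::topological_space set \<Rightarrow> 's option measure" where
  "MSi S = measure_of (insert None (Some ` S))
      {B. B \<subseteq> insert None (Some ` S) \<and> Some -` B \<in> sets (MS S)} (\<lambda>_. 0)"

text \<open>The signed kernel q is represented through its off-diagonal part
  qt x a = q~(.|x,a) (a finite measure on S with q~({x}|x,a) = 0);
  since q(S|x,a) = 0 one has q_x(a) = -q({x}|x,a) = q~(S|x,a).\<close>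

definition qx :: "('s \<Rightarrow> 'a \<Rightarrow> 's measure) \<Rightarrow> 's set \<Rightarrow> 's \<Rightarrow> 'a \<Rightarrow> real" where
  "qx qt S x a = measure (qt x a) S"

definition ctmdp_model ::
  "'s::polish_space set \<Rightarrow> 'a::polish_space set \<Rightarrow> ('s \<Rightarrow> 'a \<Rightarrow> 's measure) \<Rightarrow> 's measure \<Rightarrow> bool" where
  "ctmdp_model S A qt \<gamma> \<longleftrightarrow>
     S \<in> sets borel \<and> S \<noteq> {} \<and> A \<in> sets borel \<and> A \<noteq> {} \<and>
     prob_space \<gamma> \<and> sets \<gamma> = sets (MS S) \<and>
     (\<forall>x\<in>S. \<forall>a\<in>A. sets (qt x a) = sets (MS S) \<and> finite_measure (qt x a)
                    \<and> emeasure (qt x a) {x} = 0) \<and>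
     (\<forall>B\<in>sets (MS S). (\<lambda>(x,a). emeasure (qt x a) B) \<in> borel_measurable (MS S \<Otimes>\<^sub>M MA A)) \<and>
     (\<forall>x\<in>S. bdd_above ((\<lambda>a. qx qt S x a) ` A))"

definition cost_data ::
  "'s::polish_space set \<Rightarrow> 'a::polish_space set \<Rightarrow> nat \<Rightarrow> (nat \<Rightarrow> 's \<Rightarrow> 'a \<Rightarrow> real) \<Rightarrow> (nat \<Rightarrow> real) \<Rightarrow> bool" where
  "cost_data S A N c d \<longleftrightarrow>
     (\<forall>i\<le>N. (\<lambda>(x,a). c i x a) \<in> borel_measurable (MS S \<Otimes>\<^sub>M MA A) \<and>
            (\<forall>x\<in>S. \<forall>a\<in>A. 0 \<le> c i x a)) \<and>
     (\<forall>j\<in>{1..N}. 0 \<le> d j)"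

definition lsc_on :: "'b::topological_space set \<Rightarrow> ('b \<Rightarrow> real) \<Rightarrow> bool" where
  "lsc_on D f \<longleftrightarrow> (\<forall>z\<in>D. \<forall>y. y < f z \<longrightarrow> (\<exists>U. open U \<and> z \<in> U \<and> (\<forall>w\<in>U \<inter> D. y < f w)))"

definition condition1 ::
  "'s::polish_space set \<Rightarrow> 'a::polish_space set \<Rightarrow> ('s \<Rightarrow> 'a \<Rightarrow> 's measure) \<Rightarrow> nat \<Rightarrow> (nat \<Rightarrow> 's \<Rightarrow> 'a \<Rightarrow> real) \<Rightarrow> bool" where
  "condition1 S A qt N c \<longleftrightarrow>
     compact A \<and>
     (\<forall>f::'s \<Rightarrow> real. continuous_on S f \<and> bounded (f ` S) \<longrightarrow>
        continuous_on (S \<times> A) (\<lambda>(x,a). (\<integral>y. f y \<partial>qt x a) / qx qt S x a)) \<and>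
     continuous_on (S \<times> A) (\<lambda>(x,a). qx qt S x a) \<and>
     (\<forall>i\<le>N. lsc_on (S \<times> A) (\<lambda>(x,a). c i x a))"

definition S2 ::
  "'s set \<Rightarrow> 'a set \<Rightarrow> ('s \<Rightarrow> 'a \<Rightarrow> 's measure) \<Rightarrow> nat \<Rightarrow> (nat \<Rightarrow> 's \<Rightarrow> 'a \<Rightarrow> real) \<Rightarrow> 's set" where
  "S2 S A qt N c = {x\<in>S. (INF a\<in>A. qx qt S x a + (\<Sum>i\<le>N. c i x a)) = 0}"

text \<open>Given a (sub-)rate function rt on subsets of S and a total rate r,
  the measure Gamma |-> rt(Gamma)/r on S, the remaining mass 1 - rt(S)/r going to
  x_inf = None (real division, so 0/0 = 0).\<close>

definition trans_meas :: "'s::topological_space set \<Rightarrow> ('s set \<Rightarrow> real) \<Rightarrow> real \<Rightarrow> 's option measure" where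
  "trans_meas S rt r = measure_of (space (MSi S)) (sets (MSi S))
     (\<lambda>B. ennreal (rt (Some -` B) / r) + (if None \<in> B then ennreal (1 - rt S / r) else 0))"

text \<open>A trajectory omega = (x_0, theta_1, x_1, theta_2, ...) is encoded as
  omega :: nat => ennreal x 's option with omega 0 = (0, Some x_0) and
  omega n = (theta_n, x_n) for n \<ge> 1 (theta_n = \<infinity>, x_n = None after absorption).\<close>

definition Mstep :: "'s::topological_space set \<Rightarrow> (ennreal \<times> 's option) measure" where
  "Mstep S = (borel :: ennreal measure) \<Otimes>\<^sub>M MSi S"

definition Hset :: "'s::topological_space set \<Rightarrow> nat \<Rightarrow> (nat \<Rightarrow> ennreal \<times> 's option) set" where
  "Hset S n = {h \<in> space (PiM {..n} (\<lambda>_. Mstep S)).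
      fst (h 0) = 0 \<and> (\<forall>i\<le>n. snd (h i) \<in> Some ` S) \<and>
      (\<forall>i\<in>{1..n}. 0 < fst (h i) \<and> fst (h i) < \<infinity>)}"

definition Hn :: "'s::topological_space set \<Rightarrow> nat \<Rightarrow> (nat \<Rightarrow> ennreal \<times> 's option) measure" where
  "Hn S n = restrict_space (PiM {..n} (\<lambda>_. Mstep S)) (Hset S n)"

definition Omega :: "'s::topological_space set \<Rightarrow> (nat \<Rightarrow> ennreal \<times> 's option) set" where
  "Omega S = {\<omega> \<in> space (PiM UNIV (\<lambda>_. Mstep S)).
      fst (\<omega> 0) = 0 \<and> snd (\<omega> 0) \<in> Some ` S \<and>
      (\<forall>n\<ge>1. \<omega> n = (\<infinity>, None) \<or> (0 < fst (\<omega> n) \<and> fst (\<omega> n) < \<infinity> \<and> snd (\<omega> n) \<in> Some ` S)) \<and>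
      (\<forall>n\<ge>1. \<omega> n = (\<infinity>, None) \<longrightarrow> \<omega> (Suc n) = (\<infinity>, None))}"

definition MOmega :: "'s::topological_space set \<Rightarrow> (nat \<Rightarrow> ennreal \<times> 's option) measure" where
  "MOmega S = restrict_space (PiM UNIV (\<lambda>_. Mstep S)) (Omega S)"

text \<open>A CTMDP policy: pi (Suc n) h s = pi_{n+1}(da | x_0,theta_1,...,x_n, s), a stochastic
  kernel from H_n x (0,\<infinity>) to A. (pi 0 is unused.)\<close>

definition ct_policy ::
  "'s::polish_space set \<Rightarrow> 'a::polish_space set \<Rightarrow> (nat \<Rightarrow> (nat \<Rightarrow> ennreal \<times> 's option) \<Rightarrow> real \<Rightarrow> 'a measure) \<Rightarrow> bool" where
  "ct_policy S A \<pi> \<longleftrightarrow>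
     (\<forall>n. (\<lambda>(h,s). \<pi> (Suc n) h s) \<in>
            (Hn S n \<Otimes>\<^sub>M restrict_space (borel :: real measure) {0<..}) \<rightarrow>\<^sub>M prob_algebra (MA A))"

definition cumrate ::
  "'s set \<Rightarrow> ('s \<Rightarrow> 'a \<Rightarrow> 's measure) \<Rightarrow> (nat \<Rightarrow> (nat \<Rightarrow> ennreal \<times> 's option) \<Rightarrow> real \<Rightarrow> 'a measure)
    \<Rightarrow> nat \<Rightarrow> (nat \<Rightarrow> ennreal \<times> 's option) \<Rightarrow> real \<Rightarrow> ennreal" where
  "cumrate S qt \<pi> n h t =
     (\<integral>\<^sup>+ s. indicator {0<..t} s * (\<integral>\<^sup>+ a. ennreal (qx qt S (the (snd (h n))) a) \<partial>\<pi> (Suc n) h s) \<partial>lborel)"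

definition theta_law ::
  "'s set \<Rightarrow> ('s \<Rightarrow> 'a \<Rightarrow> 's measure) \<Rightarrow> (nat \<Rightarrow> (nat \<Rightarrow> ennreal \<times> 's option) \<Rightarrow> real \<Rightarrow> 'a measure)
    \<Rightarrow> nat \<Rightarrow> (nat \<Rightarrow> ennreal \<times> 's option) \<Rightarrow> ennreal measure" where
  "theta_law S qt \<pi> n h = (THE \<nu>. sets \<nu> = sets (borel :: ennreal measure) \<and> prob_space \<nu> \<and>
      (\<forall>t::real. 0 \<le> t \<longrightarrow>
         emeasure \<nu> {\<theta>. ennreal t \<le> \<theta>} = ennreal (exp (- enn2real (cumrate S qt \<pi> n h t)))))"

definition x_law ::
  "'s::topological_space set \<Rightarrow> ('s \<Rightarrow> 'a \<Rightarrow> 's measure) \<Rightarrow> (nat \<Rightarrow> (nat \<Rightarrow> ennreal \<times> 's option) \<Rightarrow> real \<Rightarrow> 'a measure)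
    \<Rightarrow> nat \<Rightarrow> (nat \<Rightarrow> ennreal \<times> 's option) \<Rightarrow> real \<Rightarrow> 's option measure" where
  "x_law S qt \<pi> n h t =
     (let x = the (snd (h n)) in
      trans_meas S (\<lambda>\<Gamma>. enn2real (\<integral>\<^sup>+ a. emeasure (qt x a) \<Gamma> \<partial>\<pi> (Suc n) h t))
                   (enn2real (\<integral>\<^sup>+ a. ennreal (qx qt S x a) \<partial>\<pi> (Suc n) h t)))"

definition ct_step ::
  "'s::topological_space set \<Rightarrow> ('s \<Rightarrow> 'a \<Rightarrow> 's measure) \<Rightarrow> (nat \<Rightarrow> (nat \<Rightarrow> ennreal \<times> 's option) \<Rightarrow> real \<Rightarrow> 'a measure)
    \<Rightarrow> nat \<Rightarrow> (nat \<Rightarrow> ennreal \<times> 's option) \<Rightarrow> (ennreal \<times> 's option) measure" where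
  "ct_step S qt \<pi> n h =
     (if snd (h n) = None then return (Mstep S) (\<infinity>, None)
      else theta_law S qt \<pi> n h \<bind>
             (\<lambda>\<theta>. if \<theta> = \<infinity> then return (Mstep S) (\<infinity>, None)
                  else distr (x_law S qt \<pi> n h (enn2real \<theta>)) (Mstep S) (\<lambda>y. (\<theta>, y))))"

primrec ct_marg ::
  "'s::topological_space set \<Rightarrow> ('s \<Rightarrow> 'a \<Rightarrow> 's measure) \<Rightarrow> 's measure
    \<Rightarrow> (nat \<Rightarrow> (nat \<Rightarrow> ennreal \<times> 's option) \<Rightarrow> real \<Rightarrow> 'a measure)
    \<Rightarrow> nat \<Rightarrow> (nat \<Rightarrow> ennreal \<times> 's option) measure" where
  "ct_marg S qt \<gamma> \<pi> 0 = distr \<gamma> (PiM {..0} (\<lambda>_. Mstep S)) (\<lambda>x. \<lambda>i\<in>{..0}. (0, Some x))"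
| "ct_marg S qt \<gamma> \<pi> (Suc n) = ct_marg S qt \<gamma> \<pi> n \<bind>
     (\<lambda>h. distr (ct_step S qt \<pi> n h) (PiM {..Suc n} (\<lambda>_. Mstep S))
                 (\<lambda>y. \<lambda>i\<in>{..Suc n}. if i = Suc n then y else h i))"

text \<open>P is the strategic measure P^pi_gamma: the probability measure on Omega whose
  finite-dimensional marginals are given by the conditional laws above
  (it exists and is unique by the Ionescu-Tulcea theorem).\<close>
definition ct_strategic_measure ::
  "'s::topological_space set \<Rightarrow> ('s \<Rightarrow> 'a \<Rightarrow> 's measure) \<Rightarrow> 's measure
    \<Rightarrow> (nat \<Rightarrow> (nat \<Rightarrow> ennreal \<times> 's option) \<Rightarrow> real \<Rightarrow> 'a measure)
    \<Rightarrow> (nat \<Rightarrow> ennreal \<times> 's option) measure \<Rightarrow> bool" where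
  "ct_strategic_measure S qt \<gamma> \<pi> P \<longleftrightarrow>
     prob_space P \<and> sets P = sets (MOmega S) \<and> space P = Omega S \<and>
     (\<forall>n. distr P (PiM {..n} (\<lambda>_. Mstep S)) (\<lambda>\<omega>. restrict \<omega> {..n}) = ct_marg S qt \<gamma> \<pi> n)"

definition tt :: "(nat \<Rightarrow> ennreal \<times> 's option) \<Rightarrow> nat \<Rightarrow> ennreal" where
  "tt \<omega> n = (\<Sum>i\<in>{1..n}. fst (\<omega> i))"

definition xi :: "(nat \<Rightarrow> ennreal \<times> 's option) \<Rightarrow> real \<Rightarrow> 's option" where
  "xi \<omega> t = (if \<exists>n. tt \<omega> n \<le> ennreal t \<and> ennreal t < tt \<omega> (Suc n)
             then snd (\<omega> (THE n. tt \<omega> n \<le> ennreal t \<and> ennreal t < tt \<omega> (Suc n)))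
             else None)"

text \<open>pi(da|omega,t) = pi_{n+1}(da|x_0,...,x_n, t - t_n) for t_n < t \<le> t_{n+1}; outside
  [0,t_\<infinity>) only a dummy is used (all rates and costs vanish at x_inf).\<close>
definition pol ::
  "'a::topological_space set \<Rightarrow> (nat \<Rightarrow> (nat \<Rightarrow> ennreal \<times> 's option) \<Rightarrow> real \<Rightarrow> 'a measure)
    \<Rightarrow> (nat \<Rightarrow> ennreal \<times> 's option) \<Rightarrow> real \<Rightarrow> 'a measure" where
  "pol A \<pi> \<omega> t = (if \<exists>n. tt \<omega> n < ennreal t \<and> ennreal t \<le> tt \<omega> (Suc n)
      then (let n = THE n. tt \<omega> n < ennreal t \<and> ennreal t \<le> tt \<omega> (Suc n)
            in \<pi> (Suc n) (restrict \<omega> {..n}) (t - enn2real (tt \<omega> n)))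
      else null_measure (MA A))"

definition ct_cost ::
  "'a::topological_space set \<Rightarrow> (nat \<Rightarrow> (nat \<Rightarrow> ennreal \<times> 's option) \<Rightarrow> real \<Rightarrow> 'a measure)
    \<Rightarrow> (nat \<Rightarrow> ennreal \<times> 's option) measure \<Rightarrow> ('s \<Rightarrow> 'a \<Rightarrow> real) \<Rightarrow> ennreal" where
  "ct_cost A \<pi> P f =
     (\<integral>\<^sup>+ \<omega>. (\<integral>\<^sup>+ t. indicator {0..} t *
          (case xi \<omega> t of None \<Rightarrow> 0 | Some x \<Rightarrow> \<integral>\<^sup>+ a. ennreal (f x a) \<partial>pol A \<pi> \<omega> t) \<partial>lborel) \<partial>P)"

definition occ ::
  "'s set \<Rightarrow> 'a::topological_space set \<Rightarrow> ('s \<Rightarrow> 'a \<Rightarrow> 's measure)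
    \<Rightarrow> (nat \<Rightarrow> (nat \<Rightarrow> ennreal \<times> 's option) \<Rightarrow> real \<Rightarrow> 'a measure)
    \<Rightarrow> (nat \<Rightarrow> ennreal \<times> 's option) measure \<Rightarrow> nat \<Rightarrow> 's set \<Rightarrow> 'a set \<Rightarrow> ennreal" where
  "occ S A qt \<pi> P n \<Gamma>S \<Gamma>A =
     (\<integral>\<^sup>+ \<omega>. (\<integral>\<^sup>+ t. indicator {t. tt \<omega> n \<le> ennreal t \<and> ennreal t < tt \<omega> (Suc n)} t *
          (case xi \<omega> t of None \<Rightarrow> 0
           | Some x \<Rightarrow> indicator \<Gamma>S x *
               (\<integral>\<^sup>+ a. indicator \<Gamma>A a * ennreal (qx qt S x a) \<partial>pol A \<pi> \<omega> t)) \<partial>lborel) \<partial>P)"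

definition pk :: "'s::topological_space set \<Rightarrow> ('s \<Rightarrow> 'a \<Rightarrow> 's measure) \<Rightarrow> 's option \<Rightarrow> 'a \<Rightarrow> 's option measure" where
  "pk S qt y a = (case y of None \<Rightarrow> return (MSi S) None
                  | Some x \<Rightarrow> trans_meas S (\<lambda>\<Gamma>. measure (qt x a) \<Gamma>) (qx qt S x a))"

definition dt_markov_policy ::
  "'s::topological_space set \<Rightarrow> 'a::topological_space set \<Rightarrow> (nat \<Rightarrow> 's option \<Rightarrow> 'a measure) \<Rightarrow> bool" where
  "dt_markov_policy S A \<sigma> \<longleftrightarrow> (\<forall>n. \<sigma> (Suc n) \<in> MSi S \<rightarrow>\<^sub>M prob_algebra (MA A))"

definition Mda :: "'s::topological_space set \<Rightarrow> 'a::topological_space set \<Rightarrow> ('s option \<times> 'a) measure" where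
  "Mda S A = MSi S \<Otimes>\<^sub>M MA A"

primrec dt_marg ::
  "'s::topological_space set \<Rightarrow> 'a::topological_space set \<Rightarrow> ('s \<Rightarrow> 'a \<Rightarrow> 's measure) \<Rightarrow> 's measure
    \<Rightarrow> (nat \<Rightarrow> 's option \<Rightarrow> 'a measure) \<Rightarrow> nat \<Rightarrow> (nat \<Rightarrow> 's option \<times> 'a) measure" where
  "dt_marg S A qt \<gamma> \<sigma> 0 = \<gamma> \<bind> (\<lambda>x. \<sigma> 1 (Some x) \<bind>
       (\<lambda>a. return (PiM {..0} (\<lambda>_. Mda S A)) (\<lambda>i\<in>{..0}. (Some x, a))))"
| "dt_marg S A qt \<gamma> \<sigma> (Suc n) = dt_marg S A qt \<gamma> \<sigma> n \<bind>
     (\<lambda>h. pk S qt (fst (h n)) (snd (h n)) \<bind>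
       (\<lambda>y. \<sigma> (Suc (Suc n)) y \<bind>
         (\<lambda>a. return (PiM {..Suc n} (\<lambda>_. Mda S A))
                 (\<lambda>i\<in>{..Suc n}. if i = Suc n then (y, a) else h i))))"

definition dt_prob ::
  "'s::topological_space set \<Rightarrow> 'a::topological_space set \<Rightarrow> ('s \<Rightarrow> 'a \<Rightarrow> 's measure) \<Rightarrow> 's measure
    \<Rightarrow> (nat \<Rightarrow> 's option \<Rightarrow> 'a measure) \<Rightarrow> nat \<Rightarrow> 's set \<Rightarrow> 'a set \<Rightarrow> ennreal" where
  "dt_prob S A qt \<gamma> \<sigma> n \<Gamma>S \<Gamma>A =
     emeasure (dt_marg S A qt \<gamma> \<sigma> n)
       {h \<in> space (dt_marg S A qt \<gamma> \<sigma> n). fst (h n) \<in> Some ` \<Gamma>S \<and> snd (h n) \<in> \<Gamma>A}"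

end

theory Submission
  imports Defs
begin

text \<open>
  Given the history up to the $n$-th jump, the sojourn time has survival function $e^{-\Lambda}$, where
  $\Lambda' = r$ is the action-averaged jump rate, so Tonelli's theorem gives
  $E\int_{t_n}^{t_{n+1}} f(\xi_t, a)\,\pi(da)\,dt = E \int_0^\infty e^{-\Lambda(s)} \int f(x_n, a)\,\pi_{n+1}(da|s)\,ds$.
  Off $S_2$ the quantity $q_x(a) + \sum_i c_i(x,a)$ is bounded below by some $\delta(x) > 0$; since the expected costs
  are finite, $\int_0^\infty e^{-\Lambda(s)}\,ds$ is finite almost surely, hence $\Lambda(\infty) = \infty$ and
  $\int_0^\infty r e^{-\Lambda} = 1$. So the first marginal of the occupancy measure $M^n$ is the law of $x_n$ restricted
  to $S \setminus S_2$. Disintegrating $M^n$ along this marginal yields $\sigma_{n+1}$. Because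
  $P(x_{n+1} \in \Gamma) = \int p(\Gamma|x,a)\,M^n(dx, da)$ and states in $S_2$ are left at rate zero in both models,
  the laws of $x_n$ and $X_n$ agree for all $n$ by induction.
\<close>

section \<open>Disintegration over a closed subset of a Polish space\<close>

text \<open>The occupation measure without the weight \<open>qrate\<close> can be infinite, because
  a state of \<open>S2\<close> may be kept forever. Weighted by \<open>qrate\<close> it has mass at
  most one, since a sojourn ends in at most one jump; it is the weighted measure that is
  disintegrated. At \<open>fstar\<close> the weight vanishes on \<open>S2\<close>, so the marginal
  has no mass there and the kernel can be overwritten by \<open>fstar\<close> without changing any
  integral against it. Each \<open>\<sigma> (Suc n)\<close> depends on the n-th occupancy measure
  alone. The policy is thus built for all n at once, and the induction concerns only one-dimensional
  state laws. There, a state of \<open>S2\<close> has an infinite sojourn in continuous time and is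
  followed by \<open>None\<close>, while the discrete chain goes from it to \<open>None\<close>
  because 0/0 is 0. Two obstacles shape the technical part. Jump rates are merely measurable in
  time, and the history laws are binds of kernels whose measurability is not known; that these binds
  are probability measures has to be read off from \<open>P\<close>.\<close>

lemma AE_le_if_set_integrals_le:
  fixes f g :: "'x \<Rightarrow> ennreal"
  assumes [measurable]: "f \<in> borel_measurable M" "g \<in> borel_measurable M"
    and fin: "integral\<^sup>N M g \<noteq> \<infinity>"
    and le: "\<And>B. B \<in> sets M \<Longrightarrow> (\<integral>\<^sup>+x. f x * indicator B x \<partial>M) \<le> (\<integral>\<^sup>+x. g x * indicator B x \<partial>M)"
  shows "AE x in M. f x \<le> g x"
proof -
  let ?N = "{x\<in>space M. g x < f x}"
  have "(\<integral>\<^sup>+x. g x * indicator ?N x \<partial>M) \<le> integral\<^sup>N M g"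
    by (intro nn_integral_mono) (auto split: split_indicator)
  then have Pg: "(\<integral>\<^sup>+x. g x * indicator ?N x \<partial>M) \<noteq> \<infinity>"
    using fin by (auto simp: top_unique)
  have "(\<integral>\<^sup>+x. (f x - g x) * indicator ?N x \<partial>M)
      = (\<integral>\<^sup>+x. f x * indicator ?N x - g x * indicator ?N x \<partial>M)"
    by (auto intro!: nn_integral_cong simp: indicator_def)
  also have "\<dots> = (\<integral>\<^sup>+x. f x * indicator ?N x \<partial>M) - (\<integral>\<^sup>+x. g x * indicator ?N x \<partial>M)"
    by (rule nn_integral_diff) (use Pg in \<open>auto split: split_indicator\<close>)
  also have "\<dots> = 0"
    using le[of ?N] Pg by (intro diff_eq_0_ennreal) (auto simp: less_top intro: le_less_trans)
  finally have "AE x in M. (f x - g x) * indicator ?N x = 0"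
    by (subst (asm) nn_integral_0_iff_AE) auto
  then show ?thesis
    using nn_integral_PInf_AE[OF assms(2) fin] AE_space
    by eventually_elim
      (auto split: split_indicator_asm simp: not_less ennreal_minus_eq_0)
qed

lemma measure_eqI_rectangles:
  assumes "finite_measure M" and sM: "sets M = sets (X \<Otimes>\<^sub>M Y)" and sN: "sets N = sets (X \<Otimes>\<^sub>M Y)"
    and eq: "\<And>B C. B \<in> sets X \<Longrightarrow> C \<in> sets Y \<Longrightarrow> emeasure M (B \<times> C) = emeasure N (B \<times> C)"
  shows "M = N"
proof (rule measure_eqI_generator_eq)
  let ?E = "{a \<times> b | a b. a \<in> sets X \<and> b \<in> sets Y}"
  show "Int_stable ?E" by (rule Int_stable_pair_measure_generator)
  show "?E \<subseteq> Pow (space X \<times> space Y)" by (rule pair_measure_closed)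
  show "sets M = sigma_sets (space X \<times> space Y) ?E" "sets N = sigma_sets (space X \<times> space Y) ?E"
    using sM sN by (simp_all add: sets_pair_measure)
  show "range (\<lambda>i::nat. space X \<times> space Y) \<subseteq> ?E" by auto
  show "emeasure M (space X \<times> space Y) \<noteq> \<infinity>" for i :: nat
    using finite_measure.emeasure_finite[OF assms(1)] by simp
qed (use eq in auto)

lemma nn_integral_bind_distr:
  assumes f: "f \<in> borel_measurable K" and g: "(\<lambda>(x, y). g x y) \<in> M \<Otimes>\<^sub>M N \<rightarrow>\<^sub>M K" and k: "k \<in> M \<rightarrow>\<^sub>M subprob_algebra N"
  shows "(\<integral>\<^sup>+z. f z \<partial>(M \<bind> (\<lambda>x. distr (k x) K (g x)))) = (\<integral>\<^sup>+x. \<integral>\<^sup>+y. f (g x y) \<partial>k x \<partial>M)"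
  unfolding nn_integral_bind[OF f measurable_distr2[OF g k]]
proof (rule nn_integral_cong)
  fix x assume x: "x \<in> space M"
  have "g x \<in> N \<rightarrow>\<^sub>M K" using measurable_compose[OF measurable_Pair1'[OF x] g] by simp
  then have "g x \<in> k x \<rightarrow>\<^sub>M K" by (simp cong: measurable_cong_sets add: sets_kernel[OF k x])
  then show "(\<integral>\<^sup>+z. f z \<partial>distr (k x) K (g x)) = (\<integral>\<^sup>+y. f (g x y) \<partial>k x)" by (rule nn_integral_distr) (simp add: f)
qed

lemma nn_integral_bind_return:
  assumes "prob_space k \<and> sets k = sets N" and g: "g \<in> N \<rightarrow>\<^sub>M K" and f: "f \<in> borel_measurable K"
  shows "(\<integral>\<^sup>+z. f z \<partial>(k \<bind> (\<lambda>y. return K (g y)))) = (\<integral>\<^sup>+y. f (g y) \<partial>k)"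
proof -
  have "g \<in> k \<rightarrow>\<^sub>M K" using assms(1) g by (simp cong: measurable_cong_sets)
  then show ?thesis
    using assms(1) f by (subst bind_return_distr') (auto simp: nn_integral_distr prob_space.not_empty)
qed

text \<open>Conditional distribution functions are first available at rational points and are
  extended by limits from the right. The inequality \<open>t < r k\<close> is strict so that every
  \<open>r k\<close> lies in the index set of the infimum that defines the extension.\<close>

lemma dyadic_upper_approx:
  fixes t :: real
  defines "r \<equiv> \<lambda>k::nat. (of_int \<lfloor>t * 2 ^ k\<rfloor> + 1) / 2 ^ k"
  shows "t < r k" "r k \<le> t + 1 / 2 ^ k" "r (Suc k) \<le> r k" "r k \<in> \<rat>"
proof -
  show "t < r k" unfolding r_def by (simp add: field_simps) linarith
  show "r k \<le> t + 1 / 2 ^ k" unfolding r_def by (simp add: field_simps)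
  have int_step: "a < 2 * b + 2 \<Longrightarrow> a + 1 \<le> 2 * (b + 1)" for a b :: int by presburger
  have "\<lfloor>t * 2 ^ Suc k\<rfloor> < 2 * \<lfloor>t * 2 ^ k\<rfloor> + 2"
    by (simp add: floor_less_iff algebra_simps) linarith
  then have "\<lfloor>t * 2 ^ Suc k\<rfloor> + 1 \<le> 2 * (\<lfloor>t * 2 ^ k\<rfloor> + 1)" using int_step by blast
  then have "real_of_int (\<lfloor>t * 2 ^ Suc k\<rfloor> + 1) \<le> real_of_int (2 * (\<lfloor>t * 2 ^ k\<rfloor> + 1))"
    by (simp only: of_int_le_iff)
  then have "real_of_int (\<lfloor>t * 2 ^ Suc k\<rfloor> + 1) / 2 ^ Suc k \<le> real_of_int (2 * (\<lfloor>t * 2 ^ k\<rfloor> + 1)) / 2 ^ Suc k"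
    by (rule divide_right_mono) simp
  then show "r (Suc k) \<le> r k" unfolding r_def by (simp add: add_divide_distrib)
  show "r k \<in> \<rat>" unfolding r_def by simp
qed

text \<open>The classical construction of a regular conditional distribution: Radon-Nikodym
  derivatives of \<open>M (\<cdot> \<times> {..r})\<close> for each \<open>r\<close>, regularised to
  a distribution function in \<open>r\<close>. The regularisation is arranged so that every
  \<open>x\<close>, and not only almost every \<open>x\<close>, yields a distribution function; the
  kernel needs no correction on an exceptional set.\<close>

lemma disintegration_unit_interval:
  fixes M :: "('x \<times> real) measure"
  assumes fin: "finite_measure M" and sM: "sets M = sets (X \<Otimes>\<^sub>M borel)"
    and unit: "AE z in M. snd z \<in> {0..1}"
  shows "\<exists>k \<in> X \<rightarrow>\<^sub>M prob_algebra borel.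
    \<forall>B\<in>sets X. \<forall>C\<in>sets borel. emeasure M (B \<times> C) = (\<integral>\<^sup>+x. emeasure (k x) C * indicator B x \<partial>distr M X fst)"
proof -
  interpret M: finite_measure M by fact
  note sM[measurable_cong]
  have spM: "space M = space X \<times> UNIV" using sets_eq_imp_space_eq[OF sM] by (simp add: space_pair_measure)
  define m where "m = distr M X fst"
  have sm[measurable_cong, simp]: "sets m = sets X" and spm[simp]: "space m = space X" by (auto simp: m_def)
  interpret m: finite_measure m unfolding m_def by (rule M.finite_measure_distr) simp
  have em: "emeasure m B = emeasure M (B \<times> UNIV)" if "B \<in> sets X" for B
    using that sets.sets_into_space[OF that] unfolding m_def
    by (subst emeasure_distr) (auto simp: spM intro!: arg_cong[where f="emeasure M"])
  have rect[measurable]: "B \<times> C \<in> sets M" if "B \<in> sets X" "C \<in> sets borel" for B and C :: "real set"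
    using that by (simp add: sM)
  define N where "N r = distr (density M (\<lambda>z. indicator {..r} (snd z))) X fst" for r :: real
  have eN: "emeasure (N r) B = emeasure M (B \<times> {..r})" if [measurable]: "B \<in> sets X" for B r
  proof -
    have "emeasure (N r) B = (\<integral>\<^sup>+z. indicator {..r} (snd z) * indicator (fst -` B \<inter> space M) z \<partial>M)"
      unfolding N_def by (subst emeasure_distr) (auto simp: emeasure_density)
    also have "\<dots> = (\<integral>\<^sup>+z. indicator (B \<times> {..r}) z \<partial>M)"
      by (intro nn_integral_cong) (auto split: split_indicator)
    finally show ?thesis by simp
  qed
  have sN[simp]: "sets (N r) = sets X" for r by (simp add: N_def)
  have Nle: "emeasure (N r) B \<le> emeasure m B" if "B \<in> sets X" for B r
    unfolding eN[OF that] em[OF that] by (intro emeasure_mono) (use that in auto)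
  have ac: "absolutely_continuous m (N r)" for r
    unfolding absolutely_continuous_def null_sets_def using Nle[of _ r] by (fastforce simp: le_zero_eq)
  have RN: "(\<integral>\<^sup>+x. RN_deriv m (N r) x * indicator B x \<partial>m) = emeasure M (B \<times> {..r})" if [measurable]: "B \<in> sets X" for B r
    by (subst m.RN_deriv_nn_integral[OF ac, symmetric]) (auto simp: eN that)
  have const: "(\<integral>\<^sup>+x. 1 * indicator B x \<partial>m) = emeasure m B" if "B \<in> sets X" for B
    using that by simp
  have RN1: "AE x in m. RN_deriv m (N r) x \<le> 1" for r
  proof (rule AE_le_if_set_integrals_le)
    fix B assume "B \<in> sets m" then have B: "B \<in> sets X" by simp
    show "(\<integral>\<^sup>+x. RN_deriv m (N r) x * indicator B x \<partial>m) \<le> (\<integral>\<^sup>+x. 1 * indicator B x \<partial>m)"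
      unfolding RN[OF B] const[OF B] eN[OF B, symmetric] by (rule Nle[OF B])
  qed (auto simp: m.emeasure_eq_measure)
  \<comment> \<open>The values for \<open>r < 0\<close> and \<open>1 \<le> r\<close> are prescribed,
    which is consistent with \<open>M\<close> living on \<open>{0..1}\<close>; this makes the limits
    at both infinities hold for every \<open>x\<close>. The cut at 1 keeps the function finite
    everywhere.\<close>
  define F :: "real \<Rightarrow> 'x \<Rightarrow> ennreal" where
    "F r x = (if r < 0 then 0 else if 1 \<le> r then 1 else min 1 (RN_deriv m (N r) x))" for r x
  have F_meas[measurable]: "F r \<in> borel_measurable X" for r
  proof -
    have [measurable]: "RN_deriv m (N r) \<in> borel_measurable X"
      using borel_measurable_RN_deriv[of m "N r"] by (simp cong: measurable_cong_sets)
    show ?thesis unfolding F_def by measurable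
  qed
  have F1: "F r x \<le> 1" for r x by (simp add: F_def)
  have FI: "(\<integral>\<^sup>+x. F r x * indicator B x \<partial>m) = emeasure M (B \<times> {..r})" if [measurable]: "B \<in> sets X" for B r
  proof -
    consider "r < 0" | "1 \<le> r" | "0 \<le> r" "r < 1" by linarith
    then show ?thesis
    proof cases
      case 1
      have "emeasure M (B \<times> {..r}) = emeasure M {}"
        by (rule emeasure_eq_AE) (use unit 1 in \<open>auto elim!: AE_mp\<close>)
      with 1 show ?thesis by (simp add: F_def)
    next
      case 2
      have "emeasure M (B \<times> {..r}) = emeasure M (B \<times> UNIV)"
        by (rule emeasure_eq_AE) (use unit 2 in \<open>auto elim!: AE_mp\<close>)
      with 2 show ?thesis by (simp add: F_def em)
    next
      case 3
      have "(\<integral>\<^sup>+x. F r x * indicator B x \<partial>m) = (\<integral>\<^sup>+x. RN_deriv m (N r) x * indicator B x \<partial>m)"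
        by (rule nn_integral_cong_AE) (use RN1[of r] 3 in \<open>auto elim!: AE_mp simp: F_def min_absorb2\<close>)
      then show ?thesis by (simp add: RN)
    qed
  qed
  have Fmono: "AE x in m. F r x \<le> F r' x" if "r \<le> r'" for r r'
  proof (rule AE_le_if_set_integrals_le)
    have "integral\<^sup>N m (F r') \<le> (\<integral>\<^sup>+x. 1 \<partial>m)" by (intro nn_integral_mono F1)
    also have "\<dots> < \<infinity>" by (simp add: m.emeasure_eq_measure)
    finally show "integral\<^sup>N m (F r') \<noteq> \<infinity>" by simp
  next
    fix B assume "B \<in> sets m" then have B[measurable]: "B \<in> sets X" by simp
    show "(\<integral>\<^sup>+x. F r x * indicator B x \<partial>m) \<le> (\<integral>\<^sup>+x. F r' x * indicator B x \<partial>m)"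
      unfolding FI[OF B] by (intro emeasure_mono) (use that in auto)
  qed auto
  \<comment> \<open>An infimum over rationals strictly above \<open>t\<close> is monotone and
    right-continuous in \<open>t\<close> for every \<open>x\<close>, even where \<open>F\<close>
    itself fails to be monotone in \<open>r\<close>.\<close>
  define G where "G x t = (INF r\<in>{r\<in>\<rat>. t < r}. F r x)" for x and t :: real
  have cQ: "countable {r\<in>\<rat>. t < (r::real)}" for t
    by (rule countable_subset[OF _ countable_rat]) auto
  have G_meas[measurable]: "(\<lambda>x. G x t) \<in> borel_measurable X" for t
    unfolding G_def by (rule borel_measurable_INF[OF cQ]) simp
  have neQ: "{r\<in>\<rat>. t < (r::real)} \<noteq> {}" for t
    using Rats_dense_in_real[of t "t + 1"] by auto
  have G1: "G x t \<le> 1" for x t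
    unfolding G_def using neQ[of t] F1 by (meson INF_lower2 ex_in_conv)
  have GI: "(\<integral>\<^sup>+x. G x t * indicator B x \<partial>m) = emeasure M (B \<times> {..t})" if [measurable]: "B \<in> sets X" for B t
  proof -
    \<comment> \<open>For almost every \<open>x\<close> the map \<open>F\<close> is monotone on all
      rationals at once. The infimum over rationals above \<open>t\<close> is then already attained
      along this decreasing sequence, and monotone convergence applies.\<close>
    define r :: "nat \<Rightarrow> real" where "r k = (of_int \<lfloor>t * 2 ^ k\<rfloor> + 1) / 2 ^ k" for k :: nat
    note r = dyadic_upper_approx[of t, folded r_def]
    have "AE x in m. \<forall>a\<in>\<rat>. \<forall>b\<in>\<rat>. a \<le> b \<longrightarrow> F a x \<le> F b x"
      by (intro AE_ball_countable[THEN iffD2] countable_rat ballI) (use Fmono in \<open>auto simp: AE_conj_iff\<close>)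
    then have mono: "AE x in m. \<forall>a\<in>\<rat>. \<forall>b\<in>\<rat>. a \<le> b \<longrightarrow> F a x \<le> F b x" .
    have seq: "r \<longlonglongrightarrow> t"
    proof (rule tendsto_sandwich)
      show "\<forall>\<^sub>F k in sequentially. t \<le> r k" using r(1) by (auto intro: always_eventually less_imp_le)
      show "\<forall>\<^sub>F k in sequentially. r k \<le> t + 1 / 2 ^ k" using r(2) by (auto intro: always_eventually)
      show "(\<lambda>k. t + 1 / 2 ^ k) \<longlonglongrightarrow> t"
        by (rule tendsto_eq_intros LIMSEQ_divide_realpow_zero | simp)+
        qed simp
    have "AE x in m. G x t * indicator B x = (INF k. F (r k) x * indicator B x)"
      using mono
    proof eventually_elim
      case (elim x)
      have "G x t = (INF k. F (r k) x)"
        unfolding G_def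
      proof (rule INF_eq)
        fix a assume a: "a \<in> {r \<in> \<rat>. t < r}"
        then obtain k where "r k < a"
          using order_tendstoD(2)[OF seq, of a] by (auto simp: eventually_sequentially)
        then show "\<exists>k\<in>UNIV. F (r k) x \<le> F a x" using elim a r(4) by (auto intro!: exI[of _ k])
      next
        fix k show "\<exists>a\<in>{r \<in> \<rat>. t < r}. F a x \<le> F (r k) x" using r(1,4) by (intro bexI[of _ "r k"]) auto
      qed
      then show ?case by (auto split: split_indicator)
    qed
    then have "(\<integral>\<^sup>+x. G x t * indicator B x \<partial>m) = (\<integral>\<^sup>+x. (INF k. F (r k) x * indicator B x) \<partial>m)"
      by (rule nn_integral_cong_AE)
    also have "\<dots> = (INF k. \<integral>\<^sup>+x. F (r k) x * indicator B x \<partial>m)"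
    proof (rule nn_integral_monotone_convergence_INF_AE)
      fix k show "AE x in m. F (r (Suc k)) x * indicator B x \<le> F (r k) x * indicator B x"
        using Fmono[OF r(3)[of k]] by eventually_elim (auto split: split_indicator)
      show "(\<integral>\<^sup>+x. F (r 0) x * indicator B x \<partial>m) < \<infinity>"
        by (simp add: FI M.emeasure_eq_measure)
    qed simp
    also have "\<dots> = (INF k. emeasure M (B \<times> {..r k}))" by (simp add: FI)
    also have "\<dots> = emeasure M (\<Inter>k. B \<times> {..r k})"
      by (rule INF_emeasure_decseq) (use r(3) in \<open>auto simp: decseq_Suc_iff intro: order_trans\<close>)
    also have "(\<Inter>k. B \<times> {..r k}) = B \<times> {..t}"
    proof -
      have "s \<le> t \<longleftrightarrow> (\<forall>k. s \<le> r k)" for s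
        using r(1) LIMSEQ_le_const[OF seq] by (meson less_imp_le order_trans)
      then show ?thesis by auto
    qed
    finally show ?thesis .
  qed
  define H where "H x t = enn2real (G x t)" for x t
  have GH: "ennreal (H x t) = G x t" for x t
    unfolding H_def using G1[of x t] by (simp add: ennreal_enn2real_if top_unique split: if_splits) (metis ennreal_one_neq_top top.extremum_uniqueI)
  have H0: "0 \<le> H x t" for x t by (simp add: H_def)
  have Gmono: "G x s \<le> G x t" if "s \<le> t" for x s t
    unfolding G_def by (rule INF_superset_mono) (use that in auto)
  have Hmono: "H x s \<le> H x t" if "s \<le> t" for x s t
    unfolding H_def by (rule enn2real_mono[OF Gmono[OF that]]) (use G1[of x t] in \<open>auto simp: top_unique intro: le_less_trans\<close>)
  have Hright: "continuous (at_right a) (H x)" for x a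
  proof (subst continuous_at_right_real_increasing)
    show "\<And>s t. s \<le> t \<Longrightarrow> H x s \<le> H x t" by (rule Hmono)
    show "\<forall>e>0. \<exists>d>0. H x (a + d) - H x a < e"
    proof safe
      fix e :: real assume e: "0 < e"
      have "G x a < G x a + ennreal e" using e unfolding GH[symmetric, of x a] by (simp add: ennreal_less_iff H_def flip: ennreal_plus)
      then obtain r where r: "r \<in> \<rat>" "a < r" "F r x < G x a + ennreal e"
        unfolding G_def by (auto simp: INF_less_iff)
      have "G x (a + (r - a) / 2) \<le> F r x"
        unfolding G_def by (rule INF_lower) (use r in \<open>auto simp: field_simps\<close>)
      then have "ennreal (H x (a + (r - a) / 2)) < ennreal (H x a + e)"
        using r(3) e ennreal_plus[of "H x a" e, OF _ less_imp_le[OF e]] H0[of x a] by (simp add: GH)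
      then have "H x (a + (r - a) / 2) < H x a + e"
        using e by (subst (asm) ennreal_less_iff) (auto simp: H_def)
      then show "\<exists>d>0. H x (a + d) - H x a < e"
        using r by (intro exI[of _ "(r - a) / 2"]) auto
    qed
  qed
  have Hbot: "(H x \<longlongrightarrow> 0) at_bot" for x
  proof (rule tendsto_eventually)
    have "H x t = 0" if t: "t < 0" for t
    proof -
      obtain r where r: "r \<in> \<rat>" "t < r" "r < 0" using Rats_dense_in_real[OF t] by auto
      have "G x t \<le> F r x" unfolding G_def by (rule INF_lower) (use r in auto)
      then show ?thesis using r by (simp add: H_def F_def)
    qed
    then show "\<forall>\<^sub>F t in at_bot. H x t = 0" by (auto intro: eventually_mono[OF eventually_gt_at_bot[of 0]] simp: eventually_at_bot_dense)
  qed
  have Htop: "(H x \<longlongrightarrow> 1) at_top" for x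
  proof (rule tendsto_eventually)
    have "H x t = 1" if "1 \<le> t" for t
    proof -
      have "G x t = (INF r\<in>{r\<in>\<rat>. t < r}. 1)"
        unfolding G_def by (rule INF_cong) (use that in \<open>auto simp: F_def\<close>)
      then show ?thesis using neQ[of t] by (simp add: H_def)
    qed
    then show "\<forall>\<^sub>F t in at_top. H x t = 1" by (auto intro: eventually_mono[OF eventually_ge_at_top[of 1]])
  qed
  define k where "k x = interval_measure (H x)" for x
  interpret k: real_distribution "k x" for x
    unfolding k_def by (rule real_distribution_interval_measure[OF Hmono Hright Hbot Htop])
  have ek: "emeasure (k x) {..t} = G x t" for x t
    unfolding k_def by (subst emeasure_interval_measure_Iic[OF Hmono Hright Hbot]) (simp_all add: GH)
  have sb: "sets (borel :: real measure) = sigma_sets UNIV (range (\<lambda>t. {..t}))"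
    by (subst borel_eq_atMost) simp
  have istb: "Int_stable (range (\<lambda>t::real. {..t}))"
    by (rule Int_stableI_image) (auto intro!: exI[of _ "min _ _"])
  have km[measurable]: "k \<in> X \<rightarrow>\<^sub>M prob_algebra borel"
  proof (rule measurable_prob_algebra_generated[OF sb istb])
    show "prob_space (k x)" for x by unfold_locales
    fix A assume "A \<in> range (\<lambda>t::real. {..t})"
    then show "(\<lambda>x. emeasure (k x) A) \<in> borel_measurable X" by (auto simp: ek)
  qed (auto simp: k_def)
  have kms[measurable]: "k \<in> X \<rightarrow>\<^sub>M subprob_algebra borel" by (rule measurable_prob_algebraD[OF km])
  have "emeasure M (B \<times> C) = (\<integral>\<^sup>+x. emeasure (k x) C * indicator B x \<partial>m)"
    if B[measurable]: "B \<in> sets X" and C: "C \<in> sets borel" for B C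
  proof (cases "space X = {}")
    case True
    then have "B = {}" using sets.sets_into_space[OF B] by auto
    then show ?thesis by simp
  next
    case ne: False
    \<comment> \<open>With \<open>B\<close> fixed, both sides are finite measures in
      \<open>C\<close>, so agreement on half-lines, which is \<open>GI\<close>, is enough.\<close>
    define M1 where "M1 = distr (density M (\<lambda>z. indicator B (fst z))) borel snd"
    define M2 where "M2 = density m (indicator B) \<bind> k"
    have e1: "emeasure M1 C = emeasure M (B \<times> C)" if [measurable]: "C \<in> sets borel" for C
    proof -
      have "emeasure M1 C = (\<integral>\<^sup>+z. indicator B (fst z) * indicator (snd -` C \<inter> space M) z \<partial>M)"
        unfolding M1_def by (subst emeasure_distr) (auto simp: emeasure_density)
      also have "\<dots> = (\<integral>\<^sup>+z. indicator (B \<times> C) z \<partial>M)"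
        by (intro nn_integral_cong) (auto split: split_indicator simp: spM)
      finally show ?thesis by simp
    qed
    have e2: "emeasure M2 C = (\<integral>\<^sup>+x. emeasure (k x) C * indicator B x \<partial>m)" if [measurable]: "C \<in> sets borel" for C
      unfolding M2_def using ne
      by (subst emeasure_bind[where N=borel]) (auto simp: nn_integral_density mult.commute)
    have "M1 = M2"
    proof (rule measure_eqI_generator_eq[OF istb])
      show "sets M1 = sigma_sets UNIV (range (\<lambda>t. {..t}))" unfolding sb[symmetric] M1_def by simp
      show "sets M2 = sigma_sets UNIV (range (\<lambda>t. {..t}))" unfolding sb[symmetric] M2_def
        using ne by (subst sets_bind[where N=borel]) (auto simp: k_def)
      show "range (\<lambda>i::nat. {..real i}) \<subseteq> range (\<lambda>t. {..t})" by auto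
      show "(\<Union>i::nat. {..real i}) = UNIV" by (auto intro: real_arch_simple)
      show "emeasure M1 {..real i} \<noteq> \<infinity>" for i by (simp add: e1 M.emeasure_eq_measure)
    qed (auto simp: e1 e2 ek GI)
    then show ?thesis using e1[OF C] e2[OF C] by simp
  qed
  then show ?thesis using km unfolding m_def by blast
qed

section \<open>Coding the points of a closed set by real numbers\<close>

lemma ternary_expansion_bounds:
  fixes b :: "nat \<Rightarrow> real"
  assumes "\<And>i. b i \<in> {0, 1}"
  shows "summable (\<lambda>i. b i / 3 ^ Suc i)" "0 \<le> (\<Sum>i. b i / 3 ^ Suc i)" "(\<Sum>i. b i / 3 ^ Suc i) < 1"
proof -
  have s: "(\<lambda>i. 1 / 3 ^ Suc i :: real) sums (1/2)"
    using sums_mult[OF geometric_sums[of "1/3::real"], of "1/3"] by (simp add: power_divide field_simps)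
  have b: "0 \<le> b i" "b i \<le> 1" for i using assms[of i] by auto
  show sb: "summable (\<lambda>i. b i / 3 ^ Suc i)"
    by (rule summable_comparison_test'[OF sums_summable[OF s]]) (use b in \<open>auto simp: divide_right_mono\<close>)
  show "0 \<le> (\<Sum>i. b i / 3 ^ Suc i)" using b by (intro suminf_nonneg sb) auto
  have "(\<Sum>i. b i / 3 ^ Suc i) \<le> (\<Sum>i. 1 / 3 ^ Suc i)"
    by (intro suminf_le sb sums_summable[OF s]) (use b in \<open>auto simp: divide_right_mono\<close>)
  then show "(\<Sum>i. b i / 3 ^ Suc i) < 1" using sums_unique[OF s] by simp
qed

lemma ternary_expansion_shift:
  fixes b :: "nat \<Rightarrow> real"
  assumes b: "\<And>i. b i \<in> {0, 1}"
  shows "3 * (\<Sum>i. b i / 3 ^ Suc i) = b 0 + (\<Sum>i. b (Suc i) / 3 ^ Suc i)"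
proof -
  have "(\<Sum>i. b (Suc i) / 3 ^ Suc (Suc i)) = (\<Sum>i. 1 / 3 * (b (Suc i) / 3 ^ Suc i))" by simp
  also have "\<dots> = 1 / 3 * (\<Sum>i. b (Suc i) / 3 ^ Suc i)"
    by (rule suminf_mult[OF ternary_expansion_bounds(1)]) (rule b)
  finally show ?thesis
    using suminf_split_head[OF ternary_expansion_bounds(1)[of b, OF b]] by simp
qed

text \<open>Multiplication by \<open>3 ^ Suc n\<close> brings digit \<open>n\<close> to the units
  place and turns the earlier digits into multiples of 3. With digits 0 and 1 in base 3 the
  remaining tail is at most 1/2, so the floor never carries; binary expansions would be ambiguous
  here. Digits are thereby measurable functions of the code.\<close>

lemma ternary_digit:
  fixes b :: "nat \<Rightarrow> real"
  assumes "\<And>i. b i \<in> {0, 1}"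
  shows "real_of_int (\<lfloor>3 ^ Suc n * (\<Sum>i. b i / 3 ^ Suc i)\<rfloor> mod 3) = b n"
  using assms
proof (induction n arbitrary: b)
  case (0 b)
  note h = ternary_expansion_bounds[of "\<lambda>i. b (Suc i)", OF "0"]
  have e: "3 * (\<Sum>i. b i / 3 ^ Suc i) = b 0 + (\<Sum>i. b (Suc i) / 3 ^ Suc i)"
    by (rule ternary_expansion_shift) (rule "0")
  have "b 0 = of_int (if b 0 = 0 then 0 else 1)" using 0[of 0] by auto
  moreover have "\<lfloor>3 * (\<Sum>i. b i / 3 ^ Suc i)\<rfloor> = (if b 0 = 0 then 0 else 1)"
    unfolding e using h(2,3) 0[of 0] by (intro floor_unique) auto
  ultimately show ?case by (simp only: power_one_right power_Suc power_0 mult_1_right) auto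
next
  case (Suc n b)
  note h = ternary_expansion_bounds[of "\<lambda>i. b (Suc i)", OF Suc.prems]
  have e: "3 * (\<Sum>i. b i / 3 ^ Suc i) = b 0 + (\<Sum>i. b (Suc i) / 3 ^ Suc i)"
    by (rule ternary_expansion_shift) (rule Suc.prems)
  define z :: int where "z = (if b 0 = 0 then 0 else 1)"
  have z: "b 0 = of_int z" using Suc.prems[of 0] by (auto simp: z_def)
  have "3 ^ Suc (Suc n) * (\<Sum>i. b i / 3 ^ Suc i) = 3 ^ Suc n * (3 * (\<Sum>i. b i / 3 ^ Suc i))" by simp
  also have "\<dots> = of_int (3 * (3 ^ n * z)) + 3 ^ Suc n * (\<Sum>i. b (Suc i) / 3 ^ Suc i)"
    unfolding e z by (simp add: algebra_simps)
  finally have "\<lfloor>3 ^ Suc (Suc n) * (\<Sum>i. b i / 3 ^ Suc i)\<rfloor> = 3 * (3 ^ n * z) + \<lfloor>3 ^ Suc n * (\<Sum>i. b (Suc i) / 3 ^ Suc i)\<rfloor>"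
    by (simp only: int_add_floor)
  then show ?case using Suc.IH[of "\<lambda>i. b (Suc i)", OF Suc.prems] by simp
qed

text \<open>A point is coded by the ternary expansion of its memberships in a countable family of small balls; it is recovered as the
  limit of the centres of the first ball of each radius containing it. Closedness of $A$ keeps the limit in $A$, so no
  measurability of the image of the coding is needed.\<close>

lemma closed_polish_coding:
  fixes A :: "'a::polish_space set"
  assumes A: "closed A" "A \<noteq> {}"
  obtains \<phi> :: "'a \<Rightarrow> real" and g :: "real \<Rightarrow> 'a"
  where "\<phi> \<in> borel_measurable borel" "\<And>a. \<phi> a \<in> {0..1}" "g \<in> borel \<rightarrow>\<^sub>M restrict_space borel A"
    "\<And>a. a \<in> A \<Longrightarrow> g (\<phi> a) = a"
proof -
  obtain T where T: "countable T" "T \<subseteq> A" "A \<subseteq> closure T" using separable[of A] by auto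
  have "T \<noteq> {}" using T(3) A(2) by auto
  define d where "d = from_nat_into T"
  have d: "d k \<in> A" for k unfolding d_def using from_nat_into[OF \<open>T \<noteq> {}\<close>] T(2) by auto
  have dense: "\<exists>k. dist (d k) a < e" if a: "a \<in> A" and e: "0 < e" for a e
  proof -
    have "a \<in> closure T" using a T by auto
    then obtain y where "y \<in> T" "dist y a < e" using e by (auto simp: closure_approachable)
    then show ?thesis unfolding d_def using from_nat_into_surj[OF T(1)] by metis
  qed
  \<comment> \<open>The index \<open>i\<close> codes a pair: the first component fixes the radius,
    the second one the centre.\<close>
  define U where "U i = ball (d (snd (prod_decode i))) (1 / 2 ^ fst (prod_decode i))" for i
  define b :: "nat \<Rightarrow> 'a \<Rightarrow> real" where "b i = indicator (U i)" for i
  define \<phi> where "\<phi> a = (\<Sum>i. b i a / 3 ^ Suc i)" for a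
  have b01: "b i a \<in> {0, 1}" for i a by (auto simp: b_def indicator_def)
  have b_meas: "b i \<in> borel_measurable borel" for i
    unfolding b_def U_def by (intro borel_measurable_indicator borel_open open_ball)
  \<comment> \<open>This is the first centre whose ball of radius \<open>1 / 2 ^ n\<close> contains
    the coded point, expressed through the code \<open>r\<close> alone.\<close>
  define K where "K n r = (LEAST k. \<lfloor>3 ^ Suc (prod_encode (n, k)) * r\<rfloor> mod 3 \<noteq> 0)" for n and r :: real
  have K: "dist (d (K n (\<phi> a))) a < 1 / 2 ^ n" if a: "a \<in> A" for n a
  proof -
    have iff: "\<lfloor>3 ^ Suc (prod_encode (n, k)) * \<phi> a\<rfloor> mod 3 \<noteq> 0 \<longleftrightarrow> dist (d k) a < 1 / 2 ^ n" for k
      using ternary_digit[of "\<lambda>i. b i a" "prod_encode (n, k)", OF b01]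
      by (auto simp: \<phi>_def b_def U_def split: split_indicator_asm)
    obtain k where "dist (d k) a < 1 / 2 ^ n" using dense[OF a, of "1 / 2 ^ n"] by auto
    then have "\<lfloor>3 ^ Suc (prod_encode (n, k)) * \<phi> a\<rfloor> mod 3 \<noteq> 0" by (simp only: iff)
    then have "\<lfloor>3 ^ Suc (prod_encode (n, K n (\<phi> a))) * \<phi> a\<rfloor> mod 3 \<noteq> 0"
      unfolding K_def by (rule LeastI)
    then show ?thesis by (simp only: iff)
  qed
  \<comment> \<open>A real number that codes no point of \<open>A\<close> may give a divergent
    sequence of centres. The constant sequence \<open>d 0\<close> replaces it, so that
    \<open>g\<close> maps all of the reals into \<open>A\<close>.\<close>
  define s where "s n r = (if Cauchy (\<lambda>n. d (K n r)) then d (K n r) else d 0)" for n r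
  define g where "g r = lim (\<lambda>n. s n r)" for r
  have lims: "(\<lambda>n. s n r) \<longlonglongrightarrow> g r" for r
  proof -
    have "convergent (\<lambda>n. s n r)"
      by (cases "Cauchy (\<lambda>n. d (K n r))") (auto simp: s_def convergent_const Cauchy_convergent_iff)
    then show ?thesis unfolding g_def by (simp add: convergent_LIMSEQ_iff)
  qed
  have gA: "g r \<in> A" for r
    by (rule closed_sequentially[OF A(1) _ lims]) (auto simp: s_def d)
  have K_meas[measurable]: "K n \<in> borel \<rightarrow>\<^sub>M count_space UNIV" for n
    unfolding K_def by measurable
  have dK[measurable]: "(\<lambda>r. d (K n r)) \<in> borel_measurable borel" for n
    by (rule measurable_compose[OF K_meas]) simp
  have s_meas: "s n \<in> borel_measurable borel" for n
    unfolding s_def by measurable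
  have g_meas: "g \<in> borel_measurable borel"
    by (rule borel_measurable_LIMSEQ_metric[OF s_meas lims])
  show thesis
  proof (rule that[of \<phi> g])
    show "\<phi> \<in> borel_measurable borel" unfolding \<phi>_def by (intro borel_measurable_suminf borel_measurable_divide b_meas borel_measurable_const)
    show "\<phi> a \<in> {0..1}" for a
      using ternary_expansion_bounds(2,3)[of "\<lambda>i. b i a", OF b01] by (auto simp: \<phi>_def)
    show "g \<in> borel \<rightarrow>\<^sub>M restrict_space borel A"
      by (rule measurable_restrict_space2) (use gA g_meas in auto)
    fix a assume a: "a \<in> A"
    have lim: "(\<lambda>n. d (K n (\<phi> a))) \<longlonglongrightarrow> a"
    proof (rule metric_tendsto_imp_tendsto[where f="\<lambda>n. 1 / 2 ^ n :: real" and a=0])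
      show "(\<lambda>n. 1 / 2 ^ n :: real) \<longlonglongrightarrow> 0" by (rule LIMSEQ_divide_realpow_zero) simp
      show "\<forall>\<^sub>F n in sequentially. dist (d (K n (\<phi> a))) a \<le> dist (1 / 2 ^ n :: real) 0"
        using K[OF a] by (auto intro!: always_eventually less_imp_le)
    qed
    then have "s n (\<phi> a) = d (K n (\<phi> a))" for n by (auto simp: s_def dest: LIMSEQ_imp_Cauchy)
    with lim lims[of "\<phi> a"] show "g (\<phi> a) = a" by (auto dest: LIMSEQ_unique)
  qed
qed

lemma disintegration_closed_polish:
  fixes A :: "'a::polish_space set" and M :: "('x \<times> 'a) measure"
  assumes A: "closed A" "A \<noteq> {}"
    and fin: "finite_measure M" and sM: "sets M = sets (X \<Otimes>\<^sub>M restrict_space borel A)"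
  shows "\<exists>k \<in> X \<rightarrow>\<^sub>M prob_algebra (restrict_space borel A).
    \<forall>f \<in> borel_measurable (X \<Otimes>\<^sub>M restrict_space borel A).
      (\<integral>\<^sup>+z. f z \<partial>M) = (\<integral>\<^sup>+x. \<integral>\<^sup>+a. f (x, a) \<partial>k x \<partial>distr M X fst)"
proof -
  let ?Y = "restrict_space borel A :: 'a measure"
  interpret M: finite_measure M by fact
  note sM[measurable_cong]
  have spM: "space M = space X \<times> A" using sets_eq_imp_space_eq[OF sM] by (simp add: space_pair_measure space_restrict_space)
  obtain \<phi> :: "'a \<Rightarrow> real" and g :: "real \<Rightarrow> 'a" where
    c: "\<phi> \<in> borel_measurable borel" "\<And>a. \<phi> a \<in> {0..1}" "g \<in> borel \<rightarrow>\<^sub>M ?Y" "\<And>a. a \<in> A \<Longrightarrow> g (\<phi> a) = a"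
    using closed_polish_coding[OF A] by blast
  note c(3)[measurable]
  have [measurable]: "\<phi> \<in> borel_measurable ?Y" using c(1) by (rule measurable_restrict_space1)
  define M' where "M' = distr M (X \<Otimes>\<^sub>M borel) (\<lambda>z. (fst z, \<phi> (snd z)))"
  have "\<exists>k \<in> X \<rightarrow>\<^sub>M prob_algebra borel. \<forall>B\<in>sets X. \<forall>C\<in>sets borel.
      emeasure M' (B \<times> C) = (\<integral>\<^sup>+x. emeasure (k x) C * indicator B x \<partial>distr M' X fst)"
  proof (rule disintegration_unit_interval)
    show "finite_measure M'" unfolding M'_def by (rule M.finite_measure_distr) measurable
    show "sets M' = sets (X \<Otimes>\<^sub>M borel)" by (simp add: M'_def)
    show "AE z in M'. snd z \<in> {0..1}" unfolding M'_def using c(2) by (subst AE_distr_iff) auto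
  qed
  then obtain k' where k'[measurable]: "k' \<in> X \<rightarrow>\<^sub>M prob_algebra borel"
    and k'e: "\<And>B C. B \<in> sets X \<Longrightarrow> C \<in> sets borel \<Longrightarrow>
      emeasure M' (B \<times> C) = (\<integral>\<^sup>+x. emeasure (k' x) C * indicator B x \<partial>distr M' X fst)" by blast
  have dd: "distr M' X fst = distr M X fst"
    unfolding M'_def by (subst distr_distr) (auto simp: comp_def)
  define k where "k x = distr (k' x) ?Y g" for x
  have k[measurable]: "k \<in> X \<rightarrow>\<^sub>M prob_algebra ?Y" unfolding k_def by measurable
  have ks[measurable]: "k \<in> X \<rightarrow>\<^sub>M subprob_algebra ?Y" by (rule measurable_prob_algebraD[OF k])
  have k's: "k' \<in> X \<rightarrow>\<^sub>M subprob_algebra borel" by (rule measurable_prob_algebraD[OF k'])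
  define N where "N = distr M X fst \<bind> (\<lambda>x. distr (k x) (X \<Otimes>\<^sub>M ?Y) (Pair x))"
  have Nf: "(\<integral>\<^sup>+z. f z \<partial>N) = (\<integral>\<^sup>+x. \<integral>\<^sup>+a. f (x, a) \<partial>k x \<partial>distr M X fst)"
    if "f \<in> borel_measurable (X \<Otimes>\<^sub>M ?Y)" for f
    unfolding N_def
  proof (rule nn_integral_bind_distr[OF that])
    show "(\<lambda>(x, a). (x, a)) \<in> distr M X fst \<Otimes>\<^sub>M ?Y \<rightarrow>\<^sub>M X \<Otimes>\<^sub>M ?Y" by measurable
    show "k \<in> distr M X fst \<rightarrow>\<^sub>M subprob_algebra ?Y" by simp
  qed
  have "M = N"
  proof (cases "space X = {}")
    \<comment> \<open>Over an empty space \<open>bind\<close> is the empty measure and the kernel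
      formulas say nothing about its sigma-algebra.\<close>
    case True
    then have "space M = {}" "space N = {}" by (auto simp: spM N_def bind_empty)
    then show ?thesis by (metis space_empty)
  next
    case ne: False
    show ?thesis
    proof (rule measure_eqI_rectangles[OF fin sM])
      show sN: "sets N = sets (X \<Otimes>\<^sub>M ?Y)" unfolding N_def using ne by (subst sets_bind[where N="X \<Otimes>\<^sub>M ?Y"]) auto
      fix B C assume B[measurable]: "B \<in> sets X" and C[measurable]: "C \<in> sets ?Y"
      have "emeasure N (B \<times> C) = (\<integral>\<^sup>+z. indicator (B \<times> C) z \<partial>N)" by (simp add: sN)
      also have "\<dots> = (\<integral>\<^sup>+x. \<integral>\<^sup>+a. indicator (B \<times> C) (x, a) \<partial>k x \<partial>distr M X fst)" by (rule Nf) simp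
      also have "\<dots> = (\<integral>\<^sup>+x. emeasure (k' x) (g -` C) * indicator B x \<partial>distr M X fst)"
      proof (rule nn_integral_cong)
        fix x assume "x \<in> space (distr M X fst)"
        then have x: "x \<in> space X" by simp
        note [measurable_cong] = sets_kernel[OF ks x] sets_kernel[OF k's x]
        have "(\<integral>\<^sup>+a. indicator (B \<times> C) (x, a) \<partial>k x) = (\<integral>\<^sup>+a. indicator B x * indicator C a \<partial>k x)"
          by (intro nn_integral_cong) (auto split: split_indicator)
        also have "\<dots> = indicator B x * emeasure (k x) C"
          by (rule nn_integral_cmult_indicator) (simp add: sets_kernel[OF ks x])
        also have "emeasure (k x) C = emeasure (k' x) (g -` C)"
          unfolding k_def by (subst emeasure_distr) (use sets_eq_imp_space_eq[OF sets_kernel[OF k's x]] in auto)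
        finally show "(\<integral>\<^sup>+a. indicator (B \<times> C) (x, a) \<partial>k x) = emeasure (k' x) (g -` C) * indicator B x"
          by (simp add: mult.commute)
      qed
      also have "\<dots> = emeasure M' (B \<times> (g -` C))"
        using measurable_sets[OF c(3) C] by (subst k'e) (auto simp: dd)
      also have "\<dots> = emeasure M (B \<times> C)"
      proof -
        have [measurable]: "g -` C \<in> sets borel" using measurable_sets[OF c(3) C] by simp
        have "C \<subseteq> A" using sets.sets_into_space[OF C] by (auto simp: space_restrict_space)
        then show ?thesis unfolding M'_def using sets.sets_into_space[OF B]
          by (subst emeasure_distr) (auto simp: spM c(4) intro!: arg_cong[where f="emeasure M"])
      qed
      finally show "emeasure M (B \<times> C) = emeasure N (B \<times> C)" ..
    qed
  qed
  then show ?thesis using k Nf by metis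
qed

section \<open>Binding non-measurable kernels\<close>

text \<open>
  \<^const>\<open>ct_marg\<close> binds a kernel that is arbitrary, possibly non-measurable, off the admissible histories. If the
  bind is nevertheless a probability measure, then so is the push-forward of $M$ along $f$; it is setwise dominated by the one
  along $g$ (non-measurable preimages count as $0$), and equal total mass forces equality.
\<close>

lemma bind_cong_null_nonmeasurable:
  assumes M: "prob_space M" and sf: "\<And>x. x \<in> space M \<Longrightarrow> sets (f x) = sets N"
    and g[measurable]: "g \<in> M \<rightarrow>\<^sub>M subprob_algebra N"
    and eq: "AE x in M. f x = g x"
    and P: "prob_space (M \<bind> f)"
  shows "M \<bind> f = M \<bind> g"
proof -
  interpret M: prob_space M by fact
  interpret B: prob_space "M \<bind> f" by fact
  let ?SP = "subprob_algebra N"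
  define D where "D = distr M ?SP f"
  define D0 where "D0 = distr M ?SP g"
  have ne: "space M \<noteq> {}" by (rule M.not_empty)
  have "subprob_algebra (f (SOME x. x \<in> space M)) = ?SP"
    by (rule subprob_algebra_cong, rule sf) (use ne in \<open>simp add: some_in_eq\<close>)
  then have bf: "M \<bind> f = join D" by (simp add: bind_nonempty[OF ne] D_def)
  have bg: "M \<bind> g = join D0" unfolding D0_def by (rule bind_nonempty''[OF g ne])
  have le: "emeasure D B \<le> emeasure D0 B" if B: "B \<in> sets ?SP" for B
  proof -
    have "emeasure M (f -` B \<inter> space M) \<le> emeasure M (g -` B \<inter> space M)"
    proof (cases "f -` B \<inter> space M \<in> sets M")
      case True
      show ?thesis
        by (rule emeasure_mono_AE) (use eq B in \<open>auto elim!: AE_mp\<close>)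
    qed (simp add: emeasure_notin_sets)
    \<comment> \<open>If the preimage masses do not form a measure, \<open>distr\<close> is the zero
      measure by default, which is dominated as well.\<close>
    then have "emeasure D B \<le> emeasure M (g -` B \<inter> space M)"
      unfolding D_def distr_def by (auto simp: emeasure_measure_of_conv)
    also have "\<dots> = emeasure D0 B" unfolding D0_def by (rule emeasure_distr[symmetric, OF g B])
    finally show ?thesis .
  qed
  have sD: "sets D = sets ?SP" "sets D0 = sets ?SP" "space D = space ?SP" "space D0 = space ?SP"
    by (auto simp: D_def D0_def)
  have spB: "space (join D) = space N"
    unfolding bf[symmetric] by (rule space_bind[OF sf ne])
  \<comment> \<open>The members of \<open>subprob_algebra N\<close> have mass at most one, so the
    joined measure cannot have more mass than \<open>D\<close>; hence \<open>D\<close> has full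
    mass.\<close>
  have "1 = emeasure (join D) (space N)" using B.emeasure_space_1 unfolding bf spB by simp
  also have "\<dots> = (\<integral>\<^sup>+\<nu>. emeasure \<nu> (space N) \<partial>D)" by (rule emeasure_join[OF sD(1)]) simp
  also have "\<dots> \<le> (\<integral>\<^sup>+\<nu>. 1 \<partial>D)"
    by (intro nn_integral_mono) (auto simp: sD space_subprob_algebra subprob_space.subprob_emeasure_le_1)
  finally have D1: "1 \<le> emeasure D (space ?SP)" by (simp add: sD)
  interpret D0: prob_space D0
    unfolding D0_def by (rule M.prob_space_distr) simp
  have D1': "emeasure D (space ?SP) = 1"
    using D1 le[of "space ?SP"] D0.emeasure_space_1 by (auto simp: sD intro: antisym)
  have "D = D0"
  proof (rule measure_eqI)
    fix B assume "B \<in> sets D"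
    then have B: "B \<in> sets ?SP" by (simp add: sD)
    have fin: "emeasure D B \<noteq> \<infinity>" using le[OF B] D0.emeasure_finite[of B] by (auto simp: top_unique)
    have c1: "emeasure D (space ?SP - B) = 1 - emeasure D B"
      using emeasure_compl[of B D] B fin by (simp add: sD D1')
    have c2: "emeasure D0 (space ?SP - B) = 1 - emeasure D0 B"
      using emeasure_compl[of B D0] B D0.emeasure_space_1 by (simp add: sD)
    have "1 - emeasure D B \<le> 1 - emeasure D0 B" using le[of "space ?SP - B"] B c1 c2 by simp
    moreover have "emeasure D0 B \<le> 1" by (rule D0.subprob_emeasure_le_1)
    ultimately have "emeasure D0 B \<le> emeasure D B"
      using fin D0.emeasure_finite[of B] by (cases "emeasure D B"; cases "emeasure D0 B")
        (auto simp: ennreal_minus ennreal_le_iff2 ennreal_le_1 simp flip: ennreal_1)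
    then show "emeasure D B = emeasure D0 B" using le[OF B] by simp
  qed (simp add: sD)
  then show ?thesis using bf bg by simp
qed

text \<open>Preimages under \<open>f\<close> and \<open>g\<close> differ at most by the measurable
  null set \<open>{p}\<close>, so they are measurable together and have equal mass. This is used for
  the sojourn time 0, where the policy is unconstrained.\<close>

lemma bind_cong_point_nonmeasurable:
  assumes ne: "space M \<noteq> {}" and sf: "\<And>x. x \<in> space M \<Longrightarrow> sets (f x) = sets N"
    and g[measurable]: "g \<in> M \<rightarrow>\<^sub>M subprob_algebra N"
    and p[measurable]: "{p} \<in> sets M" and p0: "emeasure M {p} = 0" and eq: "\<And>x. x \<in> space M \<Longrightarrow> x \<noteq> p \<Longrightarrow> f x = g x"
  shows "M \<bind> f = M \<bind> g"
proof -
  let ?SP = "subprob_algebra N"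
  have "subprob_algebra (f (SOME x. x \<in> space M)) = ?SP"
    by (rule subprob_algebra_cong, rule sf) (use ne in \<open>simp add: some_in_eq\<close>)
  then have bf: "M \<bind> f = join (distr M ?SP f)" by (simp add: bind_nonempty[OF ne])
  have bg: "M \<bind> g = join (distr M ?SP g)" by (rule bind_nonempty''[OF g ne])
  have "distr M ?SP f = distr M ?SP g"
    unfolding distr_def
  proof (rule measure_of_eq[OF sets.space_closed])
    fix B assume "B \<in> sigma_sets (space ?SP) (sets ?SP)"
    then have B[measurable]: "B \<in> sets ?SP" by (simp add: sets.sigma_sets_eq)
    let ?g = "g -` B \<inter> space M"
    have "f -` B \<inter> space M = (?g - {p}) \<union> (if f p \<in> B then {p} else {})"
    proof (rule set_eqI)
      fix x show "x \<in> f -` B \<inter> space M \<longleftrightarrow> x \<in> (?g - {p}) \<union> (if f p \<in> B then {p} else {})"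
        using eq[of x] sets.sets_into_space[OF p] by (cases "x = p") auto
    qed
    also have "emeasure M \<dots> = emeasure M (?g - {p})"
      by (rule emeasure_Un_null_set) (use p0 in \<open>auto simp: null_sets_def\<close>)
    also have "\<dots> = emeasure M ?g"
      using p0 by (intro emeasure_Diff_null_set) (auto simp: null_sets_def)
    finally show "emeasure M (f -` B \<inter> space M) = emeasure M ?g" .
  qed
  then show ?thesis using bf bg by simp
qed

section \<open>Sojourn times with a bounded measurable jump rate\<close>

text \<open>The derivative vanishes at every point. Applied to the defect of an integral identity,
  this proves the identity although the integrand has no continuity.\<close>

lemma const_if_quadratic_increments:
  fixes f :: "real \<Rightarrow> real"
  assumes f: "\<And>x y. x \<le> y \<Longrightarrow> \<bar>f y - f x\<bar> \<le> C * (y - x)\<^sup>2"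
  shows "f x = f y"
proof -
  have f': "\<bar>f y - f x\<bar> \<le> C * (y - x)\<^sup>2" for x y
    using f[of x y] f[of y x] by (cases "x \<le> y") (auto simp: abs_minus_commute power2_commute)
  have "DERIV f x :> 0" for x
    unfolding DERIV_def
  proof (rule Lim_null_comparison)
    show "\<forall>\<^sub>F h in at 0. norm ((f (x + h) - f x) / h) \<le> C * \<bar>h\<bar>"
    proof (rule eventually_mono[OF eventually_at_ball'[of 1 0 UNIV]])
      fix h :: real assume "h \<in> ball 0 1 \<and> h \<noteq> 0 \<and> h \<in> UNIV"
      then have h: "h \<noteq> 0" by simp
      have "\<bar>f (x + h) - f x\<bar> \<le> C * \<bar>h\<bar> * \<bar>h\<bar>" using f'[of "x + h" x] by (simp add: power2_eq_square mult.assoc)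
      then show "norm ((f (x + h) - f x) / h) \<le> C * \<bar>h\<bar>" using h by (simp add: divide_le_eq)
    qed simp
    show "((\<lambda>h. C * \<bar>h\<bar>) \<longlongrightarrow> 0) (at 0)" by (rule tendsto_eq_intros | simp)+
  qed
  then show ?thesis using DERIV_isconst_all by blast
qed

text \<open>The cumulative hazard of a jump rate; it vanishes for nonpositive times. Like the
  definition of \<open>theta_law\<close> it uses \<open>enn2real\<close>, which would send an
  infinite hazard to 0; the bound on the rate assumed below excludes that case.\<close>

definition cumhaz :: "(real \<Rightarrow> ennreal) \<Rightarrow> real \<Rightarrow> real" where
  "cumhaz \<rho> t = enn2real (\<integral>\<^sup>+s. indicator {0<..t} s * \<rho> s \<partial>lborel)"

definition surv :: "(real \<Rightarrow> ennreal) \<Rightarrow> real \<Rightarrow> ennreal" where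
  "surv \<rho> t = ennreal (exp (- cumhaz \<rho> t))"

text \<open>The mass of the event that no jump occurs is placed on the interval $(-1, 0]$, which \<open>jump_time\<close> maps to
  infinity; thus the law of the sojourn time is the image of a measure with a Lebesgue density.\<close>

definition jump_density :: "(real \<Rightarrow> ennreal) \<Rightarrow> real \<Rightarrow> ennreal" where
  "jump_density \<rho> s = (if 0 < s then \<rho> s * surv \<rho> s
     else if - 1 < s then 1 - (\<integral>\<^sup>+u. indicator {0<..} u * (\<rho> u * surv \<rho> u) \<partial>lborel) else 0)"

definition jump_time :: "real \<Rightarrow> ennreal" where
  "jump_time s = (if 0 < s then ennreal s else \<infinity>)"

definition jump_law :: "(real \<Rightarrow> ennreal) \<Rightarrow> ennreal measure" where
  "jump_law \<rho> = distr (density lborel (jump_density \<rho>)) borel jump_time"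

lemma jump_time_measurable[measurable]: "jump_time \<in> borel_measurable borel"
  unfolding jump_time_def by measurable

lemma surv_measurable:
  assumes [measurable]: "(\<lambda>(h, s). \<rho> h s) \<in> borel_measurable (M \<Otimes>\<^sub>M borel)"
  shows "(\<lambda>(h, s). surv (\<rho> h) s) \<in> borel_measurable (M \<Otimes>\<^sub>M borel)"
proof -
  have "(\<lambda>z. \<integral>\<^sup>+s. indicator {0<..snd z} s * \<rho> (fst z) s \<partial>lborel) \<in> borel_measurable (M \<Otimes>\<^sub>M borel)"
    unfolding greaterThanAtMost_def indicator_inter_arith
    by (intro lborel.borel_measurable_nn_integral) (simp add: indicator_def, measurable)
  then show ?thesis unfolding surv_def cumhaz_def by measurable
qed

lemma jump_density_measurable:
  assumes [measurable]: "(\<lambda>(h, s). \<rho> h s) \<in> borel_measurable (M \<Otimes>\<^sub>M borel)"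
  shows "(\<lambda>(h, s). jump_density (\<rho> h) s) \<in> borel_measurable (M \<Otimes>\<^sub>M borel)"
proof -
  note surv_measurable[OF assms, measurable]
  have [measurable]: "(\<lambda>h. \<integral>\<^sup>+u. indicator {0<..} u * (\<rho> h u * surv (\<rho> h) u) \<partial>lborel) \<in> borel_measurable M"
    by (intro lborel.borel_measurable_nn_integral) measurable
  show ?thesis unfolding jump_density_def by measurable
qed

context
  fixes \<rho> :: "real \<Rightarrow> ennreal" and K :: real
  assumes \<rho>_meas[measurable]: "\<rho> \<in> borel_measurable borel" and \<rho>_le: "\<And>s. \<rho> s \<le> ennreal K" and K: "0 \<le> K"
begin

lemma surv_meas[measurable]: "surv \<rho> \<in> borel_measurable borel"
  using surv_measurable[of "\<lambda>_::unit. \<rho>" "count_space UNIV"] measurable_Pair_compose_split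
  by (auto dest!: measurable_compose[OF measurable_Pair1'[of "()"], rotated])

text \<open>The rate counts only at positive times, whence the \<open>max 0 s\<close>. In this form
  the increments are controlled for negative \<open>s\<close> too, as the differentiation argument
  on the whole line requires.\<close>

lemma cumhaz_increment:
  assumes "s \<le> t"
  shows "(\<integral>\<^sup>+u. indicator {0<..t} u * \<rho> u \<partial>lborel) = ennreal (cumhaz \<rho> t)"
    and "(\<integral>\<^sup>+u. indicator {max 0 s<..t} u * \<rho> u \<partial>lborel) = ennreal (cumhaz \<rho> t - cumhaz \<rho> s)"
    and "cumhaz \<rho> s \<le> cumhaz \<rho> t" "cumhaz \<rho> t - cumhaz \<rho> s \<le> K * (t - s)"
proof -
  have le: "(\<integral>\<^sup>+u. indicator {a<..b} u * \<rho> u \<partial>lborel) \<le> ennreal (K * max 0 (b - a))" for a b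
  proof -
    have "(\<integral>\<^sup>+u. indicator {a<..b} u * \<rho> u \<partial>lborel) \<le> (\<integral>\<^sup>+u. ennreal K * indicator {a<..b} u \<partial>lborel)"
      by (intro nn_integral_mono) (auto split: split_indicator simp: \<rho>_le)
    also have "\<dots> = ennreal (K * max 0 (b - a))"
      using K by (cases "a \<le> b") (auto simp: nn_integral_cmult_indicator ennreal_mult' max_def)
    finally show ?thesis .
  qed
  have eq: "(\<integral>\<^sup>+u. indicator {0<..t} u * \<rho> u \<partial>lborel) = ennreal (cumhaz \<rho> t)" for t
    unfolding cumhaz_def using neq_top_trans[OF ennreal_neq_top le[of 0 t]] by (simp add: ennreal_enn2real_if)
  show "(\<integral>\<^sup>+u. indicator {0<..t} u * \<rho> u \<partial>lborel) = ennreal (cumhaz \<rho> t)" by (rule eq)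
  let ?I = "\<integral>\<^sup>+u. indicator {max 0 s<..t} u * \<rho> u \<partial>lborel"
  have "(\<integral>\<^sup>+u. indicator {0<..t} u * \<rho> u \<partial>lborel)
    = (\<integral>\<^sup>+u. indicator {0<..s} u * \<rho> u + indicator {max 0 s<..t} u * \<rho> u \<partial>lborel)"
    by (intro nn_integral_cong) (use assms in \<open>auto split: split_indicator\<close>)
  also have "\<dots> = (\<integral>\<^sup>+u. indicator {0<..s} u * \<rho> u \<partial>lborel) + ?I"
    by (rule nn_integral_add) auto
  finally have split: "ennreal (cumhaz \<rho> t) = ennreal (cumhaz \<rho> s) + ?I" unfolding eq .
  have "?I \<noteq> \<infinity>" using le[of "max 0 s" t] by (auto simp: top_unique)
  then obtain i where i: "?I = ennreal i" "0 \<le> i" by (cases ?I) auto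
  have "0 \<le> cumhaz \<rho> s" "0 \<le> cumhaz \<rho> t" by (auto simp: cumhaz_def)
  then have ti: "cumhaz \<rho> t = cumhaz \<rho> s + i" using split i by (simp flip: ennreal_plus)
  then show "cumhaz \<rho> s \<le> cumhaz \<rho> t" using i by simp
  show "?I = ennreal (cumhaz \<rho> t - cumhaz \<rho> s)" using ti i by simp
  have "ennreal i \<le> ennreal (K * max 0 (t - max 0 s))" using le[of "max 0 s" t] i by simp
  then have "i \<le> K * max 0 (t - max 0 s)" using K by (subst (asm) ennreal_le_iff) auto
  also have "\<dots> \<le> K * (t - s)" using K assms by (intro mult_left_mono) auto
  finally show "cumhaz \<rho> t - cumhaz \<rho> s \<le> K * (t - s)" using ti by simp
qed

text \<open>The rate is only measurable, so the fundamental theorem of calculus is not available; but the difference of both sides has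
  increments of quadratic order and is therefore constant.\<close>

lemma surv_identity:
  "(\<integral>\<^sup>+s. indicator {0<..t} s * (\<rho> s * surv \<rho> s) \<partial>lborel) = ennreal (1 - exp (- cumhaz \<rho> t))"
proof -
  let ?L = "cumhaz \<rho>"
  define E where "E t = (\<integral>\<^sup>+s. indicator {0<..t} s * (\<rho> s * surv \<rho> s) \<partial>lborel)" for t
  define D where "D t = enn2real (E t) - (1 - exp (- ?L t))" for t
  have exp_bounds: "(y - x) * exp (- y) \<le> exp (- x) - exp (- y)" "exp (- x) - exp (- y) \<le> (y - x) * exp (- x)"
    for x y :: real
  proof -
    have "(1 + (y - x)) * exp (- y) \<le> exp (y - x) * exp (- y)" by (intro mult_right_mono exp_ge_add_one_self) auto
    then show "(y - x) * exp (- y) \<le> exp (- x) - exp (- y)" by (simp add: algebra_simps flip: exp_add)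
    have "(1 + (x - y)) * exp (- x) \<le> exp (x - y) * exp (- x)" by (intro mult_right_mono exp_ge_add_one_self) auto
    then show "exp (- x) - exp (- y) \<le> (y - x) * exp (- x)" by (simp add: algebra_simps flip: exp_add)
  qed
  have abs_diff_le: "d = i - e \<Longrightarrow> i \<le> b \<Longrightarrow> a \<le> i \<Longrightarrow> a \<le> e \<Longrightarrow> e \<le> b \<Longrightarrow> \<bar>d\<bar> \<le> b - a"
    for a b d e i :: real by linarith
  have E_le: "E t \<le> ennreal (?L t)" for t
    unfolding E_def cumhaz_increment(1)[OF order_refl, symmetric]
    by (intro nn_integral_mono mult_left_mono) (auto simp: surv_def cumhaz_def intro!: mult_left_le)
  have Efin: "E t = ennreal (enn2real (E t))" for t using neq_top_trans[OF ennreal_neq_top E_le[of t]] by (simp add: ennreal_enn2real_if)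
  \<comment> \<open>Both the increment of \<open>E\<close> and that of \<open>- exp (- ?L)\<close>
    lie between \<open>?L t - ?L s\<close> times the smaller and times the larger end value of
    \<open>exp (- ?L)\<close>. They differ by at most \<open>?L t - ?L s\<close> times the drop of
    the exponential, which is at most the square of \<open>?L t - ?L s\<close>, and
    \<open>?L\<close> is Lipschitz with constant \<open>K\<close>.\<close>
  have inc: "\<bar>D t - D s\<bar> \<le> K\<^sup>2 * (t - s)\<^sup>2" if st: "s \<le> t" for s t
  proof -
    note inc = cumhaz_increment[OF st]
    let ?I = "\<integral>\<^sup>+u. indicator {max 0 s<..t} u * (\<rho> u * surv \<rho> u) \<partial>lborel"
    have "E t = (\<integral>\<^sup>+u. indicator {0<..s} u * (\<rho> u * surv \<rho> u) + indicator {max 0 s<..t} u * (\<rho> u * surv \<rho> u) \<partial>lborel)"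
      unfolding E_def by (intro nn_integral_cong) (use st in \<open>auto split: split_indicator\<close>)
    also have "\<dots> = E s + ?I" unfolding E_def by (rule nn_integral_add) auto
    finally have split: "E t = E s + ?I" .
    have up: "?I \<le> ennreal ((?L t - ?L s) * exp (- ?L s))"
    proof -
      have "?I \<le> (\<integral>\<^sup>+u. indicator {max 0 s<..t} u * \<rho> u * ennreal (exp (- ?L s)) \<partial>lborel)"
        by (intro nn_integral_mono) (auto split: split_indicator simp: surv_def cumhaz_increment(3) intro!: mult_left_mono ennreal_leI)
      also have "\<dots> = ennreal ((?L t - ?L s) * exp (- ?L s))"
        using inc(3) by (subst nn_integral_multc) (auto simp: inc(2) ennreal_mult)
      finally show ?thesis .
    qed
    have lo: "ennreal ((?L t - ?L s) * exp (- ?L t)) \<le> ?I"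
    proof -
      have "ennreal ((?L t - ?L s) * exp (- ?L t)) = (\<integral>\<^sup>+u. indicator {max 0 s<..t} u * \<rho> u * ennreal (exp (- ?L t)) \<partial>lborel)"
        using inc(3) by (subst nn_integral_multc) (auto simp: inc(2) ennreal_mult)
      also have "\<dots> \<le> ?I"
        by (intro nn_integral_mono) (auto split: split_indicator simp: surv_def cumhaz_increment(3) intro!: mult_left_mono ennreal_leI)
      finally show ?thesis .
    qed
    have "?I \<noteq> \<infinity>" using up by (auto simp: top_unique)
    then obtain i where i: "?I = ennreal i" "0 \<le> i" by (cases ?I) auto
    have "enn2real (E t) = enn2real (E s) + i"
    proof -
      have "ennreal (enn2real (E t)) = ennreal (enn2real (E s) + i)"
        using split i Efin[of s] Efin[of t] by (simp add: ennreal_plus)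
      then show ?thesis using i by (subst (asm) ennreal_inj) auto
    qed
    then have "D t - D s = i - (exp (- ?L s) - exp (- ?L t))" by (simp add: D_def)
    moreover have "i \<le> (?L t - ?L s) * exp (- ?L s)" using up i inc(3) by (simp add: ennreal_le_iff)
    moreover have "(?L t - ?L s) * exp (- ?L t) \<le> i" using lo i inc(3) by (simp add: ennreal_le_iff)
    ultimately have "\<bar>D t - D s\<bar> \<le> (?L t - ?L s) * exp (- ?L s) - (?L t - ?L s) * exp (- ?L t)"
      using abs_diff_le exp_bounds(1)[of "?L t" "?L s"] exp_bounds(2)[of "?L s" "?L t"] by blast
    also have "\<dots> = (?L t - ?L s) * (exp (- ?L s) - exp (- ?L t))" by (simp add: algebra_simps)
    also have "\<dots> \<le> (?L t - ?L s) * (?L t - ?L s)"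
    proof (rule mult_left_mono)
      have "(?L t - ?L s) * exp (- ?L s) \<le> (?L t - ?L s) * 1"
        using inc(3) by (intro mult_left_mono) (auto simp: cumhaz_def)
      then show "exp (- ?L s) - exp (- ?L t) \<le> ?L t - ?L s" using exp_bounds(2)[of "?L s" "?L t"] by simp
    qed (use inc(3) in simp)
    also have "\<dots> \<le> (K * (t - s)) * (K * (t - s))" using inc K st by (intro mult_mono) auto
    finally show ?thesis by (simp add: power2_eq_square algebra_simps)
  qed
  have "D t = D 0" by (rule const_if_quadratic_increments[OF inc])
  also have "D 0 = 0" by (simp add: D_def E_def cumhaz_def)
  finally have "enn2real (E t) = 1 - exp (- ?L t)" by (simp add: D_def)
  then show ?thesis using Efin[of t] unfolding E_def by metis
qed

lemma surv_total_le_1: "(\<integral>\<^sup>+u. indicator {0<..} u * (\<rho> u * surv \<rho> u) \<partial>lborel) \<le> 1"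
proof -
  have "(\<integral>\<^sup>+u. indicator {0<..} u * (\<rho> u * surv \<rho> u) \<partial>lborel)
    = (\<integral>\<^sup>+u. (SUP n::nat. indicator {0<..real n} u * (\<rho> u * surv \<rho> u)) \<partial>lborel)"
  proof (intro nn_integral_cong)
    fix u :: real
    obtain n :: nat where "u \<le> real n" using real_arch_simple by blast
    then have "(indicator {0<..} u :: ennreal) * x \<le> indicator {0<..real n} u * x" for x by (auto split: split_indicator)
    moreover have "(indicator {0<..real n} u :: ennreal) * x \<le> indicator {0<..} u * x" for x n by (auto split: split_indicator)
    ultimately show "indicator {0<..} u * (\<rho> u * surv \<rho> u) = (SUP n::nat. indicator {0<..real n} u * (\<rho> u * surv \<rho> u))"
      by (intro antisym SUP_least SUP_upper2[of n]) auto
  qed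
  also have "\<dots> = (SUP n::nat. \<integral>\<^sup>+u. indicator {0<..real n} u * (\<rho> u * surv \<rho> u) \<partial>lborel)"
    by (rule nn_integral_monotone_convergence_SUP) (auto simp: incseq_def le_fun_def split: split_indicator)
  also have "\<dots> \<le> 1" by (intro SUP_least) (auto simp: surv_identity)
  finally show ?thesis .
qed

lemma jump_density_meas[measurable]: "jump_density \<rho> \<in> borel_measurable borel"
  unfolding jump_density_def by measurable

text \<open>The no-jump mass is sent to infinity and lies in every tail. Together with the mass of
  the jumps after \<open>t\<close> it makes up one minus the mass of the jumps up to
  \<open>t\<close>, which \<open>surv_identity\<close> evaluates.\<close>

lemma jump_density_tail:
  assumes t: "0 \<le> t"
  shows "(\<integral>\<^sup>+s. jump_density \<rho> s * indicator {\<theta>. ennreal t \<le> \<theta>} (jump_time s) \<partial>lborel) = surv \<rho> t"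
proof -
  let ?r = "\<lambda>s. \<rho> s * surv \<rho> s"
  let ?T = "\<integral>\<^sup>+u. indicator {0<..} u * ?r u \<partial>lborel"
  let ?E = "\<integral>\<^sup>+u. indicator {0<..t} u * ?r u \<partial>lborel"
  let ?X = "\<integral>\<^sup>+u. indicator {t<..} u * ?r u \<partial>lborel"
  have "?T = (\<integral>\<^sup>+u. indicator {0<..t} u * ?r u + indicator {t<..} u * ?r u \<partial>lborel)"
    by (intro nn_integral_cong) (use t in \<open>auto split: split_indicator\<close>)
  also have "\<dots> = ?E + ?X" by (rule nn_integral_add) auto
  finally have T: "?T = ?E + ?X" .
  have "(\<integral>\<^sup>+s. jump_density \<rho> s * indicator {\<theta>. ennreal t \<le> \<theta>} (jump_time s) \<partial>lborel)
    = (\<integral>\<^sup>+s. (1 - ?T) * indicator {-1<..0} s + indicator {t<..} s * ?r s \<partial>lborel)"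
  proof (rule nn_integral_cong_AE)
    \<comment> \<open>The tail is closed at \<open>t\<close> while the integral on the right is over
      times after \<open>t\<close>; the difference is a null set.\<close>
    have "AE s in lborel. s \<noteq> t" by (rule AE_lborel_singleton)
    then show "AE s in lborel. jump_density \<rho> s * indicator {\<theta>. ennreal t \<le> \<theta>} (jump_time s)
        = (1 - ?T) * indicator {-1<..0} s + indicator {t<..} s * ?r s"
      by eventually_elim (use t in \<open>auto split: split_indicator simp: jump_density_def jump_time_def ennreal_le_iff\<close>)
  qed
  also have "\<dots> = (1 - ?T) + ?X"
    by (subst nn_integral_add) (auto simp: nn_integral_cmult_indicator)
  also have "\<dots> = 1 - ?E"
  proof -
    have "?E + ?X \<le> 1" using T surv_total_le_1 by simp
    then show ?thesis unfolding T by (cases ?E; cases ?X)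
      (auto simp: ennreal_minus ennreal_le_1 top_add add_top top_unique simp flip: ennreal_1 ennreal_plus)
  qed
  also have "\<dots> = surv \<rho> t"
    by (simp only: surv_identity) (simp add: surv_def ennreal_minus cumhaz_def flip: ennreal_1)
  finally show ?thesis .
qed

lemma nn_integral_jump_law:
  assumes [measurable]: "f \<in> borel_measurable borel"
  shows "(\<integral>\<^sup>+\<theta>. f \<theta> \<partial>jump_law \<rho>) = (\<integral>\<^sup>+s. jump_density \<rho> s * f (jump_time s) \<partial>lborel)"
  unfolding jump_law_def by (subst nn_integral_distr) (auto simp: nn_integral_density)

lemma jump_law_tail: "0 \<le> t \<Longrightarrow> emeasure (jump_law \<rho>) {\<theta>. ennreal t \<le> \<theta>} = surv \<rho> t"
  using nn_integral_jump_law[of "indicator {\<theta>. ennreal t \<le> \<theta>}"] jump_density_tail[of t]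
  by (simp add: jump_law_def)

lemma prob_space_jump_law: "prob_space (jump_law \<rho>)"
proof
  have "{\<theta>::ennreal. ennreal 0 \<le> \<theta>} = UNIV" by auto
  then show "emeasure (jump_law \<rho>) (space (jump_law \<rho>)) = 1"
    using jump_law_tail[of 0] by (simp add: jump_law_def surv_def cumhaz_def)
qed

text \<open>Closed tails form an intersection-stable generator. The hypothesis fixes those with
  finite left end, and the one at infinity follows by continuity from above along the integers.
  Uniqueness is what resolves the definite description in \<open>theta_law\<close>.\<close>

lemma jump_law_unique:
  assumes s: "sets \<nu> = sets (borel :: ennreal measure)" and "prob_space \<nu>"
    and tail: "\<And>t::real. 0 \<le> t \<Longrightarrow> emeasure \<nu> {\<theta>. ennreal t \<le> \<theta>} = surv \<rho> t"
  shows "\<nu> = jump_law \<rho>"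
proof -
  interpret \<nu>: prob_space \<nu> by fact
  interpret J: prob_space "jump_law \<rho>" by (rule prob_space_jump_law)
  have sb: "sets (borel :: ennreal measure) = sigma_sets UNIV (range (\<lambda>t. {t..}))"
  proof -
    have "sigma_sets UNIV (range lessThan) = sigma_sets UNIV (range (\<lambda>t::ennreal. {t..}))"
    proof (rule sigma_sets_eqI)
      fix A assume "A \<in> range (lessThan :: ennreal \<Rightarrow> _)"
      then obtain a where "A = {..<a}" by auto
      then have "A = UNIV - {a..}" by auto
      then show "A \<in> sigma_sets UNIV (range (\<lambda>t::ennreal. {t..}))"
        by (simp only:) (intro sigma_sets.Compl sigma_sets.Basic, auto)
    next
      fix A assume "A \<in> range (\<lambda>t::ennreal. {t..})"
      then obtain a where "A = {a..}" by auto
      then have "A = UNIV - {..<a}" by auto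
      then show "A \<in> sigma_sets UNIV (range lessThan)"
        by (simp only:) (intro sigma_sets.Compl sigma_sets.Basic, auto)
    qed
    then show ?thesis by (subst borel_Iio) simp
  qed
  have sJ: "sets (jump_law \<rho>) = sets borel" by (simp add: jump_law_def)
  have fin: "emeasure \<nu> {x..} = emeasure (jump_law \<rho>) {x..}" if "x \<noteq> \<infinity>" for x
    using that tail[of "enn2real x"] jump_law_tail[of "enn2real x"]
    by (simp add: ennreal_enn2real_if atLeast_def)
  have inf: "{\<infinity>..} = (\<Inter>n::nat. {of_nat n :: ennreal..})"
    by (auto simp: top_unique) (metis ennreal_Ex_less_of_nat not_le top.not_eq_extremum)
  show ?thesis
  proof (rule measure_eqI_generator_eq[where A="\<lambda>_. {0..}"])
    show "Int_stable (range (\<lambda>t::ennreal. {t..}))"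
    proof (rule Int_stableI_image)
      fix i j :: ennreal show "\<exists>k\<in>UNIV. {i..} \<inter> {j..} = {k..}" by (rule bexI[of _ "max i j"]) auto
    qed
    fix X :: "ennreal set" assume "X \<in> range (\<lambda>t. {t..})"
    then obtain x where X: "X = {x..}" by auto
    show "emeasure \<nu> X = emeasure (jump_law \<rho>) X"
    proof (cases "x = \<infinity>")
      case True
      have "emeasure \<nu> X = (INF n::nat. emeasure \<nu> {of_nat n..})"
        unfolding X True inf by (rule INF_emeasure_decseq[symmetric]) (auto simp: s decseq_def intro: order_trans[rotated] of_nat_mono)
      also have "\<dots> = (INF n::nat. emeasure (jump_law \<rho>) {of_nat n..})"
        by (intro INF_cong refl fin) simp
      also have "\<dots> = emeasure (jump_law \<rho>) X"
        unfolding X True inf by (rule INF_emeasure_decseq) (auto simp: sJ decseq_def intro: order_trans[rotated] of_nat_mono)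
      finally show ?thesis .
    qed (simp add: X fin)
  next
    show "sets \<nu> = sigma_sets UNIV (range (\<lambda>t. {t..}))" "sets (jump_law \<rho>) = sigma_sets UNIV (range (\<lambda>t. {t..}))"
      using s sJ sb by auto
    show "range (\<lambda>i::nat. {0::ennreal..}) \<subseteq> range (\<lambda>t. {t..})" by auto
    show "(\<Union>i::nat. {0::ennreal..}) = UNIV" by auto
  qed auto
qed

end

text \<open>If the total jump probability were \<open>T < 1\<close>, survival would stay above
  \<open>1 - T\<close> at all times and its integral would be infinite.\<close>

lemma surv_total_eq_1:
  assumes \<rho>: "\<rho> \<in> borel_measurable borel" "\<And>s. \<rho> s \<le> ennreal K" "0 \<le> K"
    and fin: "(\<integral>\<^sup>+s. indicator {0<..} s * surv \<rho> s \<partial>lborel) < \<infinity>"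
  shows "(\<integral>\<^sup>+u. indicator {0<..} u * (\<rho> u * surv \<rho> u) \<partial>lborel) = 1" (is "?T = 1")
proof (rule antisym[OF surv_total_le_1[OF \<rho>]], rule ccontr)
  assume "\<not> 1 \<le> ?T"
  then have "?T < ennreal 1" by simp
  then obtain T where T: "?T = ennreal T" "0 \<le> T" "T < 1" by (cases ?T) (auto simp: ennreal_less_iff simp del: ennreal_1)
  obtain c where c: "(\<integral>\<^sup>+s. indicator {0<..} s * surv \<rho> s \<partial>lborel) = ennreal c" "0 \<le> c"
    using fin by (cases "\<integral>\<^sup>+s. indicator {0<..} s * surv \<rho> s \<partial>lborel") auto
  have lo: "1 - T \<le> exp (- cumhaz \<rho> t)" for t
  proof -
    have "ennreal (1 - exp (- cumhaz \<rho> t)) \<le> ?T"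
      unfolding surv_identity[OF \<rho>, symmetric] by (intro nn_integral_mono) (auto split: split_indicator)
    then show ?thesis using T by (simp add: ennreal_le_iff)
  qed
  \<comment> \<open>Chosen so that \<open>(1 - T) * t\<close> equals \<open>c + 1\<close> and
    exceeds the finite integral \<open>c\<close>.\<close>
  define t where "t = (c + 1) / (1 - T)"
  have t: "0 < t" using c T by (simp add: t_def)
  have "ennreal ((1 - T) * t) = (\<integral>\<^sup>+s. ennreal (1 - T) * indicator {0<..t} s \<partial>lborel)"
    using t T by (simp add: nn_integral_cmult_indicator ennreal_mult')
  also have "\<dots> \<le> (\<integral>\<^sup>+s. indicator {0<..} s * surv \<rho> s \<partial>lborel)"
    by (intro nn_integral_mono) (auto split: split_indicator simp: surv_def intro!: ennreal_leI lo)
  finally have "(1 - T) * t \<le> c" using c by (simp add: ennreal_le_iff)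
  then show False using T by (simp add: t_def)
qed

section \<open>Transition measures on the state space with cemetery\<close>

lemma space_MS[simp]: "space (MS S) = S" by (simp add: MS_def space_restrict_space)
lemma space_MA[simp]: "space (MA A) = A" by (simp add: MA_def space_restrict_space)

lemma MSi_sigma_algebra:
  "sigma_algebra (insert None (Some ` S)) {B. B \<subseteq> insert None (Some ` S) \<and> Some -` B \<in> sets (MS S)}"
proof (rule sigma_algebra_iff2[THEN iffD2], safe)
  show "Some -` {} \<in> sets (MS S)" by simp
  fix B assume B: "B \<subseteq> insert None (Some ` S)" "Some -` B \<in> sets (MS S)"
  have "Some -` (insert None (Some ` S) - B) = S - Some -` B" by auto
  then show "Some -` (insert None (Some ` S) - B) \<in> sets (MS S)" using sets.compl_sets[OF B(2)] by simp
next
  fix F :: "nat \<Rightarrow> 'a option set"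
  assume "range F \<subseteq> {B. B \<subseteq> insert None (Some ` S) \<and> Some -` B \<in> sets (MS S)}"
  then show "Some -` (\<Union>i. F i) \<in> sets (MS S)" by (auto simp: vimage_UN)
qed auto

lemma space_MSi[simp]: "space (MSi S) = insert None (Some ` S)"
  unfolding MSi_def by (rule space_measure_of) auto

lemma sets_MSi: "sets (MSi S) = {B. B \<subseteq> insert None (Some ` S) \<and> Some -` B \<in> sets (MS S)}"
  unfolding MSi_def by (rule sigma_algebra.sets_measure_of_eq[OF MSi_sigma_algebra])

lemma vimage_Some_sets: "B \<in> sets (MSi S) \<Longrightarrow> Some -` B \<in> sets (MS S)" by (simp add: sets_MSi)

lemma image_Some_sets: "G \<in> sets (MS S) \<Longrightarrow> Some ` G \<in> sets (MSi S)"
  using sets.sets_into_space[of G "MS S"] by (auto simp: sets_MSi inj_vimage_image_eq)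

lemma None_sets_MSi: "{None} \<in> sets (MSi S)" by (auto simp: sets_MSi vimage_def)

lemma Some_measurable[measurable]: "Some \<in> MS S \<rightarrow>\<^sub>M MSi S"
proof (rule measurableI)
  fix B assume B: "B \<in> sets (MSi S)"
  then have "Some -` B \<inter> space (MS S) = Some -` B" using sets.sets_into_space[OF vimage_Some_sets[OF B]] by auto
  then show "Some -` B \<inter> space (MS S) \<in> sets (MS S)" using vimage_Some_sets[OF B] by simp
qed auto

lemma measurable_MSi:
  assumes "f None \<in> space N" and f: "(\<lambda>x. f (Some x)) \<in> MS S \<rightarrow>\<^sub>M N"
  shows "f \<in> MSi S \<rightarrow>\<^sub>M N"
proof (rule measurableI)
  fix y assume "y \<in> space (MSi S)"
  then show "f y \<in> space N" using assms(1) measurable_space[OF f] by auto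
next
  fix B assume "B \<in> sets N"
  then have "(\<lambda>x. f (Some x)) -` B \<inter> S \<in> sets (MS S)" using measurable_sets[OF f] by simp
  moreover have "Some -` (f -` B \<inter> space (MSi S)) = (\<lambda>x. f (Some x)) -` B \<inter> S" by auto
  ultimately show "f -` B \<inter> space (MSi S) \<in> sets (MSi S)" by (auto simp: sets_MSi)
qed

text \<open>Composition with the \<open>Some\<close> branch needs a total retraction of
  \<open>MSi S\<close> onto \<open>S\<close>; the point \<open>x0\<close> supplies its value at
  \<open>None\<close>.\<close>

lemma measurable_MSi_pair:
  assumes x0: "x0 \<in> S" and N: "F None \<in> K \<rightarrow>\<^sub>M N" and F: "(\<lambda>(x, a). F (Some x) a) \<in> MS S \<Otimes>\<^sub>M K \<rightarrow>\<^sub>M N"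
  shows "(\<lambda>(y, a). F y a) \<in> MSi S \<Otimes>\<^sub>M K \<rightarrow>\<^sub>M N"
proof -
  note None_sets_MSi[measurable]
  define g where "g y = (case y of None \<Rightarrow> x0 | Some x \<Rightarrow> x)" for y
  have [measurable]: "g \<in> MSi S \<rightarrow>\<^sub>M MS S"
    by (rule measurable_MSi) (use x0 in \<open>auto simp: g_def\<close>)
  have "(\<lambda>(y, a). if y \<in> {None} then F None a else F (Some (g y)) a) \<in> MSi S \<Otimes>\<^sub>M K \<rightarrow>\<^sub>M N"
    using N F by measurable
  moreover have "(\<lambda>(y, a). if y \<in> {None} then F None a else F (Some (g y)) a) = (\<lambda>(y, a). F y a)"
    by (auto simp: fun_eq_iff g_def split: option.split)
  ultimately show ?thesis by simp
qed

context
  fixes S :: "'s::topological_space set" and \<mu> :: "'s measure" and rt :: "'s set \<Rightarrow> real" and r :: real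
  assumes fin: "finite_measure \<mu>" and s: "sets \<mu> = sets (MS S)"
    and rt: "\<And>G. G \<in> sets (MS S) \<Longrightarrow> rt G = measure \<mu> G" and r: "r = measure \<mu> S"
begin

text \<open>\<open>trans_meas\<close> is a \<open>measure_of\<close> of an explicit set function,
  whose values are usable only once it is known to be a measure. It is matched with one here: for
  \<open>r = 0\<close> the convention 0/0 = 0 leaves all mass to \<open>None\<close>, and otherwise
  the normalised measure has mass one and nothing is left for \<open>None\<close>.\<close>

lemma emeasure_normalized_measure:
  assumes B: "B \<in> sets (MSi S)"
  shows "emeasure (if r = 0 then return (MSi S) None else distr (density \<mu> (\<lambda>_. ennreal (1 / r))) (MSi S) Some) B =
    ennreal (rt (Some -` B) / r) + (if None \<in> B then ennreal (1 - rt S / r) else 0)"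
proof (cases "r = 0")
  case True then show ?thesis using B by (auto simp: indicator_def)
next
  case False
  interpret finite_measure \<mu> by (rule fin)
  note s[measurable_cong]
  note vB = vimage_Some_sets[OF B]
  have SS: "S \<in> sets (MS S)" using sets.top[of "MS S"] by simp
  have "emeasure (distr (density \<mu> (\<lambda>_. ennreal (1 / r))) (MSi S) Some) B
      = emeasure (density \<mu> (\<lambda>_. ennreal (1 / r))) (Some -` B \<inter> space \<mu>)"
    using B by (simp add: emeasure_distr)
  also have "Some -` B \<inter> space \<mu> = Some -` B"
    using sets.sets_into_space[OF vB] sets_eq_imp_space_eq[OF s] by auto
  also have "emeasure (density \<mu> (\<lambda>_. ennreal (1 / r))) (Some -` B) = ennreal (1 / r) * emeasure \<mu> (Some -` B)"
    using vB by (subst emeasure_density) (auto simp: s nn_integral_cmult_indicator)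
  also have "\<dots> = ennreal (rt (Some -` B) / r)"
    by (simp add: rt[OF vB] r emeasure_eq_measure flip: ennreal_mult)
  finally show ?thesis using False by (simp add: rt[OF SS] r)
qed

lemma trans_meas_eq:
  "trans_meas S rt r = (if r = 0 then return (MSi S) None
      else distr (density \<mu> (\<lambda>_. ennreal (1 / r))) (MSi S) Some)" (is "_ = ?N")
proof -
  have sN: "sets ?N = sets (MSi S)" by simp
  have "trans_meas S rt r = measure_of (space (MSi S)) (sets (MSi S)) (emeasure ?N)"
    unfolding trans_meas_def
    by (rule measure_of_eq[OF sets.space_closed])
      (simp only: sets.sigma_sets_eq emeasure_normalized_measure)
  also have "\<dots> = ?N" using measure_of_of_measure[of ?N] sN sets_eq_imp_space_eq[OF sN] by simp
  finally show ?thesis .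
qed

lemma emeasure_trans_meas:
  "B \<in> sets (MSi S) \<Longrightarrow> emeasure (trans_meas S rt r) B =
    ennreal (rt (Some -` B) / r) + (if None \<in> B then ennreal (1 - rt S / r) else 0)"
  unfolding trans_meas_eq by (rule emeasure_normalized_measure)

lemma prob_space_trans_meas: "prob_space (trans_meas S rt r)"
proof
  have sT: "sets (trans_meas S rt r) = sets (MSi S)" unfolding trans_meas_eq by simp
  have SS: "S \<in> sets (MS S)" using sets.top[of "MS S"] by simp
  have vS: "Some -` space (MSi S) = S" by auto
  have "emeasure (trans_meas S rt r) (space (trans_meas S rt r)) = ennreal (rt S / r) + ennreal (1 - rt S / r)"
    using emeasure_trans_meas[OF sets.top] sets_eq_imp_space_eq[OF sT] vS by (simp only:) simp
  also have "\<dots> = 1" using r rt[OF SS] by (cases "r = 0") auto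
  finally show "emeasure (trans_meas S rt r) (space (trans_meas S rt r)) = 1" .
qed

text \<open>Multiplying by \<open>r\<close> undoes the normalisation. For \<open>r = 0\<close> the
  identity persists because \<open>\<mu>\<close> vanishes, so it can be integrated over all states
  and actions without case distinction.\<close>

lemma emeasure_trans_meas_Some:
  assumes G: "G \<in> sets (MS S)"
  shows "ennreal r * emeasure (trans_meas S rt r) (Some ` G) = emeasure \<mu> G"
proof -
  interpret finite_measure \<mu> by (rule fin)
  have "emeasure (trans_meas S rt r) (Some ` G) = ennreal (rt G / r)"
    using emeasure_trans_meas[OF image_Some_sets[OF G]] by (auto simp: inj_vimage_image_eq)
  moreover have "measure \<mu> G \<le> r"
    unfolding r by (rule finite_measure_mono) (use sets.sets_into_space[OF G] sets.top[of "MS S"] s in auto)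
  moreover have "0 \<le> r" by (simp add: r)
  ultimately show ?thesis
    by (cases "r = 0") (auto simp: rt[OF G] emeasure_eq_measure measure_le_0_iff simp flip: ennreal_mult)
qed

end

text \<open>The measures \<open>q a\<close> are rates whose mass may exceed one. Their mixture is
  therefore not a \<open>bind\<close> of subprobability kernels and is built directly.\<close>

lemma average_measure:
  assumes [measurable]: "\<And>B. B \<in> sets N \<Longrightarrow> (\<lambda>a. emeasure (q a) B) \<in> borel_measurable \<kappa>"
    and s: "\<And>a. a \<in> space \<kappa> \<Longrightarrow> sets (q a) = sets N"
  defines "\<mu> \<equiv> measure_of (space N) (sets N) (\<lambda>B. \<integral>\<^sup>+a. emeasure (q a) B \<partial>\<kappa>)"
  shows "sets \<mu> = sets N" "\<And>B. B \<in> sets N \<Longrightarrow> emeasure \<mu> B = (\<integral>\<^sup>+a. emeasure (q a) B \<partial>\<kappa>)"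
proof -
  show s\<mu>: "sets \<mu> = sets N" by (simp add: \<mu>_def sets.sigma_sets_eq)
  fix B assume B: "B \<in> sets N"
  show "emeasure \<mu> B = (\<integral>\<^sup>+a. emeasure (q a) B \<partial>\<kappa>)"
  proof (rule emeasure_measure_of[OF \<mu>_def[THEN meta_eq_to_obj_eq]])
    show "countably_additive (sets \<mu>) (\<lambda>B. \<integral>\<^sup>+a. emeasure (q a) B \<partial>\<kappa>)"
    proof (rule countably_additiveI)
      fix F :: "nat \<Rightarrow> 'a set" assume F: "range F \<subseteq> sets \<mu>" "disjoint_family F"
      have "(\<Sum>i. \<integral>\<^sup>+a. emeasure (q a) (F i) \<partial>\<kappa>) = (\<integral>\<^sup>+a. (\<Sum>i. emeasure (q a) (F i)) \<partial>\<kappa>)"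
        using F by (subst nn_integral_suminf) (auto simp: s\<mu>)
      also have "\<dots> = (\<integral>\<^sup>+a. emeasure (q a) (\<Union>i. F i) \<partial>\<kappa>)"
        by (intro nn_integral_cong suminf_emeasure) (use F s in \<open>auto simp: s\<mu>\<close>)
      finally show "(\<Sum>i. \<integral>\<^sup>+a. emeasure (q a) (F i) \<partial>\<kappa>) = (\<integral>\<^sup>+a. emeasure (q a) (\<Union>i. F i) \<partial>\<kappa>)" .
    qed
  qed (use B s\<mu> sets.space_closed in \<open>auto simp: positive_def\<close>)
qed

section \<open>The jump kernel of the controlled process\<close>

locale ctmdp =
  fixes S :: "'s::polish_space set" and A :: "'a::polish_space set"
    and qt :: "'s \<Rightarrow> 'a \<Rightarrow> 's measure" and \<gamma> :: "'s measure"
    and \<pi> :: "nat \<Rightarrow> (nat \<Rightarrow> ennreal \<times> 's option) \<Rightarrow> real \<Rightarrow> 'a measure"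
  assumes model: "ctmdp_model S A qt \<gamma>" and pol: "ct_policy S A \<pi>"
begin

lemma S_ne: "S \<noteq> {}" and A_ne: "A \<noteq> {}" and prob_\<gamma>: "prob_space \<gamma>" and sets_\<gamma>: "sets \<gamma> = sets (MS S)"
  and sets_qt: "x \<in> S \<Longrightarrow> a \<in> A \<Longrightarrow> sets (qt x a) = sets (MS S)"
  and finite_qt: "x \<in> S \<Longrightarrow> a \<in> A \<Longrightarrow> finite_measure (qt x a)"
  and qt_measurable: "B \<in> sets (MS S) \<Longrightarrow> (\<lambda>(x, a). emeasure (qt x a) B) \<in> borel_measurable (MS S \<Otimes>\<^sub>M MA A)"
  and qx_bdd: "x \<in> S \<Longrightarrow> bdd_above ((\<lambda>a. qx qt S x a) ` A)"
  using model unfolding ctmdp_model_def by auto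

abbreviation "SA \<equiv> MS S \<Otimes>\<^sub>M MA A"
abbreviation Pn :: "nat \<Rightarrow> (nat \<Rightarrow> ennreal \<times> 's option) measure" where
  "Pn n \<equiv> PiM {..n} (\<lambda>_. Mstep S)"

definition "a_dflt = (SOME a. a \<in> A)"
definition "x_dflt = (SOME x. x \<in> S)"
lemma a_dflt: "a_dflt \<in> A" using A_ne by (simp add: a_dflt_def some_in_eq)
lemma x_dflt: "x_dflt \<in> S" using S_ne by (simp add: x_dflt_def some_in_eq)

text \<open>Outside \<^const>\<open>Hset\<close> and for nonpositive times the policy is unconstrained, so it is replaced by a constant there.\<close>

definition "policy_ext n h s = (if h \<in> Hset S n \<and> 0 < s then \<pi> (Suc n) h s else return (MA A) a_dflt)"
definition "state_ext n h = (if h \<in> Hset S n then the (snd (h n)) else x_dflt)"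
text \<open>A single averaging functional for the jump rate, the rates into sets and the costs; all
  later identities are proved for general \<open>f\<close>.\<close>

definition "rate f n h s = (\<integral>\<^sup>+a. f (state_ext n h) a \<partial>policy_ext n h s)"
definition "qrate x a = ennreal (qx qt S x a)"

lemma coord_measurable: "i \<le> n \<Longrightarrow> (\<lambda>h. h i) \<in> Pn n \<rightarrow>\<^sub>M Mstep S"
  by (rule measurable_component_singleton) simp

lemma fst_coord: "i \<le> n \<Longrightarrow> (\<lambda>h. fst (h i)) \<in> borel_measurable (Pn n)"
  using measurable_compose[OF coord_measurable[unfolded Mstep_def] measurable_fst] by (simp add: Mstep_def)
lemma snd_coord: "i \<le> n \<Longrightarrow> (\<lambda>h. snd (h i)) \<in> Pn n \<rightarrow>\<^sub>M MSi S"
  using measurable_compose[OF coord_measurable[unfolded Mstep_def] measurable_snd] by (simp add: Mstep_def)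

lemma SomeS_sets[measurable]: "Some ` S \<in> sets (MSi S)"
  using image_Some_sets[OF sets.top[of "MS S"]] by simp

lemma Hset_sets[measurable]: "Hset S n \<in> sets (Pn n)"
proof -
  have [measurable]: "(\<lambda>h. fst (h 0)) \<in> borel_measurable (Pn n)" by (rule fst_coord) simp
  have 1: "{h \<in> space (Pn n). fst (h 0) = 0} \<in> sets (Pn n)" by measurable
  have 2: "{h \<in> space (Pn n). \<forall>i\<in>{..n}. snd (h i) \<in> Some ` S} \<in> sets (Pn n)"
  proof (rule sets.sets_Collect_finite_All)
    fix i assume "i \<in> {..n}"
    then have "(\<lambda>h. snd (h i)) \<in> Pn n \<rightarrow>\<^sub>M MSi S" by (intro snd_coord) auto
    from measurable_sets[OF this SomeS_sets]
    show "{h \<in> space (Pn n). snd (h i) \<in> Some ` S} \<in> sets (Pn n)" by (simp add: vimage_def Int_def conj_commute)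
  qed simp
  have 3: "{h \<in> space (Pn n). \<forall>i\<in>{1..n}. 0 < fst (h i) \<and> fst (h i) < \<infinity>} \<in> sets (Pn n)"
  proof (rule sets.sets_Collect_finite_All)
    fix i assume "i \<in> {1..n}"
    then have [measurable]: "(\<lambda>h. fst (h i)) \<in> borel_measurable (Pn n)" by (intro fst_coord) auto
    show "{h \<in> space (Pn n). 0 < fst (h i) \<and> fst (h i) < \<infinity>} \<in> sets (Pn n)" by measurable
  qed simp
  have "Hset S n = {h \<in> space (Pn n). fst (h 0) = 0} \<inter> {h \<in> space (Pn n). \<forall>i\<in>{..n}. snd (h i) \<in> Some ` S}
      \<inter> {h \<in> space (Pn n). \<forall>i\<in>{1..n}. 0 < fst (h i) \<and> fst (h i) < \<infinity>}"
    unfolding Hset_def by blast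
  then show ?thesis using 1 2 3 by auto
qed

lemma state_ext_in_S: "h \<in> space (Pn n) \<Longrightarrow> state_ext n h \<in> S"
  using x_dflt by (auto simp: state_ext_def Hset_def)

lemma state_ext_measurable[measurable]: "state_ext n \<in> Pn n \<rightarrow>\<^sub>M MS S"
proof -
  have g: "(\<lambda>y. case y of None \<Rightarrow> x_dflt | Some x \<Rightarrow> x) \<in> MSi S \<rightarrow>\<^sub>M MS S"
    by (rule measurable_MSi) (use x_dflt in auto)
  have [measurable]: "(\<lambda>h. case snd (h n) of None \<Rightarrow> x_dflt | Some x \<Rightarrow> x) \<in> Pn n \<rightarrow>\<^sub>M MS S"
    by (rule measurable_compose[OF snd_coord g]) simp
  have [measurable]: "(\<lambda>h. x_dflt) \<in> Pn n \<rightarrow>\<^sub>M MS S" using x_dflt by simp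
  have "state_ext n = (\<lambda>h. if h \<in> Hset S n then (case snd (h n) of None \<Rightarrow> x_dflt | Some x \<Rightarrow> x) else x_dflt)"
    by (auto simp: fun_eq_iff state_ext_def Hset_def split: option.split)
  then show ?thesis by simp
qed

lemma policy_ext_measurable: "(\<lambda>(h, s). policy_ext n h s) \<in> Pn n \<Otimes>\<^sub>M borel \<rightarrow>\<^sub>M prob_algebra (MA A)"
proof -
  let ?P = "\<lambda>z :: (nat \<Rightarrow> ennreal \<times> 's option) \<times> real. fst z \<in> Hset S n \<and> 0 < snd z"
  have "(\<lambda>z. if ?P z then \<pi> (Suc n) (fst z) (snd z) else return (MA A) a_dflt) \<in> Pn n \<Otimes>\<^sub>M borel \<rightarrow>\<^sub>M prob_algebra (MA A)"
  proof (rule measurable_If_restrict_space_iff[THEN iffD2])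
    show "{z \<in> space (Pn n \<Otimes>\<^sub>M borel). ?P z} \<in> sets (Pn n \<Otimes>\<^sub>M borel)" by measurable
    let ?R = "restrict_space (Pn n \<Otimes>\<^sub>M borel) {z. ?P z}"
    have 1: "fst \<in> ?R \<rightarrow>\<^sub>M Hn S n" unfolding Hn_def
      by (rule measurable_restrict_space3) auto
    have 2: "snd \<in> ?R \<rightarrow>\<^sub>M restrict_space borel {0<..}"
      by (rule measurable_restrict_space3) auto
    have "(\<lambda>(h, s). \<pi> (Suc n) h s) \<in> Hn S n \<Otimes>\<^sub>M restrict_space (borel :: real measure) {0<..} \<rightarrow>\<^sub>M prob_algebra (MA A)"
      using pol unfolding ct_policy_def by blast
    from measurable_compose[OF measurable_Pair[OF 1 2] this]
    have "(\<lambda>z. \<pi> (Suc n) (fst z) (snd z)) \<in> ?R \<rightarrow>\<^sub>M prob_algebra (MA A)" by (simp only: split_conv)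
    moreover have "(\<lambda>z. return (MA A) a_dflt) \<in> restrict_space (Pn n \<Otimes>\<^sub>M borel) {z. \<not> ?P z} \<rightarrow>\<^sub>M prob_algebra (MA A)"
      using a_dflt by (intro measurable_const) (auto simp: space_prob_algebra prob_space_return)
    ultimately show "(\<lambda>z. \<pi> (Suc n) (fst z) (snd z)) \<in> ?R \<rightarrow>\<^sub>M prob_algebra (MA A) \<and>
      (\<lambda>z. return (MA A) a_dflt) \<in> restrict_space (Pn n \<Otimes>\<^sub>M borel) {z. \<not> ?P z} \<rightarrow>\<^sub>M prob_algebra (MA A)" by blast
  qed
  then show ?thesis by (simp add: policy_ext_def split_beta')
qed

lemma policy_ext_space: "h \<in> space (Pn n) \<Longrightarrow> prob_space (policy_ext n h s) \<and> sets (policy_ext n h s) = sets (MA A)"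
  using measurable_space[OF policy_ext_measurable, of "(h, s)"] by (simp add: space_pair_measure space_prob_algebra)

lemma rate_measurable:
  assumes [measurable]: "(\<lambda>(x, a). f x a) \<in> borel_measurable SA"
  shows "(\<lambda>(h, s). rate f n h s) \<in> borel_measurable (Pn n \<Otimes>\<^sub>M borel)"
proof -
  have "(\<lambda>z. \<integral>\<^sup>+a. f (state_ext n (fst z)) a \<partial>policy_ext n (fst z) (snd z)) \<in> borel_measurable (Pn n \<Otimes>\<^sub>M borel)"
  proof (rule nn_integral_measurable_subprob_algebra2[where N="MA A"])
    show "(\<lambda>(z, a). f (state_ext n (fst z)) a) \<in> borel_measurable ((Pn n \<Otimes>\<^sub>M borel) \<Otimes>\<^sub>M MA A)"
      by measurable
    show "(\<lambda>z. policy_ext n (fst z) (snd z)) \<in> Pn n \<Otimes>\<^sub>M borel \<rightarrow>\<^sub>M subprob_algebra (MA A)"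
      using measurable_prob_algebraD[OF policy_ext_measurable] by (simp add: split_beta')
  qed
  then show ?thesis by (simp add: rate_def split_beta')
qed

lemma emeasure_qt_S: "x \<in> S \<Longrightarrow> a \<in> A \<Longrightarrow> emeasure (qt x a) S = qrate x a"
  using finite_qt[of x a] by (simp add: qrate_def qx_def finite_measure.emeasure_eq_measure)

lemma S_sets_MS: "S \<in> sets (MS S)" using sets.top[of "MS S"] by simp

lemma qrate_measurable[measurable]: "(\<lambda>(x, a). qrate x a) \<in> borel_measurable SA"
  using qt_measurable[OF S_sets_MS]
  by (rule measurable_cong[THEN iffD1, rotated]) (auto simp: space_pair_measure emeasure_qt_S)

text \<open>The bound depends on the state. The results on sojourn times are applied for one history
  at a time, hence with one fixed state.\<close>

definition "rate_bound x = (SUP a\<in>A. qx qt S x a)"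

lemma rate_bound: "x \<in> S \<Longrightarrow> 0 \<le> rate_bound x" "x \<in> S \<Longrightarrow> a \<in> A \<Longrightarrow> qrate x a \<le> ennreal (rate_bound x)"
proof -
  assume x: "x \<in> S"
  have le: "qx qt S x a \<le> rate_bound x" if "a \<in> A" for a
    unfolding rate_bound_def by (rule cSUP_upper[OF that qx_bdd[OF x]])
  then show "a \<in> A \<Longrightarrow> qrate x a \<le> ennreal (rate_bound x)" by (auto simp: qrate_def intro: ennreal_leI)
  show "0 \<le> rate_bound x" using le[OF a_dflt] by (rule order_trans[rotated]) (simp add: qx_def)
qed

lemma rate_qrate_le: "h \<in> space (Pn n) \<Longrightarrow> rate qrate n h s \<le> ennreal (rate_bound (state_ext n h))"
  unfolding rate_def using policy_ext_space[of h n s] rate_bound state_ext_in_S[of h n] sets_eq_imp_space_eq[of "policy_ext n h s" "MA A"]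
  by (intro subprob_space.nn_integral_le_const) (auto intro!: AE_I2 prob_space_imp_subprob_space)

lemma rate_section:
  assumes "(\<lambda>(x, a). f x a) \<in> borel_measurable SA" "h \<in> space (Pn n)"
  shows "rate f n h \<in> borel_measurable borel"
  using measurable_compose[OF measurable_Pair1'[OF assms(2)] rate_measurable[OF assms(1)]] by simp

definition "rate_into G x a = emeasure (qt x a) G"

lemma rate_into_measurable: "G \<in> sets (MS S) \<Longrightarrow> (\<lambda>(x, a). rate_into G x a) \<in> borel_measurable SA"
  unfolding rate_into_def by (rule qt_measurable)

definition "post_jump n h s = trans_meas S (\<lambda>G. enn2real (rate (rate_into G) n h s)) (enn2real (rate qrate n h s))"

text \<open>The averaged off-diagonal kernel is a genuine finite measure, to which the facts on
  \<open>trans_meas\<close> apply. Boundedness of the rate makes the passage through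
  \<open>enn2real\<close> lossless.\<close>

lemma avg_rate_measure:
  assumes h: "h \<in> space (Pn n)"
  obtains \<mu> where "finite_measure \<mu>" "sets \<mu> = sets (MS S)"
    "\<And>G. G \<in> sets (MS S) \<Longrightarrow> emeasure \<mu> G = rate (rate_into G) n h s"
    "\<And>G. G \<in> sets (MS S) \<Longrightarrow> enn2real (rate (rate_into G) n h s) = measure \<mu> G"
    "enn2real (rate qrate n h s) = measure \<mu> S" "rate qrate n h s = ennreal (enn2real (rate qrate n h s))"
proof -
  note p = policy_ext_space[OF h, of s]
  have spp: "space (policy_ext n h s) = A" using p sets_eq_imp_space_eq[of "policy_ext n h s" "MA A"] by simp
  note x = state_ext_in_S[OF h]
  have m: "(\<lambda>a. emeasure (qt (state_ext n h) a) G) \<in> borel_measurable (policy_ext n h s)" if "G \<in> sets (MS S)" for G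
  proof -
    have "(\<lambda>a. emeasure (qt (state_ext n h) a) G) \<in> borel_measurable (MA A)"
      using measurable_compose[OF measurable_Pair1'[of "state_ext n h" "MS S"] qt_measurable[OF that]] x by simp
    then show ?thesis using p by (simp cong: measurable_cong_sets)
  qed
  define \<mu> where "\<mu> = measure_of (space (MS S)) (sets (MS S)) (\<lambda>B. \<integral>\<^sup>+a. emeasure (qt (state_ext n h) a) B \<partial>policy_ext n h s)"
  note av = average_measure[of "MS S" "qt (state_ext n h)" "policy_ext n h s", folded \<mu>_def, OF m]
  have s\<mu>: "sets \<mu> = sets (MS S)" by (rule av) (auto simp: spp sets_qt x)
  have e\<mu>: "emeasure \<mu> G = rate (rate_into G) n h s" if G: "G \<in> sets (MS S)" for G
    unfolding rate_def rate_into_def by (rule av(2)[OF _ _ G]) (auto simp: spp sets_qt x)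
  have rS: "rate (rate_into S) n h s = rate qrate n h s"
    unfolding rate_def by (intro nn_integral_cong) (auto simp: spp rate_into_def emeasure_qt_S x)
  have eS: "emeasure \<mu> S = rate qrate n h s" using e\<mu>[OF S_sets_MS] rS by simp
  have fin: "rate qrate n h s \<noteq> \<infinity>" using rate_qrate_le[OF h, of s] by (metis ennreal_neq_top infinity_ennreal_def neq_top_trans)
  have "finite_measure \<mu>"
    using eS fin sets_eq_imp_space_eq[OF s\<mu>] by (intro finite_measureI) simp
  then show thesis
    using that[of \<mu>] s\<mu> e\<mu> eS fin by (simp add: measure_def ennreal_enn2real_if)
qed

lemma
  assumes h: "h \<in> space (Pn n)"
  shows post_jump_prob: "prob_space (post_jump n h s)"
    and post_jump_emeasure: "B \<in> sets (MSi S) \<Longrightarrow> emeasure (post_jump n h s) B =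
      ennreal (enn2real (rate (rate_into (Some -` B)) n h s) / enn2real (rate qrate n h s))
      + (if None \<in> B then ennreal (1 - enn2real (rate (rate_into S) n h s) / enn2real (rate qrate n h s)) else 0)"
    and post_jump_Some: "G \<in> sets (MS S) \<Longrightarrow> rate qrate n h s * emeasure (post_jump n h s) (Some ` G) = rate (rate_into G) n h s"
proof -
  obtain \<mu> where \<mu>: "finite_measure \<mu>" "sets \<mu> = sets (MS S)"
    "\<And>G. G \<in> sets (MS S) \<Longrightarrow> emeasure \<mu> G = rate (rate_into G) n h s"
    "\<And>G. G \<in> sets (MS S) \<Longrightarrow> enn2real (rate (rate_into G) n h s) = measure \<mu> G"
    "enn2real (rate qrate n h s) = measure \<mu> S" "rate qrate n h s = ennreal (enn2real (rate qrate n h s))"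
    by (rule avg_rate_measure[OF h, where s=s]) blast
  note t = \<mu>(1,2,4,5)
  show "prob_space (post_jump n h s)" unfolding post_jump_def by (rule prob_space_trans_meas[OF t])
  show "B \<in> sets (MSi S) \<Longrightarrow> emeasure (post_jump n h s) B =
      ennreal (enn2real (rate (rate_into (Some -` B)) n h s) / enn2real (rate qrate n h s))
      + (if None \<in> B then ennreal (1 - enn2real (rate (rate_into S) n h s) / enn2real (rate qrate n h s)) else 0)"
    unfolding post_jump_def by (rule emeasure_trans_meas[OF t])
  show "G \<in> sets (MS S) \<Longrightarrow> rate qrate n h s * emeasure (post_jump n h s) (Some ` G) = rate (rate_into G) n h s"
    using emeasure_trans_meas_Some[OF t] \<mu>(3,6) unfolding post_jump_def by metis
qed

lemma sets_post_jump: "sets (post_jump n h s) = sets (MSi S)" by (simp add: post_jump_def trans_meas_def sets.sigma_sets_eq del: space_MSi)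

lemma post_jump_measurable: "(\<lambda>(h, s). post_jump n h s) \<in> Pn n \<Otimes>\<^sub>M borel \<rightarrow>\<^sub>M prob_algebra (MSi S)"
proof (rule measurable_prob_algebraI)
  show "prob_space (case z of (h, s) \<Rightarrow> post_jump n h s)" if "z \<in> space (Pn n \<Otimes>\<^sub>M borel)" for z
    using that by (auto simp: space_pair_measure post_jump_prob)
  show "(\<lambda>(h, s). post_jump n h s) \<in> Pn n \<Otimes>\<^sub>M borel \<rightarrow>\<^sub>M subprob_algebra (MSi S)"
  proof (rule measurable_subprob_algebra)
    fix B assume B: "B \<in> sets (MSi S)"
    note [measurable] = rate_measurable[OF rate_into_measurable[OF vimage_Some_sets[OF B]]]
      rate_measurable[OF rate_into_measurable[OF S_sets_MS]] rate_measurable[OF qrate_measurable]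
    have "(\<lambda>(h, s). ennreal (enn2real (rate (rate_into (Some -` B)) n h s) / enn2real (rate qrate n h s))
      + (if None \<in> B then ennreal (1 - enn2real (rate (rate_into S) n h s) / enn2real (rate qrate n h s)) else 0))
      \<in> borel_measurable (Pn n \<Otimes>\<^sub>M borel)" by measurable
    then show "(\<lambda>z. emeasure (case z of (h, s) \<Rightarrow> post_jump n h s) B) \<in> borel_measurable (Pn n \<Otimes>\<^sub>M borel)"
      by (rule measurable_cong[THEN iffD1, rotated]) (auto simp: space_pair_measure post_jump_emeasure B)
  qed (auto simp: space_pair_measure post_jump_prob sets_post_jump prob_space_imp_subprob_space)
qed

definition "cemetery = (\<infinity> :: ennreal, None :: 's option)"

lemma cemetery_space: "cemetery \<in> space (Mstep S)" by (simp add: cemetery_def Mstep_def space_pair_measure)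

text \<open>The value at \<open>\<theta> = 0\<close> is arbitrary, as \<open>jump_law\<close> gives
  that point no mass.\<close>

definition "jump_kernel n h \<theta> = (if \<theta> = \<infinity> \<or> \<theta> = 0 then return (Mstep S) cemetery
   else distr (post_jump n h (enn2real \<theta>)) (Mstep S) (\<lambda>y. (\<theta>, y)))"

lemma jump_kernel_measurable: "(\<lambda>(h, \<theta>). jump_kernel n h \<theta>) \<in> Pn n \<Otimes>\<^sub>M borel \<rightarrow>\<^sub>M prob_algebra (Mstep S)"
proof -
  have 1: "(\<lambda>z. post_jump n (fst z) (enn2real (snd z))) \<in> Pn n \<Otimes>\<^sub>M borel \<rightarrow>\<^sub>M prob_algebra (MSi S)"
    using measurable_compose[OF _ post_jump_measurable, of "\<lambda>z. (fst z, enn2real (snd z))" "Pn n \<Otimes>\<^sub>M borel" n] by simp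
  have 2: "(\<lambda>z. distr (post_jump n (fst z) (enn2real (snd z))) (Mstep S) (\<lambda>y. (snd z, y))) \<in> Pn n \<Otimes>\<^sub>M borel \<rightarrow>\<^sub>M prob_algebra (Mstep S)"
    by (rule measurable_distr_prob_space2[OF 1]) (simp add: Mstep_def)
  have 3: "(\<lambda>z. return (Mstep S) cemetery) \<in> Pn n \<Otimes>\<^sub>M (borel :: ennreal measure) \<rightarrow>\<^sub>M prob_algebra (Mstep S)"
    using cemetery_space by (intro measurable_const) (auto simp: space_prob_algebra prob_space_return)
  have "(\<lambda>z. if snd z = \<infinity> \<or> snd z = 0 then return (Mstep S) cemetery
      else distr (post_jump n (fst z) (enn2real (snd z))) (Mstep S) (\<lambda>y. (snd z, y))) \<in> Pn n \<Otimes>\<^sub>M borel \<rightarrow>\<^sub>M prob_algebra (Mstep S)"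
    by (intro measurable_If 2 3) measurable
  then show ?thesis by (simp add: jump_kernel_def split_beta')
qed

text \<open>Each law is the image of a density with respect to the same Lebesgue measure under the
  same map. Dependence on the history sits in the density alone, so measurability is that of a
  parametrised integral.\<close>

lemma jump_law_measurable: "(\<lambda>h. jump_law (rate qrate n h)) \<in> Pn n \<rightarrow>\<^sub>M prob_algebra borel"
proof (rule measurable_prob_algebraI)
  have sJ: "sets (jump_law (rate qrate n h)) = sets borel" for h by (simp add: jump_law_def)
  have pr: "prob_space (jump_law (rate qrate n h))" if h: "h \<in> space (Pn n)" for h
    by (rule prob_space_jump_law[OF rate_section[OF qrate_measurable h] rate_qrate_le[OF h]]) (simp add: rate_bound state_ext_in_S h)
  show "h \<in> space (Pn n) \<Longrightarrow> prob_space (jump_law (rate qrate n h))" for h by (rule pr)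
  note [measurable] = jump_density_measurable[OF rate_measurable[OF qrate_measurable]]
  show "(\<lambda>h. jump_law (rate qrate n h)) \<in> Pn n \<rightarrow>\<^sub>M subprob_algebra borel"
  proof (rule measurable_subprob_algebra)
    fix B :: "ennreal set" assume B[measurable]: "B \<in> sets borel"
    have "(\<lambda>h. \<integral>\<^sup>+s. jump_density (rate qrate n h) s * indicator B (jump_time s) \<partial>lborel) \<in> borel_measurable (Pn n)"
      by (intro lborel.borel_measurable_nn_integral) measurable
    moreover have "(\<integral>\<^sup>+s. jump_density (rate qrate n h) s * indicator B (jump_time s) \<partial>lborel) = emeasure (jump_law (rate qrate n h)) B"
      if h: "h \<in> space (Pn n)" for h
    proof -
      have "emeasure (jump_law (rate qrate n h)) B = (\<integral>\<^sup>+\<theta>. indicator B \<theta> \<partial>jump_law (rate qrate n h))"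
        by (simp add: jump_law_def)
      also have "\<dots> = (\<integral>\<^sup>+s. jump_density (rate qrate n h) s * indicator B (jump_time s) \<partial>lborel)"
        by (rule nn_integral_jump_law[OF rate_section[OF qrate_measurable h] rate_qrate_le[OF h]]) (simp_all add: rate_bound state_ext_in_S h)
      finally show ?thesis ..
    qed
    ultimately show "(\<lambda>h. emeasure (jump_law (rate qrate n h)) B) \<in> borel_measurable (Pn n)"
      by (rule measurable_cong[THEN iffD1, rotated])
  qed (auto simp: pr sJ intro: prob_space_imp_subprob_space)
qed

text \<open>An everywhere measurable substitute for \<open>ct_step\<close>; the two agree on
  admissible histories and on those whose last state is \<open>None\<close>.\<close>

definition "ct_kernel n h = (if h \<in> Hset S n then jump_law (rate qrate n h) \<bind> jump_kernel n h else return (Mstep S) cemetery)"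

lemma ct_kernel_measurable: "ct_kernel n \<in> Pn n \<rightarrow>\<^sub>M prob_algebra (Mstep S)"
proof -
  have "(\<lambda>h. jump_law (rate qrate n h) \<bind> jump_kernel n h) \<in> Pn n \<rightarrow>\<^sub>M prob_algebra (Mstep S)"
    by (rule measurable_bind_prob_space2[OF jump_law_measurable jump_kernel_measurable])
  moreover have "(\<lambda>h. return (Mstep S) cemetery) \<in> Pn n \<rightarrow>\<^sub>M prob_algebra (Mstep S)"
    using cemetery_space by (intro measurable_const) (auto simp: space_prob_algebra prob_space_return)
  ultimately show ?thesis unfolding ct_kernel_def by (intro measurable_If) (auto simp: sets.Int_space_eq2[symmetric])
qed

text \<open>An integral over one step becomes a Lebesgue integral over the jump time. Nonpositive
  \<open>s\<close> represent the absence of a jump and contribute the value at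
  \<open>cemetery\<close>.\<close>

lemma nn_integral_ct_kernel:
  assumes h: "h \<in> Hset S n" and f[measurable]: "f \<in> borel_measurable (Mstep S)"
  shows "(\<integral>\<^sup>+y. f y \<partial>ct_kernel n h) = (\<integral>\<^sup>+s. jump_density (rate qrate n h) s *
     (if 0 < s then (\<integral>\<^sup>+y. f (ennreal s, y) \<partial>post_jump n h s) else f cemetery) \<partial>lborel)"
proof -
  have hs: "h \<in> space (Pn n)" using h by (simp add: Hset_def)
  have Km: "jump_kernel n h \<in> borel \<rightarrow>\<^sub>M prob_algebra (Mstep S)"
    using measurable_compose[OF measurable_Pair1'[OF hs] jump_kernel_measurable] by simp
  have sJ: "sets (jump_law (rate qrate n h)) = sets borel" by (simp add: jump_law_def)
  have Km': "jump_kernel n h \<in> jump_law (rate qrate n h) \<rightarrow>\<^sub>M subprob_algebra (Mstep S)"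
    using measurable_prob_algebraD[OF Km] by (simp cong: measurable_cong_sets add: sJ)
  have "(\<integral>\<^sup>+y. f y \<partial>ct_kernel n h) = (\<integral>\<^sup>+\<theta>. \<integral>\<^sup>+y. f y \<partial>jump_kernel n h \<theta> \<partial>jump_law (rate qrate n h))"
    using h by (simp add: ct_kernel_def nn_integral_bind[OF f Km'])
  also have "\<dots> = (\<integral>\<^sup>+s. jump_density (rate qrate n h) s * (\<integral>\<^sup>+y. f y \<partial>jump_kernel n h (jump_time s)) \<partial>lborel)"
    by (rule nn_integral_jump_law[OF rate_section[OF qrate_measurable hs] rate_qrate_le[OF hs]])
      (auto simp: rate_bound state_ext_in_S hs intro!: measurable_compose[OF measurable_prob_algebraD[OF Km] nn_integral_measurable_subprob_algebra])
  also have "(\<lambda>s. \<integral>\<^sup>+y. f y \<partial>jump_kernel n h (jump_time s)) = (\<lambda>s. if 0 < s then (\<integral>\<^sup>+y. f (ennreal s, y) \<partial>post_jump n h s) else f cemetery)"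
  proof
    fix s :: real
    have "(\<lambda>y. (ennreal s, y)) \<in> post_jump n h s \<rightarrow>\<^sub>M Mstep S"
      by (simp add: Mstep_def cong: measurable_cong_sets add: sets_post_jump)
    then show "(\<integral>\<^sup>+y. f y \<partial>jump_kernel n h (jump_time s)) = (if 0 < s then (\<integral>\<^sup>+y. f (ennreal s, y) \<partial>post_jump n h s) else f cemetery)"
      using cemetery_space by (auto simp: jump_time_def jump_kernel_def nn_integral_return nn_integral_distr)
  qed
  finally show ?thesis .
qed

lemma theta_law_eq:
  assumes h: "h \<in> Hset S n"
  shows "theta_law S qt \<pi> n h = jump_law (rate qrate n h)"
proof -
  have hs: "h \<in> space (Pn n)" using h by (simp add: Hset_def)
  note J = rate_section[OF qrate_measurable hs] rate_qrate_le[OF hs] rate_bound(1)[OF state_ext_in_S[OF hs]]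
  have "cumrate S qt \<pi> n h t = (\<integral>\<^sup>+s. indicator {0<..t} s * rate qrate n h s \<partial>lborel)" for t
    unfolding cumrate_def rate_def
    by (intro nn_integral_cong) (auto simp: policy_ext_def state_ext_def h qrate_def[abs_def] split: split_indicator)
  then have c: "ennreal (exp (- enn2real (cumrate S qt \<pi> n h t))) = surv (rate qrate n h) t" for t
    by (simp add: surv_def cumhaz_def)
  show ?thesis unfolding theta_law_def c
  proof (rule the_equality)
    show "sets (jump_law (rate qrate n h)) = sets borel \<and> prob_space (jump_law (rate qrate n h)) \<and>
      (\<forall>t\<ge>0. emeasure (jump_law (rate qrate n h)) {\<theta>. ennreal t \<le> \<theta>} = surv (rate qrate n h) t)"
      using prob_space_jump_law[OF J] jump_law_tail[OF J] by (auto simp: jump_law_def)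
    fix \<nu> assume "sets \<nu> = sets (borel :: ennreal measure) \<and> prob_space \<nu> \<and>
      (\<forall>t\<ge>0. emeasure \<nu> {\<theta>. ennreal t \<le> \<theta>} = surv (rate qrate n h) t)"
    then show "\<nu> = jump_law (rate qrate n h)" by (intro jump_law_unique[OF J]) auto
  qed
qed

lemma x_law_eq: "h \<in> Hset S n \<Longrightarrow> 0 < s \<Longrightarrow> x_law S qt \<pi> n h s = post_jump n h s"
  unfolding x_law_def post_jump_def rate_def rate_into_def qrate_def Let_def policy_ext_def state_ext_def by simp

lemma ct_step_eq:
  assumes h: "h \<in> Hset S n \<or> snd (h n) = None"
  shows "ct_step S qt \<pi> n h = ct_kernel n h"
proof (cases "snd (h n) = None")
  case True
  then have "h \<notin> Hset S n" by (auto simp: Hset_def)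
  with True show ?thesis by (simp add: ct_step_def ct_kernel_def cemetery_def)
next
  case False
  with h have h: "h \<in> Hset S n" by simp
  then have hs: "h \<in> space (Pn n)" by (simp add: Hset_def)
  let ?J = "jump_law (rate qrate n h)"
  let ?f = "\<lambda>\<theta>. if \<theta> = \<infinity> then return (Mstep S) (\<infinity>, None)
                  else distr (x_law S qt \<pi> n h (enn2real \<theta>)) (Mstep S) (\<lambda>y. (\<theta>, y))"
  have Km: "jump_kernel n h \<in> borel \<rightarrow>\<^sub>M prob_algebra (Mstep S)"
    using measurable_compose[OF measurable_Pair1'[OF hs] jump_kernel_measurable] by simp
  have sJ: "sets ?J = sets borel" and spJ: "space ?J = UNIV" by (simp_all add: jump_law_def)
  \<comment> \<open>The two kernels can differ only at \<open>\<theta> = 0\<close>: there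
    \<open>x_law\<close> evaluates the policy at time 0, outside its domain.\<close>
  have "?J \<bind> ?f = ?J \<bind> jump_kernel n h"
  proof (rule bind_cong_point_nonmeasurable[where p=0 and N="Mstep S"])
    show "jump_kernel n h \<in> ?J \<rightarrow>\<^sub>M subprob_algebra (Mstep S)"
      using measurable_prob_algebraD[OF Km] by (simp cong: measurable_cong_sets add: sJ)
    have "emeasure ?J {0} = (\<integral>\<^sup>+\<theta>. indicator {0} \<theta> \<partial>?J)" by (simp add: sJ)
    also have "\<dots> = (\<integral>\<^sup>+s. jump_density (rate qrate n h) s * indicator {0} (jump_time s) \<partial>lborel)"
      by (rule nn_integral_jump_law[OF rate_section[OF qrate_measurable hs] rate_qrate_le[OF hs]]) (auto simp: rate_bound state_ext_in_S hs)
    also have "\<dots> = (\<integral>\<^sup>+s. 0 \<partial>(lborel :: real measure))" by (intro nn_integral_cong) (auto simp: jump_time_def)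
    finally show "emeasure ?J {0} = 0" by simp
    fix \<theta> :: ennreal assume "\<theta> \<noteq> 0"
    then show "?f \<theta> = jump_kernel n h \<theta>"
      using x_law_eq[OF h, of "enn2real \<theta>"] by (auto simp: jump_kernel_def cemetery_def enn2real_positive_iff less_top zero_less_iff_neq_zero)
  qed (auto simp: sJ spJ)
  then show ?thesis using False h by (auto simp: ct_step_def ct_kernel_def theta_law_eq)
qed

end

section \<open>Occupation integrals\<close>

lemma tt_mono: "m \<le> n \<Longrightarrow> tt \<omega> m \<le> tt \<omega> n"
  unfolding tt_def by (rule sum_mono2) auto

lemma tt_Suc: "tt \<omega> (Suc n) = tt \<omega> n + fst (\<omega> (Suc n))"
  unfolding tt_def by simp

lemma tt_index_unique:
  assumes "tt \<omega> n \<le> t" "t < tt \<omega> (Suc n)" "tt \<omega> m \<le> t" "t < tt \<omega> (Suc m)"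
  shows "m = n"
  using assms tt_mono[of "Suc n" m \<omega>] tt_mono[of "Suc m" n \<omega>]
  by (metis Suc_leI le_less_trans less_le_not_le linorder_neqE_nat order_trans)

text \<open>The state is constant on intervals closed on the left, while the action law is attached
  to intervals closed on the right. Each convention needs its own uniqueness of the index.\<close>

lemma tt_index_unique':
  assumes "tt \<omega> n < t" "t \<le> tt \<omega> (Suc n)" "tt \<omega> m < t" "t \<le> tt \<omega> (Suc m)"
  shows "m = n"
  using assms tt_mono[of "Suc n" m \<omega>] tt_mono[of "Suc m" n \<omega>]
  by (metis Suc_leI le_less_trans less_le_not_le linorder_neqE_nat order_trans)

lemma xi_eq: "tt \<omega> n \<le> ennreal t \<Longrightarrow> ennreal t < tt \<omega> (Suc n) \<Longrightarrow> xi \<omega> t = snd (\<omega> n)"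
proof -
  assume t: "tt \<omega> n \<le> ennreal t" "ennreal t < tt \<omega> (Suc n)"
  then have "(THE m. tt \<omega> m \<le> ennreal t \<and> ennreal t < tt \<omega> (Suc m)) = n"
    by (intro the_equality) (auto dest: tt_index_unique)
  then show ?thesis using t unfolding xi_def by auto
qed

lemma pol_eq: "tt \<omega> n < ennreal t \<Longrightarrow> ennreal t \<le> tt \<omega> (Suc n) \<Longrightarrow>
  pol A \<pi> \<omega> t = \<pi> (Suc n) (restrict \<omega> {..n}) (t - enn2real (tt \<omega> n))"
proof -
  assume t: "tt \<omega> n < ennreal t" "ennreal t \<le> tt \<omega> (Suc n)"
  then have "(THE m. tt \<omega> m < ennreal t \<and> ennreal t \<le> tt \<omega> (Suc m)) = n"
    by (intro the_equality) (auto dest: tt_index_unique')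
  then show ?thesis using t unfolding pol_def Let_def by auto
qed

lemma tail_integral_measurable:
  assumes [measurable]: "\<theta> \<in> borel_measurable M" "(\<lambda>(h, s). r h s) \<in> borel_measurable (M \<Otimes>\<^sub>M borel)"
  shows "(\<lambda>h. \<integral>\<^sup>+s. indicator {0<..} s * indicator {\<theta>. ennreal s \<le> \<theta>} (\<theta> h) * r h s \<partial>lborel) \<in> borel_measurable M"
proof -
  have "(\<lambda>h. \<integral>\<^sup>+s. (if 0 < s \<and> ennreal s \<le> \<theta> h then r h s else 0) \<partial>lborel) \<in> borel_measurable M"
    by (rule lborel.borel_measurable_nn_integral) measurable
  also have "(\<lambda>h. \<integral>\<^sup>+s. (if 0 < s \<and> ennreal s \<le> \<theta> h then r h s else 0) \<partial>lborel) =
      (\<lambda>h. \<integral>\<^sup>+s. indicator {0<..} s * indicator {\<theta>. ennreal s \<le> \<theta>} (\<theta> h) * r h s \<partial>lborel)"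
    by (intro ext nn_integral_cong) auto
  finally show ?thesis .
qed

context ctmdp begin

abbreviation "soj f n h \<equiv> (\<integral>\<^sup>+s. indicator {0<..} s * surv (rate qrate n h) s * rate f n h s \<partial>lborel)"

definition "sojourn_integral n f \<omega> = (\<integral>\<^sup>+t. indicator {t. tt \<omega> n \<le> ennreal t \<and> ennreal t < tt \<omega> (Suc n)} t *
   (case xi \<omega> t of None \<Rightarrow> 0 | Some x \<Rightarrow> \<integral>\<^sup>+a. f x a \<partial>pol A \<pi> \<omega> t) \<partial>lborel)"

definition "append_step n h y = (\<lambda>i\<in>{..Suc n}. if i = Suc n then y else h i)" for h :: "nat \<Rightarrow> ennreal \<times> 's option"

lemma Omega_absorbed:
  assumes \<omega>: "\<omega> \<in> Omega S" and "1 \<le> i" "\<omega> i = (\<infinity>, None)" "i \<le> n"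
  shows "\<omega> n = (\<infinity>, None)"
  using \<open>i \<le> n\<close>
proof (induction n rule: dec_induct)
  case (step m) then show ?case using \<omega> \<open>1 \<le> i\<close> by (auto simp: Omega_def)
qed (use assms in simp)

lemma Omega_Hset:
  assumes \<omega>: "\<omega> \<in> Omega S" and ne: "snd (\<omega> n) \<noteq> None"
  shows "restrict \<omega> {..n} \<in> Hset S n"
proof -
  have live: "0 < fst (\<omega> i) \<and> fst (\<omega> i) < \<infinity> \<and> snd (\<omega> i) \<in> Some ` S" if "1 \<le> i" "i \<le> n" for i
    using Omega_absorbed[OF \<omega> that(1) _ that(2)] ne \<omega> that(1) by (auto simp: Omega_def)
  have 0: "fst (\<omega> 0) = 0" "snd (\<omega> 0) \<in> Some ` S" using \<omega> by (auto simp: Omega_def)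
  have "snd (\<omega> i) \<in> Some ` S" if "i \<le> n" for i using live[of i] 0 that by (cases "i = 0") auto
  moreover have "restrict \<omega> {..n} \<in> space (Pn n)" using \<omega> by (auto simp: Omega_def space_PiM)
  ultimately show ?thesis using live 0 by (auto simp: Hset_def)
qed

lemma Omega_dead:
  assumes \<omega>: "\<omega> \<in> Omega S" and "snd (\<omega> n) = None"
  shows "tt \<omega> n = \<infinity>"
proof -
  have n1: "1 \<le> n" using assms by (cases "n = 0") (auto simp: Omega_def)
  have "\<forall>n\<ge>1. \<omega> n = (\<infinity>, None) \<or> (0 < fst (\<omega> n) \<and> fst (\<omega> n) < \<infinity> \<and> snd (\<omega> n) \<in> Some ` S)"
    using \<omega> unfolding Omega_def by blast
  with n1 have "\<omega> n = (\<infinity>, None) \<or> snd (\<omega> n) \<in> Some ` S" by blast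
  with n1 assms have n: "1 \<le> n" "\<omega> n = (\<infinity>, None)" by auto
  then have "fst (\<omega> n) \<le> tt \<omega> n" unfolding tt_def by (intro member_le_sum) auto
  then show ?thesis using n by (simp add: top_unique)
qed

lemma tt_finite: "restrict \<omega> {..n} \<in> Hset S n \<Longrightarrow> tt \<omega> n < \<infinity>"
  unfolding tt_def by (auto simp: Hset_def)

text \<open>The substitution \<open>t = t_n + s\<close> removes the absolute time, so that only the
  first n+2 coordinates of the trajectory remain. After absorption the n-th jump time is infinite
  and both sides vanish.\<close>

lemma sojourn_integral_eq:
  assumes \<omega>: "\<omega> \<in> Omega S" and f: "(\<lambda>(x, a). f x a) \<in> borel_measurable SA"
  shows "sojourn_integral n f \<omega> = indicator (Hset S n) (restrict \<omega> {..n}) *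
    (\<integral>\<^sup>+s. indicator {0<..} s * indicator {\<theta>. ennreal s \<le> \<theta>} (fst (\<omega> (Suc n))) * rate f n (restrict \<omega> {..n}) s \<partial>lborel)"
proof (cases "snd (\<omega> n) = None")
  case True
  then have "restrict \<omega> {..n} \<notin> Hset S n" by (auto simp: Hset_def)
  then show ?thesis using Omega_dead[OF \<omega> True] by (simp add: sojourn_integral_def top_unique)
next
  case False
  define h where "h = restrict \<omega> {..n}"
  have h: "h \<in> Hset S n" using Omega_Hset[OF \<omega> False] by (simp add: h_def)
  then have hs: "h \<in> space (Pn n)" by (simp add: Hset_def)
  obtain x where x: "snd (\<omega> n) = Some x" using False by auto
  have state_ext: "state_ext n h = x" using h x by (simp add: state_ext_def h_def)
  define T where "T = enn2real (tt \<omega> n)"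
  have T: "tt \<omega> n = ennreal T" "0 \<le> T" using tt_finite[of \<omega> n] h by (auto simp: T_def h_def)
  define \<theta> where "\<theta> = fst (\<omega> (Suc n))"
  have tS: "tt \<omega> (Suc n) = ennreal T + \<theta>" by (simp add: tt_Suc T \<theta>_def)
  define g where "g s = indicator {0<..} s * indicator {\<theta>. ennreal s \<le> \<theta>} \<theta> * rate f n h s" for s
  note [measurable] = rate_section[OF f hs]
  have g[measurable]: "g \<in> borel_measurable borel" unfolding g_def by measurable
  have "sojourn_integral n f \<omega> = (\<integral>\<^sup>+t. g (- T + 1 * t) \<partial>lborel)"
    unfolding sojourn_integral_def
  proof (rule nn_integral_cong_AE)
    \<comment> \<open>At the two end points the conventions for state and action disagree; both are
      null. For infinite \<open>\<theta>\<close> the second exclusion repeats the first.\<close>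
    have "AE t in lborel. t \<noteq> T" "AE t in lborel. t \<noteq> T + enn2real \<theta>" by (rule AE_lborel_singleton)+
    then show "AE t in lborel. indicator {t. tt \<omega> n \<le> ennreal t \<and> ennreal t < tt \<omega> (Suc n)} t *
       (case xi \<omega> t of None \<Rightarrow> 0 | Some x \<Rightarrow> \<integral>\<^sup>+a. f x a \<partial>pol A \<pi> \<omega> t) = g (- T + 1 * t)"
    proof eventually_elim
      case (elim t)
      consider "ennreal t < ennreal T" | "t < 0" "T = 0" | "T < t"
        using elim(1) T(2) by (metis ennreal_lessI less_eq_real_def linorder_neqE_linordered_idom)
      then show ?case
      proof cases
        case 1
        then have "t < T" using T(2) by (metis ennreal_leI leD not_le_imp_less)
        then show ?thesis using 1 by (auto simp: g_def T(1) split: split_indicator)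
      next
        \<comment> \<open>\<open>ennreal\<close> sends negative times to 0, so for
          \<open>T = 0\<close> they pass the interval test. They contribute nothing because
          \<open>pol\<close> is the null measure there.\<close>
        case 2
        then have "pol A \<pi> \<omega> t = null_measure (MA A)" by (simp add: pol_def ennreal_neg)
        then show ?thesis using 2 by (simp add: g_def split: option.split)
      next
        case 3
        have less: "ennreal t < tt \<omega> (Suc n) \<longleftrightarrow> ennreal (t - T) < \<theta>"
        proof -
          have "ennreal t = ennreal T + ennreal (t - T)" using 3 T(2) by (simp flip: ennreal_plus)
          then show ?thesis unfolding tS by (simp add: ennreal_add_left_cancel_less)
        qed
        have ne: "ennreal (t - T) \<noteq> \<theta>" using elim(2) 3 by auto
        show ?thesis
        proof (cases "ennreal (t - T) < \<theta>")
          case True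
          have t1: "tt \<omega> n < ennreal t" using 3 T by (simp add: ennreal_less_iff)
          have "pol A \<pi> \<omega> t = policy_ext n h (t - T)"
            using pol_eq[of \<omega> n t A \<pi>] t1 less True h 3 by (simp add: policy_ext_def h_def T_def)
          moreover have "xi \<omega> t = Some x" using xi_eq[of \<omega> n t] t1 less True x by simp
          ultimately show ?thesis using t1 less True 3 by (simp add: g_def rate_def state_ext)
        next
          case False
          then show ?thesis using ne less by (auto simp: g_def split: split_indicator)
        qed
      qed
    qed
  qed
  also have "\<dots> = (\<integral>\<^sup>+s. g s \<partial>lborel)"
    using nn_integral_real_affine[OF g, of 1 "- T"] by simp
  finally show ?thesis using h by (simp add: h_def g_def \<theta>_def)
qed

end

section \<open>Laws of the histories and the occupancy functional\<close>

locale ctmdp_process = ctmdp S A qt \<gamma> \<pi> for S :: "'s::polish_space set" and A :: "'a::polish_space set"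
    and qt :: "'s \<Rightarrow> 'a \<Rightarrow> 's measure" and \<gamma> :: "'s measure"
    and \<pi> :: "nat \<Rightarrow> (nat \<Rightarrow> ennreal \<times> 's option) \<Rightarrow> real \<Rightarrow> 'a measure" +
  fixes P :: "(nat \<Rightarrow> ennreal \<times> 's option) measure"
  assumes P: "ct_strategic_measure S qt \<gamma> \<pi> P"
begin

abbreviation "Q n \<equiv> ct_marg S qt \<gamma> \<pi> n"

lemma prob_P: "prob_space P" and space_P: "space P = Omega S" and sets_P: "sets P = sets (MOmega S)"
  and Q_eq: "distr P (Pn n) (\<lambda>\<omega>. restrict \<omega> {..n}) = Q n"
  using P unfolding ct_strategic_measure_def by auto

lemma restrict_P: "(\<lambda>\<omega>. restrict \<omega> {..n}) \<in> P \<rightarrow>\<^sub>M Pn n"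
proof -
  have "(\<lambda>\<omega>. restrict \<omega> {..n}) \<in> PiM UNIV (\<lambda>_. Mstep S) \<rightarrow>\<^sub>M Pn n"
    by (rule measurable_restrict_subset) simp
  then have "(\<lambda>\<omega>. restrict \<omega> {..n}) \<in> MOmega S \<rightarrow>\<^sub>M Pn n"
    unfolding MOmega_def by (rule measurable_restrict_space1)
  then show ?thesis by (simp cong: measurable_cong_sets add: sets_P)
qed

text \<open>Obtained from \<open>P\<close> and not from the recursion of \<open>ct_marg\<close>,
  whose kernels are not known to be measurable. It supplies the hypothesis under which such a bind
  can be replaced by a measurable one.\<close>

lemma prob_Q: "prob_space (Q n)"
  unfolding Q_eq[symmetric] by (rule prob_space.prob_space_distr[OF prob_P restrict_P])

lemma sets_Q[simp, measurable_cong]: "sets (Q n) = sets (Pn n)" and space_Q[simp]: "space (Q n) = space (Pn n)"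
  unfolding Q_eq[symmetric] by simp_all

lemma dead_sets: "{h \<in> space (Pn n). snd (h n) = None} \<in> sets (Pn n)"
proof -
  have "(\<lambda>h. snd (h n)) \<in> Pn n \<rightarrow>\<^sub>M MSi S" by (rule snd_coord) simp
  from measurable_sets[OF this None_sets_MSi]
  have "(\<lambda>h. snd (h n)) -` {None} \<inter> space (Pn n) \<in> sets (Pn n)" .
  then show ?thesis by (simp add: vimage_def Int_def conj_commute)
qed

lemma append_step_measurable: "(\<lambda>(h, y). append_step n h y) \<in> Pn n \<Otimes>\<^sub>M Mstep S \<rightarrow>\<^sub>M Pn (Suc n)"
  unfolding append_step_def split_beta'
proof (rule measurable_restrict)
  fix i assume i: "i \<in> {..Suc n}"
  show "(\<lambda>z. if i = Suc n then snd z else fst z i) \<in> Pn n \<Otimes>\<^sub>M Mstep S \<rightarrow>\<^sub>M Mstep S"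
  proof (cases "i = Suc n")
    case False
    then have "(\<lambda>h. h i) \<in> Pn n \<rightarrow>\<^sub>M Mstep S" using i by (intro coord_measurable) auto
    from measurable_compose[OF measurable_fst[of "Pn n" "Mstep S"] this] False show ?thesis by simp
  qed simp
qed

text \<open>Inherited from \<open>Omega\<close>, where absorption is permanent: a history whose last
  state is alive has been admissible throughout. Almost every history is thus one on which
  \<open>ct_step\<close> and \<open>ct_kernel\<close> agree.\<close>

lemma Q_good: "AE h in Q n. h \<in> Hset S n \<or> snd (h n) = None"
proof -
  have "AE \<omega> in P. restrict \<omega> {..n} \<in> Hset S n \<or> snd (restrict \<omega> {..n} n) = None"
    using Omega_Hset by (auto simp: space_P)
  moreover have "{h \<in> space (Pn n). h \<in> Hset S n \<or> snd (h n) = None} \<in> sets (Pn n)"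
  proof -
    have "{h \<in> space (Pn n). h \<in> Hset S n \<or> snd (h n) = None} = Hset S n \<union> {h \<in> space (Pn n). snd (h n) = None}"
      by (auto simp: Hset_def)
    then show ?thesis using Hset_sets[of n] dead_sets[of n] by simp
  qed
  ultimately show ?thesis unfolding Q_eq[symmetric] by (subst AE_distr_iff[OF restrict_P])
qed

lemma Q_Suc: "Q (Suc n) = Q n \<bind> (\<lambda>h. distr (ct_kernel n h) (Pn (Suc n)) (append_step n h))"
proof -
  have Suc: "Q (Suc n) = Q n \<bind> (\<lambda>h. distr (ct_step S qt \<pi> n h) (Pn (Suc n)) (append_step n h))"
    by (simp add: append_step_def[abs_def])
  show ?thesis
    unfolding Suc
  proof (rule bind_cong_null_nonmeasurable[OF prob_Q])
    show "prob_space (Q n \<bind> (\<lambda>h. distr (ct_step S qt \<pi> n h) (Pn (Suc n)) (append_step n h)))"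
      unfolding Suc[symmetric] by (rule prob_Q)
    have "(\<lambda>h. distr (ct_kernel n h) (Pn (Suc n)) (append_step n h)) \<in> Pn n \<rightarrow>\<^sub>M subprob_algebra (Pn (Suc n))"
      by (rule measurable_distr2[OF append_step_measurable measurable_prob_algebraD[OF ct_kernel_measurable]])
    then show "(\<lambda>h. distr (ct_kernel n h) (Pn (Suc n)) (append_step n h)) \<in> Q n \<rightarrow>\<^sub>M subprob_algebra (Pn (Suc n))"
      by (simp cong: measurable_cong_sets)
    show "AE h in Q n. distr (ct_step S qt \<pi> n h) (Pn (Suc n)) (append_step n h) = distr (ct_kernel n h) (Pn (Suc n)) (append_step n h)"
      using Q_good[of n] by eventually_elim (simp add: ct_step_eq)
  qed simp
qed

lemma nn_integral_Q_Suc: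
  assumes "f \<in> borel_measurable (Pn (Suc n))"
  shows "(\<integral>\<^sup>+h. f h \<partial>Q (Suc n)) = (\<integral>\<^sup>+h. \<integral>\<^sup>+y. f (append_step n h y) \<partial>ct_kernel n h \<partial>Q n)"
  unfolding Q_Suc
proof (rule nn_integral_bind_distr[OF assms])
  show "(\<lambda>(h, y). append_step n h y) \<in> Q n \<Otimes>\<^sub>M Mstep S \<rightarrow>\<^sub>M Pn (Suc n)"
    using append_step_measurable[of n] by (simp cong: measurable_cong_sets)
  show "ct_kernel n \<in> Q n \<rightarrow>\<^sub>M subprob_algebra (Mstep S)"
    using measurable_prob_algebraD[OF ct_kernel_measurable] by (simp cong: measurable_cong_sets)
qed

lemma ct_kernel_tail:
  assumes h: "h \<in> Hset S n" and s: "0 < s"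
  shows "(\<integral>\<^sup>+y. indicator {\<theta>. ennreal s \<le> \<theta>} (fst y) \<partial>ct_kernel n h) = surv (rate qrate n h) s"
proof -
  have hs: "h \<in> space (Pn n)" using h by (simp add: Hset_def)
  have m: "(\<lambda>y. indicator {\<theta>. ennreal s \<le> \<theta>} (fst y)) \<in> borel_measurable (Mstep S)" unfolding Mstep_def by measurable
  have "(\<integral>\<^sup>+y. indicator {\<theta>. ennreal s \<le> \<theta>} (fst y) \<partial>ct_kernel n h)
    = (\<integral>\<^sup>+u. jump_density (rate qrate n h) u * indicator {\<theta>. ennreal s \<le> \<theta>} (jump_time u) \<partial>lborel)"
    unfolding nn_integral_ct_kernel[OF h m]
    by (intro nn_integral_cong) (auto simp: jump_time_def cemetery_def prob_space.emeasure_space_1 post_jump_prob hs)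
  also have "\<dots> = surv (rate qrate n h) s"
    by (rule jump_density_tail[OF rate_section[OF qrate_measurable hs] rate_qrate_le[OF hs]]) (use s in \<open>auto simp: rate_bound state_ext_in_S hs\<close>)
  finally show ?thesis .
qed

text \<open>The expected integral of \<open>f\<close> over the n-th sojourn, without the weight
  \<open>qrate\<close>. Costs are obtained directly, and the occupancy measure by inserting
  \<open>qrate\<close> times an indicator.\<close>

definition "occ_integral n f = (\<integral>\<^sup>+h. indicator (Hset S n) h *
  soj f n h \<partial>Q n)"

lemma append_step_restrict: "h \<in> space (Pn n) \<Longrightarrow> restrict (append_step n h y) {..n} = h"
  by (auto simp: append_step_def restrict_def fun_eq_iff space_PiM PiE_iff extensional_def)

lemma restrict_Pn: "(\<lambda>h. restrict h {..n}) \<in> Pn (Suc n) \<rightarrow>\<^sub>M Pn n"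
  by (rule measurable_restrict_subset) auto

text \<open>\<open>P\<close> is accessible only through its finite-dimensional marginals, so the
  integrand is first written as a function \<open>F\<close> of the history up to n+1. Conditioning
  on the history up to n and exchanging the integrals replaces the indicator of
  \<open>s \<le> \<theta>\<close> by the survival function.\<close>

lemma nn_integral_sojourn_integral:
  assumes f: "(\<lambda>(x, a). f x a) \<in> borel_measurable SA"
  shows "(\<integral>\<^sup>+\<omega>. sojourn_integral n f \<omega> \<partial>P) = occ_integral n f"
proof -
   define F where "F h = indicator (Hset S n) (restrict h {..n}) *
    (\<integral>\<^sup>+s. indicator {0<..} s * indicator {\<theta>. ennreal s \<le> \<theta>} (fst (h (Suc n))) * rate f n (restrict h {..n}) s \<partial>lborel)" for h
  have F: "F \<in> borel_measurable (Pn (Suc n))"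
  proof -
    have 1: "(\<lambda>(h, s). rate f n (restrict h {..n}) s) \<in> borel_measurable (Pn (Suc n) \<Otimes>\<^sub>M borel)"
      using measurable_compose[OF measurable_Pair[OF measurable_compose[OF measurable_fst restrict_Pn] measurable_snd] rate_measurable[OF f, of n]]
      by (simp add: split_beta')
    have 2: "(\<lambda>h. indicator (Hset S n) (restrict h {..n}) :: ennreal) \<in> borel_measurable (Pn (Suc n))"
      by (rule measurable_compose[OF restrict_Pn]) simp
    show ?thesis unfolding F_def
      by (rule borel_measurable_times_ennreal[OF 2 tail_integral_measurable[OF fst_coord 1]]) simp
  qed
  have "(\<integral>\<^sup>+\<omega>. sojourn_integral n f \<omega> \<partial>P) = (\<integral>\<^sup>+\<omega>. F (restrict \<omega> {..Suc n}) \<partial>P)"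
  proof (rule nn_integral_cong)
    fix \<omega> assume "\<omega> \<in> space P"
    moreover have "restrict (restrict \<omega> {..Suc n}) {..n} = restrict \<omega> {..n}" by (auto simp: restrict_def fun_eq_iff)
    ultimately show "sojourn_integral n f \<omega> = F (restrict \<omega> {..Suc n})"
      by (simp add: F_def sojourn_integral_eq[OF _ f] space_P)
  qed
  also have "\<dots> = (\<integral>\<^sup>+h. F h \<partial>Q (Suc n))"
    unfolding Q_eq[symmetric] by (rule nn_integral_distr[symmetric, OF restrict_P]) (use F in simp)
  also have "\<dots> = (\<integral>\<^sup>+h. \<integral>\<^sup>+y. F (append_step n h y) \<partial>ct_kernel n h \<partial>Q n)" by (rule nn_integral_Q_Suc[OF F])
  also have "\<dots> = occ_integral n f"
    unfolding occ_integral_def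
  proof (rule nn_integral_cong)
    fix h assume "h \<in> space (Q n)"
    then have hs: "h \<in> space (Pn n)" by simp
    note [measurable] = rate_section[OF f hs]
    note sk = sets_kernel[OF measurable_prob_algebraD[OF ct_kernel_measurable] hs]
    have pk: "prob_space (ct_kernel n h)" using measurable_space[OF ct_kernel_measurable hs] by (simp add: space_prob_algebra)
    interpret ct_kernel: prob_space "ct_kernel n h" by (rule pk)
    interpret pair_sigma_finite lborel "ct_kernel n h" ..
    have mk[measurable]: "fst \<in> ct_kernel n h \<rightarrow>\<^sub>M borel" using sk by (simp add: Mstep_def cong: measurable_cong_sets)
    have "(\<integral>\<^sup>+y. F (append_step n h y) \<partial>ct_kernel n h) = (\<integral>\<^sup>+y. indicator (Hset S n) h *
      (\<integral>\<^sup>+s. indicator {0<..} s * indicator {\<theta>. ennreal s \<le> \<theta>} (fst y) * rate f n h s \<partial>lborel) \<partial>ct_kernel n h)"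
      unfolding F_def by (simp add: append_step_restrict hs) (simp add: append_step_def)
    also have "\<dots> = indicator (Hset S n) h * soj f n h"
    proof (cases "h \<in> Hset S n")
      case True
      have "(\<integral>\<^sup>+y. \<integral>\<^sup>+s. indicator {0<..} s * indicator {\<theta>. ennreal s \<le> \<theta>} (fst y) * rate f n h s \<partial>lborel \<partial>ct_kernel n h)
        = (\<integral>\<^sup>+s. \<integral>\<^sup>+y. indicator {0<..} s * indicator {\<theta>. ennreal s \<le> \<theta>} (fst y) * rate f n h s \<partial>ct_kernel n h \<partial>lborel)"
      proof (rule Fubini')
        have "(\<lambda>(s, y). if 0 < s \<and> ennreal s \<le> fst y then rate f n h s else 0) \<in> borel_measurable (lborel \<Otimes>\<^sub>M ct_kernel n h)"
          by measurable
        also have "(\<lambda>(s, y). if 0 < s \<and> ennreal s \<le> fst y then rate f n h s else 0) =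
            (\<lambda>(s, y). indicator {0<..} s * indicator {\<theta>. ennreal s \<le> \<theta>} (fst y) * rate f n h s)"
          by (auto simp: fun_eq_iff)
        finally show "(\<lambda>(s, y). indicator {0<..} s * indicator {\<theta>. ennreal s \<le> \<theta>} (fst y) * rate f n h s) \<in> borel_measurable (lborel \<Otimes>\<^sub>M ct_kernel n h)" .
      qed
      also have "\<dots> = soj f n h"
      proof (rule nn_integral_cong)
        fix s :: real
        have "(\<integral>\<^sup>+y. indicator {0<..} s * indicator {\<theta>. ennreal s \<le> \<theta>} (fst y) * rate f n h s \<partial>ct_kernel n h)
          = (\<integral>\<^sup>+y. indicator {0<..} s * rate f n h s * indicator {\<theta>. ennreal s \<le> \<theta>} (fst y) \<partial>ct_kernel n h)"
          by (simp add: ac_simps)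
        also have "\<dots> = indicator {0<..} s * rate f n h s * (\<integral>\<^sup>+y. indicator {\<theta>. ennreal s \<le> \<theta>} (fst y) \<partial>ct_kernel n h)"
          by (rule nn_integral_cmult) measurable
        also have "\<dots> = indicator {0<..} s * surv (rate qrate n h) s * rate f n h s"
          using ct_kernel_tail[OF True, of s] by (auto simp: ac_simps split: split_indicator)
        finally show "(\<integral>\<^sup>+y. indicator {0<..} s * indicator {\<theta>. ennreal s \<le> \<theta>} (fst y) * rate f n h s \<partial>ct_kernel n h) =
          indicator {0<..} s * surv (rate qrate n h) s * rate f n h s" .
      qed
      finally show ?thesis using True by simp
    qed simp
    finally show "(\<integral>\<^sup>+y. F (append_step n h y) \<partial>ct_kernel n h) =
      indicator (Hset S n) h * soj f n h" .
  qed
  finally show ?thesis .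
qed

text \<open>The density of the jump time carries the factor \<open>rate qrate\<close>, and the
  post-jump law is normalised by it. The two cancel and leave the rate into \<open>G\<close>; the
  case of rate zero is included.\<close>

lemma next_state_law:
  assumes G: "G \<in> sets (MS S)"
  shows "emeasure (Q (Suc n)) {h \<in> space (Pn (Suc n)). snd (h (Suc n)) \<in> Some ` G} = occ_integral n (rate_into G)"
proof -
  note SG = image_Some_sets[OF G]
  let ?I = "\<lambda>h :: nat \<Rightarrow> ennreal \<times> 's option. indicator (Some ` G) (snd (h (Suc n))) :: ennreal"
  have mI: "?I \<in> borel_measurable (Pn (Suc n))"
    by (rule measurable_compose[OF snd_coord]) (use SG in auto)
  have "(\<lambda>h. snd (h (Suc n))) \<in> Pn (Suc n) \<rightarrow>\<^sub>M MSi S" by (rule snd_coord) simp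
  from measurable_sets[OF this SG]
  have "(\<lambda>h. snd (h (Suc n))) -` Some ` G \<inter> space (Pn (Suc n)) \<in> sets (Pn (Suc n))" .
  then have m: "{h \<in> space (Pn (Suc n)). snd (h (Suc n)) \<in> Some ` G} \<in> sets (Pn (Suc n))"
    by (simp add: vimage_def Int_def conj_commute)
  have "emeasure (Q (Suc n)) {h \<in> space (Pn (Suc n)). snd (h (Suc n)) \<in> Some ` G} = (\<integral>\<^sup>+h. ?I h \<partial>Q (Suc n))"
  proof -
    have "(\<integral>\<^sup>+h. ?I h \<partial>Q (Suc n)) = (\<integral>\<^sup>+h. indicator {h \<in> space (Pn (Suc n)). snd (h (Suc n)) \<in> Some ` G} h \<partial>Q (Suc n))"
      by (intro nn_integral_cong) (auto split: split_indicator simp del: ct_marg.simps)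
    then show ?thesis using m by (simp del: ct_marg.simps)
  qed
  also have "\<dots> = (\<integral>\<^sup>+h. \<integral>\<^sup>+y. ?I (append_step n h y) \<partial>ct_kernel n h \<partial>Q n)" by (rule nn_integral_Q_Suc[OF mI])
  also have "\<dots> = occ_integral n (rate_into G)"
    unfolding occ_integral_def
  proof (rule nn_integral_cong)
    fix h assume "h \<in> space (Q n)"
    then have hs: "h \<in> space (Pn n)" by simp
    have mS: "(\<lambda>y. indicator (Some ` G) (snd y) :: ennreal) \<in> borel_measurable (Mstep S)"
      unfolding Mstep_def using SG by measurable
    have "(\<integral>\<^sup>+y. ?I (append_step n h y) \<partial>ct_kernel n h) = (\<integral>\<^sup>+y. indicator (Some ` G) (snd y) \<partial>ct_kernel n h)" by (simp add: append_step_def)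
    also have "\<dots> = indicator (Hset S n) h * soj (rate_into G) n h"
    proof (cases "h \<in> Hset S n")
      case True
      have "(\<integral>\<^sup>+y. indicator (Some ` G) (snd y) \<partial>ct_kernel n h) = soj (rate_into G) n h"
        unfolding nn_integral_ct_kernel[OF True mS]
      proof (rule nn_integral_cong)
        fix s :: real
        have "(\<integral>\<^sup>+y. indicator (Some ` G) y \<partial>post_jump n h s) = emeasure (post_jump n h s) (Some ` G)"
          by (rule nn_integral_indicator) (simp add: sets_post_jump SG)
        then show "jump_density (rate qrate n h) s * (if 0 < s then \<integral>\<^sup>+y. indicator (Some ` G) (snd (ennreal s, y)) \<partial>post_jump n h s
            else indicator (Some ` G) (snd cemetery)) = indicator {0<..} s * surv (rate qrate n h) s * rate (rate_into G) n h s"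
          by (auto simp: jump_density_def cemetery_def post_jump_Some[OF hs G, symmetric] ac_simps)
      qed
      then show ?thesis using True by simp
    next
      case False
      then show ?thesis using cemetery_space mS by (simp add: ct_kernel_def nn_integral_return) (simp add: cemetery_def)
    qed
    finally show "(\<integral>\<^sup>+y. ?I (append_step n h y) \<partial>ct_kernel n h) =
      indicator (Hset S n) h * soj (rate_into G) n h" .
  qed
  finally show ?thesis .
qed

section \<open>The occupancy functional as a measure on state-action pairs\<close>

lemma occ_integral_cong:
  assumes "\<And>x a. x \<in> S \<Longrightarrow> a \<in> A \<Longrightarrow> f x a = g x a"
  shows "occ_integral n f = occ_integral n g"
proof -
  have "rate f n h s = rate g n h s" if h: "h \<in> space (Pn n)" for h s
    unfolding rate_def using assms state_ext_in_S[OF h] sets_eq_imp_space_eq[of "policy_ext n h s" "MA A"] policy_ext_space[OF h]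
    by (intro nn_integral_cong) auto
  then show ?thesis unfolding occ_integral_def by (intro nn_integral_cong) auto
qed

definition "sojourn_base n = density (Q n \<Otimes>\<^sub>M lborel)
  (\<lambda>z. indicator (Hset S n) (fst z) * (indicator {0<..} (snd z) * surv (rate qrate n (fst z)) (snd z)))"

text \<open>Realises \<open>occ_integral n\<close> as integration against a measure, which makes
  densities, images and disintegration available. Its total mass may be infinite; finiteness appears
  only after weighting by \<open>qrate\<close>.\<close>

definition "sojourn_law n = sojourn_base n \<bind> (\<lambda>z. distr (policy_ext n (fst z) (snd z)) SA (Pair (state_ext n (fst z))))"

lemma sojourn_base_weight_measurable: "(\<lambda>z. indicator (Hset S n) (fst z) * (indicator {0<..} (snd z) * surv (rate qrate n (fst z)) (snd z)))
  \<in> borel_measurable (Q n \<Otimes>\<^sub>M lborel)"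
proof -
  have s: "(\<lambda>z. surv (rate qrate n (fst z)) (snd z)) \<in> borel_measurable (Pn n \<Otimes>\<^sub>M borel)"
    using surv_measurable[OF rate_measurable[OF qrate_measurable, of n]] by (simp add: split_beta')
  have i: "(\<lambda>z. indicator (Hset S n) (fst z) :: ennreal) \<in> borel_measurable (Pn n \<Otimes>\<^sub>M (borel :: real measure))"
    by (rule measurable_compose[OF measurable_fst borel_measurable_indicator[OF Hset_sets]])
  have "(\<lambda>z. indicator (Hset S n) (fst z) * (indicator {0<..} (snd z) * surv (rate qrate n (fst z)) (snd z)))
    \<in> borel_measurable (Pn n \<Otimes>\<^sub>M borel)"
    by (intro borel_measurable_times_ennreal i s measurable_compose[OF measurable_snd borel_measurable_indicator]) simp
  then show ?thesis by (simp cong: measurable_cong_sets)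
qed

lemma sets_sojourn_base: "sets (sojourn_base n) = sets (Pn n \<Otimes>\<^sub>M borel)"
  unfolding sojourn_base_def by (simp cong: sets_pair_measure_cong)

lemma policy_base: "(\<lambda>z. policy_ext n (fst z) (snd z)) \<in> sojourn_base n \<rightarrow>\<^sub>M subprob_algebra (MA A)"
  using measurable_prob_algebraD[OF policy_ext_measurable[of n]] by (simp add: split_beta' sets_sojourn_base cong: measurable_cong_sets)

lemma state_base: "(\<lambda>(z, a). (state_ext n (fst z), a)) \<in> sojourn_base n \<Otimes>\<^sub>M MA A \<rightarrow>\<^sub>M SA"
proof -
  have "(\<lambda>(z, a). (state_ext n (fst z), a)) \<in> (Pn n \<Otimes>\<^sub>M (borel :: real measure)) \<Otimes>\<^sub>M MA A \<rightarrow>\<^sub>M SA"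
    unfolding split_beta'
    by (intro measurable_Pair measurable_snd measurable_compose[OF measurable_compose[OF measurable_fst measurable_fst] state_ext_measurable])
  then show ?thesis by (simp add: sets_sojourn_base cong: measurable_cong_sets)
qed

lemma space_Pn_ne: "space (Pn n) \<noteq> {}" using prob_space.not_empty[OF prob_Q[of n]] by simp

lemma sets_sojourn_law: "sets (sojourn_law n) = sets SA"
  unfolding sojourn_law_def
  by (rule sets_bind) (use space_Pn_ne sets_eq_imp_space_eq[OF sets_sojourn_base] in \<open>auto simp: space_pair_measure\<close>)

lemma nn_integral_sojourn_law:
  assumes f: "(\<lambda>(x, a). f x a) \<in> borel_measurable SA"
  shows "(\<integral>\<^sup>+z. f (fst z) (snd z) \<partial>sojourn_law n) = occ_integral n f"
proof -
  interpret Q: prob_space "Q n" by (rule prob_Q)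
  have f': "(\<lambda>z. f (fst z) (snd z)) \<in> borel_measurable SA" using f by (simp add: split_beta')
  have r: "(\<lambda>z. rate f n (fst z) (snd z)) \<in> borel_measurable (Q n \<Otimes>\<^sub>M lborel)"
    using rate_measurable[OF f, of n] by (simp add: split_beta' cong: measurable_cong_sets)
  have "(\<integral>\<^sup>+z. f (fst z) (snd z) \<partial>sojourn_law n) = (\<integral>\<^sup>+z. rate f n (fst z) (snd z) \<partial>sojourn_base n)"
    unfolding sojourn_law_def rate_def nn_integral_bind_distr[OF f' state_base policy_base] by simp
  also have "\<dots> = (\<integral>\<^sup>+z. indicator (Hset S n) (fst z) * (indicator {0<..} (snd z) * surv (rate qrate n (fst z)) (snd z)) * rate f n (fst z) (snd z)
      \<partial>(Q n \<Otimes>\<^sub>M lborel))"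
    unfolding sojourn_base_def by (rule nn_integral_density[OF sojourn_base_weight_measurable r])
  also have "\<dots> = (\<integral>\<^sup>+h. \<integral>\<^sup>+s. indicator (Hset S n) h * (indicator {0<..} s * surv (rate qrate n h) s) * rate f n h s \<partial>lborel \<partial>Q n)"
    using borel_measurable_times_ennreal[OF sojourn_base_weight_measurable r]
    by (subst lborel.nn_integral_fst[symmetric]) auto
  also have "\<dots> = occ_integral n f"
    unfolding occ_integral_def
  proof (rule nn_integral_cong)
    fix h assume "h \<in> space (Q n)"
    show "(\<integral>\<^sup>+s. indicator (Hset S n) h * (indicator {0<..} s * surv (rate qrate n h) s) * rate f n h s \<partial>lborel)
      = indicator (Hset S n) h * soj f n h"
      by (cases "h \<in> Hset S n") auto
  qed
  finally show ?thesis .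
qed

lemma occ_integral_add:
  assumes f: "(\<lambda>(x, a). f x a) \<in> borel_measurable SA" and g: "(\<lambda>(x, a). g x a) \<in> borel_measurable SA"
  shows "occ_integral n (\<lambda>x a. f x a + g x a) = occ_integral n f + occ_integral n g"
proof -
  have fg: "(\<lambda>(x, a). f x a + g x a) \<in> borel_measurable SA" using f g by measurable
  have "(\<integral>\<^sup>+z. f (fst z) (snd z) + g (fst z) (snd z) \<partial>sojourn_law n) = (\<integral>\<^sup>+z. f (fst z) (snd z) \<partial>sojourn_law n) + (\<integral>\<^sup>+z. g (fst z) (snd z) \<partial>sojourn_law n)"
    using f g by (intro nn_integral_add) (simp_all add: split_beta' sets_sojourn_law cong: measurable_cong_sets)
  then show ?thesis unfolding nn_integral_sojourn_law[OF fg] nn_integral_sojourn_law[OF f] nn_integral_sojourn_law[OF g] .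
qed

text \<open>On an admissible history \<open>soj qrate n h\<close> is the probability that the n-th
  sojourn ever ends.\<close>

lemma occ_integral_qrate_le_1: "occ_integral n qrate \<le> 1"
proof -
  interpret Q: prob_space "Q n" by (rule prob_Q)
  have "occ_integral n qrate \<le> (\<integral>\<^sup>+h. 1 \<partial>Q n)"
    unfolding occ_integral_def
  proof (rule nn_integral_mono)
    fix h assume "h \<in> space (Q n)"
    then have hs: "h \<in> space (Pn n)" by simp
    have "soj qrate n h \<le> 1"
      using surv_total_le_1[OF rate_section[OF qrate_measurable hs] rate_qrate_le[OF hs] rate_bound(1)[OF state_ext_in_S[OF hs]]]
      by (simp add: ac_simps)
    then show "indicator (Hset S n) h * soj qrate n h \<le> 1"
      by (auto split: split_indicator)
  qed
  then show ?thesis using Q.emeasure_space_1 by simp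
qed

text \<open>The n-th sojourn is part of the whole time axis, so finite total costs bound each of
  these integrals. This is where feasibility enters.\<close>

lemma occ_integral_le_ct_cost:
  assumes f: "(\<lambda>(x, a). f x a) \<in> borel_measurable SA"
  shows "occ_integral n (\<lambda>x a. ennreal (f x a)) \<le> ct_cost A \<pi> P f"
proof -
  have f': "(\<lambda>(x, a). ennreal (f x a)) \<in> borel_measurable SA" using f by measurable
  have "occ_integral n (\<lambda>x a. ennreal (f x a)) = (\<integral>\<^sup>+\<omega>. sojourn_integral n (\<lambda>x a. ennreal (f x a)) \<omega> \<partial>P)"
    by (rule nn_integral_sojourn_integral[OF f', symmetric])
  also have "\<dots> \<le> ct_cost A \<pi> P f"
    unfolding ct_cost_def sojourn_integral_def
  proof (intro nn_integral_mono)
    fix \<omega> and t :: real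
    \<comment> \<open>For \<open>n = 0\<close> the interval test admits negative times, because
      \<open>ennreal\<close> truncates them to 0.\<close>
    have "(case xi \<omega> t of None \<Rightarrow> 0 | Some x \<Rightarrow> \<integral>\<^sup>+a. ennreal (f x a) \<partial>pol A \<pi> \<omega> t) = 0" if "t < 0"
    proof -
      have "pol A \<pi> \<omega> t = null_measure (MA A)" using that by (simp add: pol_def ennreal_neg)
      then show ?thesis by (simp split: option.split)
    qed
    then show "indicator {t. tt \<omega> n \<le> ennreal t \<and> ennreal t < tt \<omega> (Suc n)} t *
        (case xi \<omega> t of None \<Rightarrow> 0 | Some x \<Rightarrow> \<integral>\<^sup>+a. ennreal (f x a) \<partial>pol A \<pi> \<omega> t)
      \<le> indicator {0..} t * (case xi \<omega> t of None \<Rightarrow> 0 | Some x \<Rightarrow> \<integral>\<^sup>+a. ennreal (f x a) \<partial>pol A \<pi> \<omega> t)"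
      by (cases "t < 0") (auto split: split_indicator)
  qed
  finally show ?thesis .
qed

text \<open>The lower bound $\delta$ makes the expected sojourn time finite, so that a jump is certain.\<close>

lemma occ_integral_qrate_eq_state_law:
  assumes C: "(\<lambda>(x, a). C x a) \<in> borel_measurable SA" and fin: "occ_integral n C < \<infinity>"
    and G: "G \<in> sets (MS S)" and \<delta>: "\<And>x. x \<in> G \<Longrightarrow> 0 < \<delta> x"
    and lower: "\<And>x a. x \<in> G \<Longrightarrow> a \<in> A \<Longrightarrow> ennreal (\<delta> x) \<le> qrate x a + C x a"
  shows "occ_integral n (\<lambda>x a. indicator G x * qrate x a) = emeasure (Q n) {h \<in> space (Pn n). snd (h n) \<in> Some ` G}"
proof -
  have qC: "(\<lambda>(x, a). qrate x a + C x a) \<in> borel_measurable SA" using C by measurable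
  let ?I = "\<lambda>h. \<integral>\<^sup>+s. indicator {0<..} s * surv (rate qrate n h) s * rate (\<lambda>x a. qrate x a + C x a) n h s \<partial>lborel"
  have Im: "(\<lambda>h. indicator (Hset S n) h * ?I h) \<in> borel_measurable (Q n)"
  proof -
    have m: "(\<lambda>(h, s). indicator {0<..} s * surv (rate qrate n h) s * rate (\<lambda>x a. qrate x a + C x a) n h s) \<in> borel_measurable (Pn n \<Otimes>\<^sub>M lborel)"
    proof -
      have "(\<lambda>(h, s). indicator {0<..} s * surv (rate qrate n h) s * rate (\<lambda>x a. qrate x a + C x a) n h s) \<in> borel_measurable (Pn n \<Otimes>\<^sub>M borel)"
        using surv_measurable[OF rate_measurable[OF qrate_measurable, of n]] rate_measurable[OF qC, of n]
        unfolding split_beta'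
        by (intro borel_measurable_times_ennreal measurable_compose[OF measurable_snd borel_measurable_indicator]) simp_all
      then show ?thesis by (simp cong: measurable_cong_sets)
    qed
    have "?I \<in> borel_measurable (Pn n)" by (rule lborel.borel_measurable_nn_integral[OF m])
    then have "(\<lambda>h. indicator (Hset S n) h * ?I h) \<in> borel_measurable (Pn n)"
      by (intro borel_measurable_times_ennreal borel_measurable_indicator Hset_sets)
    then show ?thesis by (simp cong: measurable_cong_sets)
  qed
  have "occ_integral n (\<lambda>x a. qrate x a + C x a) \<noteq> \<infinity>"
    unfolding occ_integral_add[OF qrate_measurable C] using occ_integral_qrate_le_1[of n] fin by (auto simp: top_unique)
  then have "AE h in Q n. indicator (Hset S n) h * ?I h \<noteq> \<infinity>"
    unfolding occ_integral_def by (intro nn_integral_PInf_AE[OF Im])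
  then have one: "AE h in Q n. h \<in> Hset S n \<longrightarrow> state_ext n h \<in> G \<longrightarrow>
     soj qrate n h = 1"
    using AE_space
  proof eventually_elim
    case (elim h)
    show ?case
    proof (intro impI)
      assume h: "h \<in> Hset S n" and x: "state_ext n h \<in> G"
      have hs: "h \<in> space (Pn n)" using h by (simp add: Hset_def)
      note J = rate_section[OF qrate_measurable hs] rate_qrate_le[OF hs] rate_bound(1)[OF state_ext_in_S[OF hs]]
      have sm: "(\<lambda>s. indicator {0<..} s * surv (rate qrate n h) s) \<in> borel_measurable lborel"
        using surv_meas[OF J] by measurable
      have "ennreal (\<delta> (state_ext n h)) * (\<integral>\<^sup>+s. indicator {0<..} s * surv (rate qrate n h) s \<partial>lborel)
        = (\<integral>\<^sup>+s. ennreal (\<delta> (state_ext n h)) * (indicator {0<..} s * surv (rate qrate n h) s) \<partial>lborel)"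
        by (rule nn_integral_cmult[OF sm, symmetric])
      also have "\<dots> \<le> ?I h"
      proof (rule nn_integral_mono)
        fix s
        have "ennreal (\<delta> (state_ext n h)) = (\<integral>\<^sup>+a. ennreal (\<delta> (state_ext n h)) \<partial>policy_ext n h s)"
          using policy_ext_space[OF hs, of s] by (simp add: prob_space.emeasure_space_1)
        also have "\<dots> \<le> rate (\<lambda>x a. qrate x a + C x a) n h s"
          unfolding rate_def using lower[OF x] sets_eq_imp_space_eq[of "policy_ext n h s" "MA A"] policy_ext_space[OF hs, of s]
          by (intro nn_integral_mono) auto
        finally show "ennreal (\<delta> (state_ext n h)) * (indicator {0<..} s * surv (rate qrate n h) s)
          \<le> indicator {0<..} s * surv (rate qrate n h) s * rate (\<lambda>x a. qrate x a + C x a) n h s"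
          by (subst mult.commute) (rule mult_left_mono, auto)
      qed
      also have "\<dots> < \<infinity>" using elim h by (simp add: top.not_eq_extremum)
      finally have "(\<integral>\<^sup>+s. indicator {0<..} s * surv (rate qrate n h) s \<partial>lborel) < \<infinity>"
        using \<delta>[OF x] by (auto simp: ennreal_mult_less_top)
      from surv_total_eq_1[OF J this]
      show "soj qrate n h = 1"
        by (simp add: ac_simps)
    qed
  qed
  have "occ_integral n (\<lambda>x a. indicator G x * qrate x a) = (\<integral>\<^sup>+h. indicator {h \<in> space (Pn n). snd (h n) \<in> Some ` G} h \<partial>Q n)"
    unfolding occ_integral_def
  proof (rule nn_integral_cong_AE)
    show "AE h in Q n. indicator (Hset S n) h * soj (\<lambda>x a. indicator G x * qrate x a) n h
      = indicator {h \<in> space (Pn n). snd (h n) \<in> Some ` G} h"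
      using one Q_good[of n] AE_space
    proof eventually_elim
      case (elim h)
      then have hs: "h \<in> space (Pn n)" by simp
      have r: "rate (\<lambda>x a. indicator G x * qrate x a) n h s = indicator G (state_ext n h) * rate qrate n h s" for s
        by (cases "state_ext n h \<in> G") (auto simp: rate_def)
      show ?case
      proof (cases "h \<in> Hset S n")
        case True
        then obtain x where x: "snd (h n) = Some x" by (auto simp: Hset_def)
        then have state_ext: "state_ext n h = x" using True by (simp add: state_ext_def)
        show ?thesis
        proof (cases "x \<in> G")
          case True
          then show ?thesis using elim(1) \<open>h \<in> Hset S n\<close> hs x state_ext by (simp add: r)
        next
          case False
          then show ?thesis using x state_ext by (auto simp: r split: split_indicator)
        qed
      next
        \<comment> \<open>By \<open>Q_good\<close> the last state of such a history is
          \<open>None\<close>, so both sides are zero.\<close>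
        case False
        then show ?thesis using elim(2) by (auto split: split_indicator)
      qed
    qed
  qed
  also have "\<dots> = emeasure (Q n) {h \<in> space (Pn n). snd (h n) \<in> Some ` G}"
  proof (rule nn_integral_indicator)
    have "(\<lambda>h. snd (h n)) \<in> Pn n \<rightarrow>\<^sub>M MSi S" by (rule snd_coord) simp
    from measurable_sets[OF this image_Some_sets[OF G]]
    show "{h \<in> space (Pn n). snd (h n) \<in> Some ` G} \<in> sets (Q n)"
      by (simp add: vimage_def Int_def conj_commute)
  qed
  finally show ?thesis .
qed

end

section \<open>The discrete-time process under a Markov policy\<close>

lemma prob_MSi_eqI:
  assumes "prob_space M" "prob_space N" and sM: "sets M = sets (MSi S)" and sN: "sets N = sets (MSi S)"
    and eq: "\<And>G. G \<in> sets (MS S) \<Longrightarrow> emeasure M (Some ` G) = emeasure N (Some ` G)"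
  shows "M = N"
proof (rule measure_eqI)
  interpret M: prob_space M by fact
  interpret N: prob_space N by fact
  have SS: "S \<in> sets (MS S)" using sets.top[of "MS S"] by simp
  have spM: "space M = insert None (Some ` S)" and spN: "space N = insert None (Some ` S)"
    using sets_eq_imp_space_eq[OF sM] sets_eq_imp_space_eq[OF sN] by simp_all
  have d: "{None} = insert None (Some ` S) - Some ` S" by auto
  have N1: "emeasure M {None} = emeasure N {None}"
  proof -
    have "emeasure M {None} = 1 - emeasure M (Some ` S)"
      unfolding d using emeasure_compl[of "Some ` S" M] image_Some_sets[OF SS] M.emeasure_space_1 by (simp add: sM spM)
    moreover have "emeasure N {None} = 1 - emeasure N (Some ` S)"
      unfolding d using emeasure_compl[of "Some ` S" N] image_Some_sets[OF SS] N.emeasure_space_1 by (simp add: sN spN)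
    ultimately show ?thesis using eq[OF SS] by simp
  qed
  fix B assume "B \<in> sets M"
  then have B: "B \<in> sets (MSi S)" by (simp add: sM)
  note vB = vimage_Some_sets[OF B]
  show "emeasure M B = emeasure N B"
  proof (cases "None \<in> B")
    case True
    have Beq: "B = Some ` (Some -` B) \<union> {None}"
    proof (rule set_eqI)
      fix y show "y \<in> B \<longleftrightarrow> y \<in> Some ` (Some -` B) \<union> {None}" using True by (cases y) auto
    qed
    have "emeasure M (Some ` (Some -` B) \<union> {None}) = emeasure M (Some ` (Some -` B)) + emeasure M {None}"
      by (rule plus_emeasure[symmetric]) (use image_Some_sets[OF vB] None_sets_MSi[of S] in \<open>auto simp: sM\<close>)
    moreover have "emeasure N (Some ` (Some -` B) \<union> {None}) = emeasure N (Some ` (Some -` B)) + emeasure N {None}"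
      by (rule plus_emeasure[symmetric]) (use image_Some_sets[OF vB] None_sets_MSi[of S] in \<open>auto simp: sN\<close>)
    ultimately show ?thesis using Beq eq[OF vB] N1 by metis
  next
    case False
    have "B = Some ` (Some -` B)"
    proof (rule set_eqI)
      fix y show "y \<in> B \<longleftrightarrow> y \<in> Some ` (Some -` B)" using False by (cases y) auto
    qed
    then show ?thesis using eq[OF vB] by metis
  qed
qed (simp add: sM sN)

context ctmdp begin

lemma pk_Some:
  assumes x: "x \<in> S" and a: "a \<in> A"
  shows "prob_space (pk S qt (Some x) a)" "sets (pk S qt (Some x) a) = sets (MSi S)"
    "B \<in> sets (MSi S) \<Longrightarrow> emeasure (pk S qt (Some x) a) B = ennreal (enn2real (rate_into (Some -` B) x a) / enn2real (qrate x a))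
       + (if None \<in> B then ennreal (1 - enn2real (rate_into S x a) / enn2real (qrate x a)) else 0)"
    "G \<in> sets (MS S) \<Longrightarrow> qrate x a * emeasure (pk S qt (Some x) a) (Some ` G) = rate_into G x a"
proof -
  have rt: "\<And>G. G \<in> sets (MS S) \<Longrightarrow> measure (qt x a) G = measure (qt x a) G" by simp
  have r: "qx qt S x a = measure (qt x a) S" by (rule qx_def)
  note f = finite_qt[OF x a] sets_qt[OF x a] rt r
  have e1: "enn2real (rate_into G x a) = measure (qt x a) G" for G by (simp add: rate_into_def measure_def)
  have e2: "enn2real (qrate x a) = qx qt S x a" by (simp add: qrate_def qx_def)
  have pk: "pk S qt (Some x) a = trans_meas S (measure (qt x a)) (qx qt S x a)" by (simp add: pk_def)
  show "prob_space (pk S qt (Some x) a)" unfolding pk by (rule prob_space_trans_meas[OF f])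
  show "sets (pk S qt (Some x) a) = sets (MSi S)" unfolding pk by (simp add: trans_meas_def sets.sigma_sets_eq del: space_MSi)
  show "emeasure (pk S qt (Some x) a) B = ennreal (enn2real (rate_into (Some -` B) x a) / enn2real (qrate x a))
       + (if None \<in> B then ennreal (1 - enn2real (rate_into S x a) / enn2real (qrate x a)) else 0)" if "B \<in> sets (MSi S)"
    unfolding pk e1 e2 by (rule emeasure_trans_meas[OF f that])
  show "qrate x a * emeasure (pk S qt (Some x) a) (Some ` G) = rate_into G x a" if "G \<in> sets (MS S)"
    unfolding pk qrate_def rate_into_def by (rule emeasure_trans_meas_Some[OF f that])
qed

lemma pk_measurable: "(\<lambda>(y, a). pk S qt y a) \<in> Mda S A \<rightarrow>\<^sub>M prob_algebra (MSi S)"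
  unfolding Mda_def
proof (rule measurable_MSi_pair[OF x_dflt])
  show "pk S qt None \<in> MA A \<rightarrow>\<^sub>M prob_algebra (MSi S)"
    unfolding pk_def by (auto intro!: measurable_const simp: space_prob_algebra prob_space_return)
  show "(\<lambda>(x, a). pk S qt (Some x) a) \<in> SA \<rightarrow>\<^sub>M prob_algebra (MSi S)"
  proof (rule measurable_prob_algebraI)
    show "prob_space (case z of (x, a) \<Rightarrow> pk S qt (Some x) a)" if "z \<in> space SA" for z
      using that by (auto simp: space_pair_measure pk_Some)
    show "(\<lambda>(x, a). pk S qt (Some x) a) \<in> SA \<rightarrow>\<^sub>M subprob_algebra (MSi S)"
    proof (rule measurable_subprob_algebra)
      fix B assume B: "B \<in> sets (MSi S)"
      note [measurable] = rate_into_measurable[OF vimage_Some_sets[OF B]] rate_into_measurable[OF S_sets_MS]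
      have "(\<lambda>(x, a). ennreal (enn2real (rate_into (Some -` B) x a) / enn2real (qrate x a))
        + (if None \<in> B then ennreal (1 - enn2real (rate_into S x a) / enn2real (qrate x a)) else 0)) \<in> borel_measurable SA"
        by measurable
      then show "(\<lambda>z. emeasure (case z of (x, a) \<Rightarrow> pk S qt (Some x) a) B) \<in> borel_measurable SA"
        by (rule measurable_cong[THEN iffD1, rotated]) (auto simp: space_pair_measure pk_Some B)
    qed (auto simp: space_pair_measure pk_Some prob_space_imp_subprob_space)
  qed
qed

end

locale dt_policy = ctmdp S A qt \<gamma> \<pi> for S :: "'s::polish_space set" and A :: "'a::polish_space set"
    and qt :: "'s \<Rightarrow> 'a \<Rightarrow> 's measure" and \<gamma> :: "'s measure"
    and \<pi> :: "nat \<Rightarrow> (nat \<Rightarrow> ennreal \<times> 's option) \<Rightarrow> real \<Rightarrow> 'a measure" +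
  fixes \<sigma> :: "nat \<Rightarrow> 's option \<Rightarrow> 'a measure"
  assumes \<sigma>: "dt_markov_policy S A \<sigma>"
begin

abbreviation "R n \<equiv> dt_marg S A qt \<gamma> \<sigma> n"
abbreviation Dn :: "nat \<Rightarrow> (nat \<Rightarrow> 's option \<times> 'a) measure" where "Dn n \<equiv> PiM {..n} (\<lambda>_. Mda S A)"

lemma \<sigma>_measurable: "\<sigma> (Suc n) \<in> MSi S \<rightarrow>\<^sub>M prob_algebra (MA A)"
  using \<sigma> by (auto simp: dt_markov_policy_def)

lemma Dcoord: "i \<le> n \<Longrightarrow> (\<lambda>h. h i) \<in> Dn n \<rightarrow>\<^sub>M Mda S A"
  by (rule measurable_component_singleton) simp

definition "dt_append n h y a = (\<lambda>i\<in>{..Suc n}. if i = Suc n then (y, a) else h i)" for h :: "nat \<Rightarrow> 's option \<times> 'a"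

lemma dt_append_measurable: "(\<lambda>((h, y), a). dt_append n h y a) \<in> (Dn n \<Otimes>\<^sub>M MSi S) \<Otimes>\<^sub>M MA A \<rightarrow>\<^sub>M Dn (Suc n)"
  unfolding dt_append_def split_beta'
proof (rule measurable_restrict)
  fix i assume i: "i \<in> {..Suc n}"
  show "(\<lambda>z. if i = Suc n then (snd (fst z), snd z) else fst (fst z) i) \<in> (Dn n \<Otimes>\<^sub>M MSi S) \<Otimes>\<^sub>M MA A \<rightarrow>\<^sub>M Mda S A"
  proof (cases "i = Suc n")
    case False
    then have "(\<lambda>h. h i) \<in> Dn n \<rightarrow>\<^sub>M Mda S A" using i by (intro Dcoord) auto
    from measurable_compose[OF measurable_compose[OF measurable_fst[of "Dn n \<Otimes>\<^sub>M MSi S" "MA A"] measurable_fst] this] False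
    show ?thesis by simp
  qed (simp add: Mda_def)
qed

abbreviation "act n h y \<equiv> \<sigma> (Suc (Suc n)) y \<bind> (\<lambda>a. return (Dn (Suc n)) (dt_append n h y a))"

lemma act_kernel: "(\<lambda>(h, y). act n h y) \<in> Dn n \<Otimes>\<^sub>M MSi S \<rightarrow>\<^sub>M prob_algebra (Dn (Suc n))"
proof -
  have 1: "(\<lambda>z. \<sigma> (Suc (Suc n)) (snd z)) \<in> Dn n \<Otimes>\<^sub>M MSi S \<rightarrow>\<^sub>M prob_algebra (MA A)"
    by (rule measurable_compose[OF measurable_snd \<sigma>_measurable])
  have 2: "(\<lambda>(z, a). return (Dn (Suc n)) (dt_append n (fst z) (snd z) a)) \<in> (Dn n \<Otimes>\<^sub>M MSi S) \<Otimes>\<^sub>M MA A \<rightarrow>\<^sub>M prob_algebra (Dn (Suc n))"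
    using measurable_compose[OF dt_append_measurable measurable_return_prob_space] by (simp add: split_beta')
  show ?thesis using measurable_bind_prob_space2[OF 1 2] by (simp add: split_beta')
qed

lemma state_kernel: "(\<lambda>h. pk S qt (fst (h n)) (snd (h n))) \<in> Dn n \<rightarrow>\<^sub>M prob_algebra (MSi S)"
  using measurable_compose[OF Dcoord[OF order_refl] pk_measurable, of n] by (simp add: split_beta')

lemma step_kernel: "(\<lambda>h. pk S qt (fst (h n)) (snd (h n)) \<bind> (\<lambda>y. act n h y))
    \<in> Dn n \<rightarrow>\<^sub>M prob_algebra (Dn (Suc n))"
  by (rule measurable_bind_prob_space2[OF state_kernel act_kernel])

lemma R_Suc: "R (Suc n) = R n \<bind> (\<lambda>h. pk S qt (fst (h n)) (snd (h n)) \<bind> (\<lambda>y. act n h y))"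
  by (simp add: dt_append_def)

lemma init_kernel: "(\<lambda>x. \<sigma> 1 (Some x) \<bind> (\<lambda>a. return (Dn 0) (\<lambda>i\<in>{..0}. (Some x, a)))) \<in> MS S \<rightarrow>\<^sub>M prob_algebra (Dn 0)"
proof -
  have 1: "(\<lambda>x. \<sigma> 1 (Some x)) \<in> MS S \<rightarrow>\<^sub>M prob_algebra (MA A)"
    using measurable_compose[OF Some_measurable \<sigma>_measurable[of 0]] by simp
  have "(\<lambda>(x, a). (\<lambda>i\<in>{..0::nat}. (Some x, a))) \<in> SA \<rightarrow>\<^sub>M Dn 0"
    unfolding split_beta' by (rule measurable_restrict) (simp add: Mda_def)
  from measurable_compose[OF this measurable_return_prob_space]
  have 2: "(\<lambda>(x, a). return (Dn 0) (\<lambda>i\<in>{..0}. (Some x, a))) \<in> SA \<rightarrow>\<^sub>M prob_algebra (Dn 0)" by (simp add: split_beta')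
  show ?thesis by (rule measurable_bind_prob_space2[OF 1 2])
qed

lemma \<gamma>_space: "\<gamma> \<in> space (prob_algebra (MS S))" using prob_\<gamma> sets_\<gamma> by (simp add: space_prob_algebra)

lemma R_space: "R n \<in> space (prob_algebra (Dn n))"
proof (induction n)
  case 0
  show ?case using sets_bind'[OF \<gamma>_space init_kernel] prob_space_bind'[OF \<gamma>_space init_kernel] by (simp add: space_prob_algebra)
next
  case (Suc n)
  show ?case unfolding R_Suc using sets_bind'[OF Suc step_kernel] prob_space_bind'[OF Suc step_kernel] by (simp add: space_prob_algebra)
qed

lemma sets_R: "sets (R n) = sets (Dn n)" and prob_R: "prob_space (R n)" and space_R: "space (R n) = space (Dn n)"
  using R_space[of n] sets_eq_imp_space_eq[of "R n" "Dn n"] by (simp_all add: space_prob_algebra)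

definition "dt_state_law n = distr (R n) (MSi S) (\<lambda>h. fst (h n))"

lemma fst_Dcoord: "(\<lambda>h. fst (h n)) \<in> Dn n \<rightarrow>\<^sub>M MSi S"
  using measurable_compose[OF Dcoord[OF order_refl, of n, unfolded Mda_def] measurable_fst] by (simp add: Mda_def)

lemma fst_R: "(\<lambda>h. fst (h n)) \<in> R n \<rightarrow>\<^sub>M MSi S"
  using fst_Dcoord[of n] by (simp add: sets_R cong: measurable_cong_sets)

lemma prob_m: "prob_space (dt_state_law n)" unfolding dt_state_law_def by (rule prob_space.prob_space_distr[OF prob_R fst_R])
lemma sets_m: "sets (dt_state_law n) = sets (MSi S)" by (simp add: dt_state_law_def)

lemma \<sigma>_space: "y \<in> space (MSi S) \<Longrightarrow> prob_space (\<sigma> (Suc n) y) \<and> sets (\<sigma> (Suc n) y) = sets (MA A)"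
  using measurable_space[OF \<sigma>_measurable] by (auto simp: space_prob_algebra)

lemma nn_integral_R_Suc:
  assumes F: "F \<in> borel_measurable (Mda S A)"
  shows "(\<integral>\<^sup>+h. F (h (Suc n)) \<partial>R (Suc n)) = (\<integral>\<^sup>+h. \<integral>\<^sup>+y. \<integral>\<^sup>+a. F (y, a) \<partial>\<sigma> (Suc (Suc n)) y \<partial>pk S qt (fst (h n)) (snd (h n)) \<partial>R n)"
proof -
  have F': "(\<lambda>h. F (h (Suc n))) \<in> borel_measurable (Dn (Suc n))" by (rule measurable_compose[OF Dcoord F]) simp
  have sk: "(\<lambda>h. pk S qt (fst (h n)) (snd (h n)) \<bind> (\<lambda>y. act n h y))
    \<in> R n \<rightarrow>\<^sub>M subprob_algebra (Dn (Suc n))"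
    using measurable_prob_algebraD[OF step_kernel] by (simp add: sets_R cong: measurable_cong_sets)
  show ?thesis unfolding R_Suc nn_integral_bind[OF F' sk]
  proof (rule nn_integral_cong)
    fix h assume "h \<in> space (R n)"
    then have h: "h \<in> space (Dn n)" by (simp add: space_R)
    have spk: "sets (pk S qt (fst (h n)) (snd (h n))) = sets (MSi S)"
      using sets_kernel[OF measurable_prob_algebraD[OF state_kernel] h] .
    have ak0: "(\<lambda>y. act n h y) \<in> MSi S \<rightarrow>\<^sub>M subprob_algebra (Dn (Suc n))"
      using measurable_compose[OF measurable_Pair1'[OF h] measurable_prob_algebraD[OF act_kernel]] by simp
    have ak: "(\<lambda>y. act n h y)
      \<in> pk S qt (fst (h n)) (snd (h n)) \<rightarrow>\<^sub>M subprob_algebra (Dn (Suc n))"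
      using ak0 by (simp add: spk cong: measurable_cong_sets)
    show "(\<integral>\<^sup>+h. F (h (Suc n)) \<partial>(pk S qt (fst (h n)) (snd (h n)) \<bind> (\<lambda>y. act n h y)))
      = (\<integral>\<^sup>+y. \<integral>\<^sup>+a. F (y, a) \<partial>\<sigma> (Suc (Suc n)) y \<partial>pk S qt (fst (h n)) (snd (h n)))"
      unfolding nn_integral_bind[OF F' ak]
    proof (rule nn_integral_cong)
      fix y assume "y \<in> space (pk S qt (fst (h n)) (snd (h n)))"
      then have y: "y \<in> space (MSi S)" using sets_eq_imp_space_eq[OF spk] by simp
      have dm: "dt_append n h y \<in> MA A \<rightarrow>\<^sub>M Dn (Suc n)"
        using measurable_compose[OF measurable_Pair1' dt_append_measurable, of "(h, y)" n] h y by (simp add: space_pair_measure)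
      show "(\<integral>\<^sup>+h. F (h (Suc n)) \<partial>(act n h y)) = (\<integral>\<^sup>+a. F (y, a) \<partial>\<sigma> (Suc (Suc n)) y)"
        unfolding nn_integral_bind_return[OF \<sigma>_space[OF y] dm F'] by (simp add: dt_append_def)
    qed
  qed
qed

lemma nn_integral_m_Suc:
  assumes g: "g \<in> borel_measurable (MSi S)"
  shows "(\<integral>\<^sup>+y. g y \<partial>dt_state_law (Suc n)) = (\<integral>\<^sup>+h. \<integral>\<^sup>+y. g y \<partial>pk S qt (fst (h n)) (snd (h n)) \<partial>R n)"
proof -
  have "(\<lambda>z. g (fst z)) \<in> borel_measurable (Mda S A)" unfolding Mda_def by (rule measurable_compose[OF measurable_fst g])
  then have "(\<integral>\<^sup>+y. g y \<partial>dt_state_law (Suc n)) = (\<integral>\<^sup>+h. \<integral>\<^sup>+y. \<integral>\<^sup>+a. g y \<partial>\<sigma> (Suc (Suc n)) y \<partial>pk S qt (fst (h n)) (snd (h n)) \<partial>R n)"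
    unfolding dt_state_law_def using nn_integral_R_Suc[of "\<lambda>z. g (fst z)" n] g
    by (subst nn_integral_distr[OF fst_R]) (simp_all del: dt_marg.simps)
  also have "\<dots> = (\<integral>\<^sup>+h. \<integral>\<^sup>+y. g y \<partial>pk S qt (fst (h n)) (snd (h n)) \<partial>R n)"
  proof (intro nn_integral_cong)
    fix h y assume h: "h \<in> space (R n)" and "y \<in> space (pk S qt (fst (h n)) (snd (h n)))"
    then have "y \<in> space (MSi S)"
      using sets_eq_imp_space_eq[OF sets_kernel[OF measurable_prob_algebraD[OF state_kernel], of h n]] by (simp add: space_R)
    from \<sigma>_space[OF this, of "Suc n"] show "(\<integral>\<^sup>+a. g y \<partial>\<sigma> (Suc (Suc n)) y) = g y"
      by (simp add: prob_space.emeasure_space_1)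
  qed
  finally show ?thesis .
qed

lemma \<sigma>_integral_measurable:
  assumes F: "F \<in> borel_measurable (Mda S A)"
  shows "(\<lambda>y. \<integral>\<^sup>+a. F (y, a) \<partial>\<sigma> (Suc n) y) \<in> borel_measurable (MSi S)"
  by (rule nn_integral_measurable_subprob_algebra2[where N="MA A"])
    (use F measurable_prob_algebraD[OF \<sigma>_measurable] in \<open>auto simp: Mda_def\<close>)

lemma nn_integral_R_0:
  assumes F: "F \<in> borel_measurable (Mda S A)"
  shows "(\<integral>\<^sup>+h. F (h 0) \<partial>R 0) = (\<integral>\<^sup>+x. \<integral>\<^sup>+a. F (Some x, a) \<partial>\<sigma> (Suc 0) (Some x) \<partial>\<gamma>)"
proof -
  have F': "(\<lambda>h. F (h 0)) \<in> borel_measurable (Dn 0)" by (rule measurable_compose[OF Dcoord F]) simp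
  have ik: "(\<lambda>x. \<sigma> 1 (Some x) \<bind> (\<lambda>a. return (Dn 0) (\<lambda>i\<in>{..0}. (Some x, a)))) \<in> \<gamma> \<rightarrow>\<^sub>M subprob_algebra (Dn 0)"
    using measurable_prob_algebraD[OF init_kernel] by (simp add: sets_\<gamma> cong: measurable_cong_sets)
  show ?thesis unfolding dt_marg.simps(1) nn_integral_bind[OF F' ik]
  proof (rule nn_integral_cong)
    fix x assume "x \<in> space \<gamma>"
    then have y: "Some x \<in> space (MSi S)" using sets_eq_imp_space_eq[OF sets_\<gamma>] by simp
    have dm: "(\<lambda>a. \<lambda>i\<in>{..0::nat}. (Some x, a)) \<in> MA A \<rightarrow>\<^sub>M Dn 0"
      by (rule measurable_restrict) (use y in \<open>simp add: Mda_def\<close>)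
    show "(\<integral>\<^sup>+h. F (h 0) \<partial>(\<sigma> 1 (Some x) \<bind> (\<lambda>a. return (Dn 0) (\<lambda>i\<in>{..0}. (Some x, a))))) = (\<integral>\<^sup>+a. F (Some x, a) \<partial>\<sigma> (Suc 0) (Some x))"
      unfolding One_nat_def nn_integral_bind_return[OF \<sigma>_space[OF y] dm F'] by simp
  qed
qed

lemma nn_integral_m_0:
  assumes g: "g \<in> borel_measurable (MSi S)"
  shows "(\<integral>\<^sup>+y. g y \<partial>dt_state_law 0) = (\<integral>\<^sup>+x. g (Some x) \<partial>\<gamma>)"
proof -
  have "(\<lambda>z. g (fst z)) \<in> borel_measurable (Mda S A)" unfolding Mda_def by (rule measurable_compose[OF measurable_fst g])
  from nn_integral_R_0[OF this] have "(\<integral>\<^sup>+y. g y \<partial>dt_state_law 0) = (\<integral>\<^sup>+x. \<integral>\<^sup>+a. g (Some x) \<partial>\<sigma> (Suc 0) (Some x) \<partial>\<gamma>)"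
    unfolding dt_state_law_def by (subst nn_integral_distr[OF fst_R]) (use g in \<open>simp_all del: dt_marg.simps\<close>)
  also have "\<dots> = (\<integral>\<^sup>+x. g (Some x) \<partial>\<gamma>)"
  proof (intro nn_integral_cong)
    fix x assume "x \<in> space \<gamma>"
    then have "Some x \<in> space (MSi S)" using sets_eq_imp_space_eq[OF sets_\<gamma>] by simp
    from \<sigma>_space[OF this, of 0] show "(\<integral>\<^sup>+a. g (Some x) \<partial>\<sigma> (Suc 0) (Some x)) = g (Some x)"
      by (simp add: prob_space.emeasure_space_1)
  qed
  finally show ?thesis .
qed

text \<open>For a Markov policy the pair of n-th state and following action depends on the past
  through the state law only. This lets the comparison with the continuous-time process proceed by
  one-dimensional laws.\<close>

lemma nn_integral_R:
  assumes F: "F \<in> borel_measurable (Mda S A)"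
  shows "(\<integral>\<^sup>+h. F (h n) \<partial>R n) = (\<integral>\<^sup>+y. \<integral>\<^sup>+a. F (y, a) \<partial>\<sigma> (Suc n) y \<partial>dt_state_law n)"
proof (cases n)
  case (Suc k)
  show ?thesis unfolding Suc nn_integral_R_Suc[OF F] by (rule nn_integral_m_Suc[OF \<sigma>_integral_measurable[OF F], symmetric])
next
  case 0
  show ?thesis unfolding 0 nn_integral_R_0[OF F] nn_integral_m_0[OF \<sigma>_integral_measurable[OF F]] ..
qed

lemma m_0: "dt_state_law 0 = distr \<gamma> (MSi S) Some"
proof (rule measure_eqI)
  have Sm: "Some \<in> \<gamma> \<rightarrow>\<^sub>M MSi S" using Some_measurable by (simp add: sets_\<gamma> cong: measurable_cong_sets)
  fix B assume "B \<in> sets (dt_state_law 0)"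
  then have B: "B \<in> sets (MSi S)" by (simp add: sets_m)
  have "emeasure (dt_state_law 0) B = (\<integral>\<^sup>+y. indicator B y \<partial>dt_state_law 0)" using B by (simp add: sets_m)
  also have "\<dots> = (\<integral>\<^sup>+x. indicator B (Some x) \<partial>\<gamma>)" by (rule nn_integral_m_0) (use B in simp)
  also have "\<dots> = (\<integral>\<^sup>+y. indicator B y \<partial>distr \<gamma> (MSi S) Some)" using B by (intro nn_integral_distr[OF Sm, symmetric]) simp
  also have "\<dots> = emeasure (distr \<gamma> (MSi S) Some) B" using B by simp
  finally show "emeasure (dt_state_law 0) B = emeasure (distr \<gamma> (MSi S) Some) B" .
qed (simp add: sets_m)

end

section \<open>Construction of the Markov policy\<close>

context ctmdp_process begin

lemma occ_eq_occ_integral: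
  assumes GS: "GS \<in> sets (MS S)" and GA: "GA \<in> sets (MA A)"
  shows "occ S A qt \<pi> P n GS GA = occ_integral n (\<lambda>x a. indicator GS x * (indicator GA a * qrate x a))"
proof -
  note [measurable] = GS GA
  have m: "(\<lambda>(x, a). indicator GS x * (indicator GA a * qrate x a)) \<in> borel_measurable SA" by measurable
  have "occ S A qt \<pi> P n GS GA = (\<integral>\<^sup>+\<omega>. sojourn_integral n (\<lambda>x a. indicator GS x * (indicator GA a * qrate x a)) \<omega> \<partial>P)"
    unfolding occ_def sojourn_integral_def qrate_def
    by (intro nn_integral_cong arg_cong2[where f="(*)"] refl) (auto split: option.split split_indicator)
  then show ?thesis by (simp add: nn_integral_sojourn_integral[OF m])
qed

text \<open>\<open>Z\<close> stands for \<open>S2\<close>; the hypotheses isolate what the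
  construction needs of it: zero rate under \<open>fs\<close>, the policy being \<open>fs\<close>
  there, and a certain jump from everywhere else, expressed by \<open>jump\<close>.\<close>

lemma markov_policy_from_occupancy:
  assumes closed: "closed A"
    and Z: "Z \<in> sets (MS S)" and fs: "fs \<in> MS S \<rightarrow>\<^sub>M MA A" and qfs: "\<And>x. x \<in> Z \<Longrightarrow> qrate x (fs x) = 0"
    and pi_Z: "\<And>n h s. h \<in> Hset S n \<Longrightarrow> 0 < s \<Longrightarrow> state_ext n h \<in> Z \<Longrightarrow> policy_ext n h s = return (MA A) (fs (state_ext n h))"
    and jump: "\<And>n G. G \<in> sets (MS S) \<Longrightarrow> G \<subseteq> S - Z \<Longrightarrow>
      occ_integral n (\<lambda>x a. indicator G x * qrate x a) = emeasure (Q n) {h \<in> space (Pn n). snd (h n) \<in> Some ` G}"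
  shows "\<exists>\<sigma>. dt_markov_policy S A \<sigma> \<and> (\<forall>n. \<forall>x\<in>Z. \<sigma> (Suc n) (Some x) = return (MA A) (fs x)) \<and>
    (\<forall>n GS GA. GS \<in> sets (MS S) \<and> GS \<subseteq> S - Z \<and> GA \<in> sets (MA A) \<longrightarrow>
       occ_integral n (\<lambda>x a. indicator GS x * (indicator GA a * qrate x a)) = dt_prob S A qt \<gamma> \<sigma> n GS GA)"
proof -
  have ZS: "Z \<subseteq> S" using sets.sets_into_space[OF Z] by simp
  define \<mu> where "\<mu> n = distr (Q n) (MSi S) (\<lambda>h. snd (h n))" for n
  have snd_Q: "(\<lambda>h. snd (h n)) \<in> Q n \<rightarrow>\<^sub>M MSi S" for n
    using snd_coord[OF order_refl, of n] by (simp cong: measurable_cong_sets)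
  have prob_\<mu>: "prob_space (\<mu> n)" for n unfolding \<mu>_def by (rule prob_space.prob_space_distr[OF prob_Q snd_Q])
  have sets_\<mu>: "sets (\<mu> n) = sets (MSi S)" for n by (simp add: \<mu>_def)
  have \<mu>_Some: "emeasure (\<mu> n) (Some ` G) = emeasure (Q n) {h \<in> space (Pn n). snd (h n) \<in> Some ` G}" if "G \<in> sets (MS S)" for G n
    unfolding \<mu>_def emeasure_distr[OF snd_Q image_Some_sets[OF that]]
    by (simp add: vimage_def Int_def conj_commute)
  have pairm: "(\<lambda>z. (Some (fst z), snd z)) \<in> SA \<rightarrow>\<^sub>M Mda S A"
    unfolding Mda_def by (intro measurable_Pair measurable_compose[OF measurable_fst Some_measurable] measurable_snd)
  have qe': "(\<lambda>z. qrate (fst z) (snd z)) \<in> borel_measurable (sojourn_law n)" for n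
    using qrate_measurable by (simp add: split_beta' sets_sojourn_law cong: measurable_cong_sets)
  \<comment> \<open>The n-th occupancy measure, transported to the state space of the discrete
    chain.\<close>
  define M' where "M' n = distr (density (sojourn_law n) (\<lambda>z. qrate (fst z) (snd z))) (Mda S A) (\<lambda>z. (Some (fst z), snd z))" for n
  have intM': "(\<integral>\<^sup>+z. F z \<partial>M' n) = occ_integral n (\<lambda>x a. qrate x a * F (Some x, a))" if F: "F \<in> borel_measurable (Mda S A)" for F n
  proof -
    have F': "(\<lambda>z. F (Some (fst z), snd z)) \<in> borel_measurable SA" by (rule measurable_compose[OF pairm F])
    have pm: "(\<lambda>z. (Some (fst z), snd z)) \<in> density (sojourn_law n) (\<lambda>z. qrate (fst z) (snd z)) \<rightarrow>\<^sub>M Mda S A"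
      using pairm by (simp add: sets_sojourn_law cong: measurable_cong_sets)
    have qF: "(\<lambda>(x, a). qrate x a * F (Some x, a)) \<in> borel_measurable SA"
      using borel_measurable_times_ennreal[OF qrate_measurable[unfolded split_beta'] F'] by (simp add: split_beta')
    have "(\<integral>\<^sup>+z. F z \<partial>M' n) = (\<integral>\<^sup>+z. F (Some (fst z), snd z) \<partial>density (sojourn_law n) (\<lambda>z. qrate (fst z) (snd z)))"
      unfolding M'_def by (rule nn_integral_distr[OF pm]) (use F in simp)
    also have "\<dots> = (\<integral>\<^sup>+z. qrate (fst z) (snd z) * F (Some (fst z), snd z) \<partial>sojourn_law n)"
      by (rule nn_integral_density[OF qe']) (use F' in \<open>simp add: sets_sojourn_law cong: measurable_cong_sets\<close>)
    also have "\<dots> = occ_integral n (\<lambda>x a. qrate x a * F (Some x, a))" by (rule nn_integral_sojourn_law[OF qF])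
    finally show ?thesis .
  qed
  \<comment> \<open>On \<open>Z\<close> the policy is concentrated at \<open>fs x\<close>, so a
    function vanishing at these pairs and off \<open>Z\<close> is integrated to zero, although the
    time spent in \<open>Z\<close> may be infinite.\<close>
  have occ_integral_0: "occ_integral n f = 0" if f: "(\<lambda>(x, a). f x a) \<in> borel_measurable SA"
    and f1: "\<And>x. x \<in> Z \<Longrightarrow> f x (fs x) = 0" and f2: "\<And>x a. x \<in> S \<Longrightarrow> x \<notin> Z \<Longrightarrow> a \<in> A \<Longrightarrow> f x a = 0" for n f
  proof -
    have "rate f n h s = 0" if h: "h \<in> Hset S n" and s: "0 < s" for h s
    proof -
      have hs: "h \<in> space (Pn n)" using h by (simp add: Hset_def)
      note x = state_ext_in_S[OF hs]
      show ?thesis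
      proof (cases "state_ext n h \<in> Z")
        case True
        have "(\<lambda>a. f (state_ext n h) a) \<in> borel_measurable (MA A)"
          using measurable_compose[OF measurable_Pair1'[of "state_ext n h" "MS S"] f] x by simp
        moreover have "fs (state_ext n h) \<in> space (MA A)" using measurable_space[OF fs] x by simp
        ultimately show ?thesis unfolding rate_def pi_Z[OF h s True] by (simp add: nn_integral_return f1[OF True])
      next
        case False
        have "rate f n h s = (\<integral>\<^sup>+a. 0 \<partial>policy_ext n h s)"
          unfolding rate_def using sets_eq_imp_space_eq[of "policy_ext n h s" "MA A"] policy_ext_space[OF hs, of s]
          by (intro nn_integral_cong) (auto simp: f2[OF x False])
        then show ?thesis by simp
      qed
    qed
    then have "soj f n h = (\<integral>\<^sup>+s. 0 \<partial>(lborel :: real measure))"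
      if "h \<in> Hset S n" for h
      using that by (intro nn_integral_cong) (auto split: split_indicator)
    then have "occ_integral n f = (\<integral>\<^sup>+h. 0 \<partial>Q n)"
      unfolding occ_integral_def by (intro nn_integral_cong) (auto split: split_indicator)
    then show ?thesis by simp
  qed
  define E where "E = Some ` (S - Z)"
  have SZ: "S - Z \<in> sets (MS S)" using sets.compl_sets[OF Z] by simp
  have E: "E \<in> sets (MSi S)" unfolding E_def by (rule image_Some_sets[OF SZ])
  have fstM: "fst \<in> M' n \<rightarrow>\<^sub>M MSi S" for n by (simp add: M'_def Mda_def)
  \<comment> \<open>The part of \<open>B\<close> in \<open>Z\<close> has no weight since
    \<open>qrate\<close> vanishes at \<open>fs\<close>; the part outside has the mass given by
    \<open>jump\<close>.\<close>
  have marg: "distr (M' n) (MSi S) fst = density (\<mu> n) (indicator E)" for n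
  proof (rule measure_eqI)
    show "sets (distr (M' n) (MSi S) fst) = sets (density (\<mu> n) (indicator E))" by (simp add: sets_\<mu>)
    fix B assume "B \<in> sets (distr (M' n) (MSi S) fst)"
    then have B: "B \<in> sets (MSi S)" by simp
    note vB = vimage_Some_sets[OF B]
    define G where "G = Some -` B - Z"
    define H where "H = Some -` B \<inter> Z"
    have G: "G \<in> sets (MS S)" "G \<subseteq> S - Z" and H: "H \<in> sets (MS S)"
      using vB Z sets.sets_into_space[OF vB] by (auto simp: G_def H_def)
    have mG: "(\<lambda>(x, a). indicator G x * qrate x a) \<in> borel_measurable SA"
      and mH: "(\<lambda>(x, a). indicator H x * qrate x a) \<in> borel_measurable SA"
      using G(1) H by measurable
    have F: "(\<lambda>z. indicator B (fst z) :: ennreal) \<in> borel_measurable (Mda S A)"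
      unfolding Mda_def by (rule measurable_compose[OF measurable_fst]) (use B in simp)
    have "emeasure (distr (M' n) (MSi S) fst) B = (\<integral>\<^sup>+y. indicator B y \<partial>distr (M' n) (MSi S) fst)" using B by simp
    also have "\<dots> = (\<integral>\<^sup>+z. indicator B (fst z) \<partial>M' n)" by (rule nn_integral_distr[OF fstM]) (use B in simp)
    also have "\<dots> = occ_integral n (\<lambda>x a. qrate x a * indicator B (Some x))" unfolding intM'[OF F] by simp
    also have "\<dots> = occ_integral n (\<lambda>x a. indicator G x * qrate x a + indicator H x * qrate x a)"
      by (rule occ_integral_cong) (auto simp: G_def H_def split: split_indicator)
    also have "\<dots> = occ_integral n (\<lambda>x a. indicator G x * qrate x a) + occ_integral n (\<lambda>x a. indicator H x * qrate x a)"
      by (rule occ_integral_add[OF mG mH])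
    also have "occ_integral n (\<lambda>x a. indicator H x * qrate x a) = 0"
      by (rule occ_integral_0[OF mH]) (auto simp: qfs H_def)
    also have "occ_integral n (\<lambda>x a. indicator G x * qrate x a) + 0 = emeasure (\<mu> n) (Some ` G)"
      by (simp add: jump[OF G] \<mu>_Some[OF G(1)])
    also have "Some ` G = E \<inter> B"
      using sets.sets_into_space[OF B] by (auto simp: G_def E_def)
    also have "emeasure (\<mu> n) (E \<inter> B) = emeasure (density (\<mu> n) (indicator E)) B"
    proof -
      have "emeasure (density (\<mu> n) (indicator E)) B = (\<integral>\<^sup>+y. indicator E y * indicator B y \<partial>\<mu> n)"
        by (rule emeasure_density) (use E B sets_\<mu> in \<open>auto cong: measurable_cong_sets\<close>)
      also have "\<dots> = (\<integral>\<^sup>+y. indicator (E \<inter> B) y \<partial>\<mu> n)" by (intro nn_integral_cong) (auto split: split_indicator)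
      also have "\<dots> = emeasure (\<mu> n) (E \<inter> B)" using E B sets_\<mu> by simp
      finally show ?thesis ..
    qed
    finally show "emeasure (distr (M' n) (MSi S) fst) B = emeasure (density (\<mu> n) (indicator E)) B" .
  qed
  have finM': "finite_measure (M' n)" for n
  proof (rule finite_measureI)
    have "emeasure (M' n) (space (M' n)) = (\<integral>\<^sup>+z. 1 \<partial>M' n)" by simp
    also have "\<dots> = occ_integral n qrate" by (subst intM') simp_all
    finally show "emeasure (M' n) (space (M' n)) \<noteq> \<infinity>" using occ_integral_qrate_le_1[of n] by (auto simp: top_unique)
  qed
  have ex: "\<forall>n. \<exists>k. k \<in> MSi S \<rightarrow>\<^sub>M prob_algebra (MA A) \<and> (\<forall>F \<in> borel_measurable (Mda S A).
      (\<integral>\<^sup>+z. F z \<partial>M' n) = (\<integral>\<^sup>+y. \<integral>\<^sup>+a. F (y, a) \<partial>k y \<partial>distr (M' n) (MSi S) fst))"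
    using disintegration_closed_polish[OF closed A_ne finM', of _ "MSi S"] unfolding MA_def[symmetric]
    by (auto simp: M'_def Mda_def Bex_def)
  obtain k where kk: "\<forall>n. k n \<in> MSi S \<rightarrow>\<^sub>M prob_algebra (MA A) \<and> (\<forall>F \<in> borel_measurable (Mda S A).
      (\<integral>\<^sup>+z. F z \<partial>M' n) = (\<integral>\<^sup>+y. \<integral>\<^sup>+a. F (y, a) \<partial>k n y \<partial>distr (M' n) (MSi S) fst))"
    using choice[OF ex] by blast
  have k: "k n \<in> MSi S \<rightarrow>\<^sub>M prob_algebra (MA A)" for n using kk by blast
  have kF: "(\<integral>\<^sup>+z. F z \<partial>M' n) = (\<integral>\<^sup>+y. \<integral>\<^sup>+a. F (y, a) \<partial>k n y \<partial>distr (M' n) (MSi S) fst)"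
    if "F \<in> borel_measurable (Mda S A)" for n F using kk that by blast
  \<comment> \<open>The shift \<open>n - 1\<close> reflects that \<open>\<sigma> (Suc n)\<close>
    governs the action taken in the n-th state.\<close>
  define \<sigma> where "\<sigma> n y = (case y of None \<Rightarrow> return (MA A) a_dflt
     | Some x \<Rightarrow> if x \<in> Z then return (MA A) (fs x) else k (n - 1) (Some x))" for n y
  have pol\<sigma>: "dt_markov_policy S A \<sigma>"
    unfolding dt_markov_policy_def
  proof (intro allI measurable_MSi)
    fix n
    show "\<sigma> (Suc n) None \<in> space (prob_algebra (MA A))"
      using a_dflt by (simp add: \<sigma>_def space_prob_algebra prob_space_return)
    have "(\<lambda>x. if x \<in> Z then return (MA A) (fs x) else k n (Some x)) \<in> MS S \<rightarrow>\<^sub>M prob_algebra (MA A)"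
    proof (rule measurable_If)
      show "{x \<in> space (MS S). x \<in> Z} \<in> sets (MS S)" using Z ZS by (simp add: Int_absorb1 Collect_conj_eq)
    qed (intro measurable_compose[OF fs measurable_return_prob_space] measurable_compose[OF Some_measurable k])+
    then show "(\<lambda>x. \<sigma> (Suc n) (Some x)) \<in> MS S \<rightarrow>\<^sub>M prob_algebra (MA A)" by (simp add: \<sigma>_def cong: if_cong)
  qed
  interpret dt: dt_policy S A qt \<gamma> \<pi> \<sigma> by unfold_locales (rule pol\<sigma>)
  \<comment> \<open>\<open>M' n\<close> sees only states in \<open>E\<close>, whereas
    \<open>\<mu> n\<close> also charges \<open>None\<close> and \<open>Z\<close>. The two vanishing
    conditions on \<open>F\<close> remove these states from the left side.\<close>
  have key: "(\<integral>\<^sup>+y. \<integral>\<^sup>+a. F (y, a) \<partial>\<sigma> (Suc n) y \<partial>\<mu> n) = (\<integral>\<^sup>+z. F z \<partial>M' n)"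
    if F: "F \<in> borel_measurable (Mda S A)" and F0: "\<And>a. F (None, a) = 0" and FZ: "\<And>x. x \<in> Z \<Longrightarrow> F (Some x, fs x) = 0" for F n
  proof -
    have km: "(\<lambda>y. \<integral>\<^sup>+a. F (y, a) \<partial>k n y) \<in> borel_measurable (\<mu> n)"
    proof -
      have "(\<lambda>y. \<integral>\<^sup>+a. F (y, a) \<partial>k n y) \<in> borel_measurable (MSi S)"
        by (rule nn_integral_measurable_subprob_algebra2[where N="MA A"])
          (use F measurable_prob_algebraD[OF k] in \<open>auto simp: Mda_def\<close>)
      then show ?thesis by (simp add: sets_\<mu> cong: measurable_cong_sets)
    qed
    have "(\<integral>\<^sup>+z. F z \<partial>M' n) = (\<integral>\<^sup>+y. indicator E y * (\<integral>\<^sup>+a. F (y, a) \<partial>k n y) \<partial>\<mu> n)"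
      unfolding kF[OF F] marg by (rule nn_integral_density[OF _ km]) (use E sets_\<mu> in \<open>simp cong: measurable_cong_sets\<close>)
    also have "\<dots> = (\<integral>\<^sup>+y. \<integral>\<^sup>+a. F (y, a) \<partial>\<sigma> (Suc n) y \<partial>\<mu> n)"
    proof (rule nn_integral_cong)
      fix y assume "y \<in> space (\<mu> n)"
      then have y: "y \<in> space (MSi S)" using sets_eq_imp_space_eq[OF sets_\<mu>] by simp
      have sec: "(\<lambda>a. F (y, a)) \<in> borel_measurable (MA A)"
        using measurable_compose[OF measurable_Pair1'[OF y] F[unfolded Mda_def]] .
      show "indicator E y * (\<integral>\<^sup>+a. F (y, a) \<partial>k n y) = (\<integral>\<^sup>+a. F (y, a) \<partial>\<sigma> (Suc n) y)"
      proof (cases y)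
        case None
        then show ?thesis by (auto simp: E_def F0)
      next
        case (Some x)
        show ?thesis
        proof (cases "x \<in> Z")
          case True
          then have "fs x \<in> space (MA A)" using measurable_space[OF fs] ZS by auto
          then have "(\<integral>\<^sup>+a. F (y, a) \<partial>return (MA A) (fs x)) = F (y, fs x)" using sec by (rule nn_integral_return)
          then show ?thesis using True Some by (simp add: E_def \<sigma>_def FZ image_iff)
        next
          case False
          then have "y \<in> E" using y Some by (auto simp: E_def)
          then show ?thesis using False Some by (simp add: \<sigma>_def)
        qed
      qed
    qed
    finally show ?thesis ..
  qed
  have m_eq: "dt.dt_state_law n = \<mu> n" for n
  proof (induction n)
    case 0
    have "\<mu> 0 = distr (distr \<gamma> (Pn 0) (\<lambda>x. \<lambda>i\<in>{..0}. (0, Some x))) (MSi S) (\<lambda>h. snd (h 0))" by (simp add: \<mu>_def)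
    also have "\<dots> = distr \<gamma> (MSi S) ((\<lambda>h. snd (h 0)) \<circ> (\<lambda>x. \<lambda>i\<in>{..0::nat}. (0::ennreal, Some x)))"
    proof (rule distr_distr)
      show "(\<lambda>h. snd (h 0)) \<in> Pn 0 \<rightarrow>\<^sub>M MSi S" by (rule snd_coord) simp
      have "(\<lambda>x. \<lambda>i\<in>{..0::nat}. (0::ennreal, Some x)) \<in> MS S \<rightarrow>\<^sub>M Pn 0"
        by (rule measurable_restrict) (simp add: Mstep_def)
      then show "(\<lambda>x. \<lambda>i\<in>{..0::nat}. (0::ennreal, Some x)) \<in> \<gamma> \<rightarrow>\<^sub>M Pn 0" by (simp add: sets_\<gamma> cong: measurable_cong_sets)
    qed
    finally show ?case by (simp add: dt.m_0 comp_def)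
  next
    case (Suc n)
    show ?case
    proof (rule prob_MSi_eqI[OF dt.prob_m prob_\<mu> dt.sets_m sets_\<mu>])
      fix G assume G: "G \<in> sets (MS S)"
      let ?F = "\<lambda>z. emeasure (pk S qt (fst z) (snd z)) (Some ` G)"
      have F: "?F \<in> borel_measurable (Mda S A)"
        using measurable_emeasure_kernel[OF measurable_prob_algebraD[OF pk_measurable] image_Some_sets[OF G]] by (simp add: split_beta')
      have "emeasure (dt.dt_state_law (Suc n)) (Some ` G) = (\<integral>\<^sup>+y. indicator (Some ` G) y \<partial>dt.dt_state_law (Suc n))"
        using image_Some_sets[OF G] by (simp add: dt.sets_m)
      also have "\<dots> = (\<integral>\<^sup>+h. \<integral>\<^sup>+y. indicator (Some ` G) y \<partial>pk S qt (fst (h n)) (snd (h n)) \<partial>dt_marg S A qt \<gamma> \<sigma> n)"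
        by (rule dt.nn_integral_m_Suc) (use image_Some_sets[OF G] in simp)
      also have "\<dots> = (\<integral>\<^sup>+h. ?F (h n) \<partial>dt_marg S A qt \<gamma> \<sigma> n)"
      proof (intro nn_integral_cong nn_integral_indicator)
        fix h assume "h \<in> space (dt_marg S A qt \<gamma> \<sigma> n)"
        then have "h \<in> space (dt.Dn n)" by (simp add: dt.space_R)
        from sets_kernel[OF measurable_prob_algebraD[OF dt.state_kernel] this]
        show "Some ` G \<in> sets (pk S qt (fst (h n)) (snd (h n)))" using image_Some_sets[OF G] by simp
      qed
      also have "\<dots> = (\<integral>\<^sup>+y. \<integral>\<^sup>+a. ?F (y, a) \<partial>\<sigma> (Suc n) y \<partial>\<mu> n)"
        unfolding Suc[symmetric] by (rule dt.nn_integral_R[OF F])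
      also have "\<dots> = (\<integral>\<^sup>+z. ?F z \<partial>M' n)"
      \<comment> \<open>The transition probability into \<open>G\<close> qualifies:
        \<open>None\<close> is absorbing, and from \<open>(x, fs x)\<close> with \<open>x\<close> in
        \<open>Z\<close> the zero rate sends the chain to \<open>None\<close>.\<close>
      proof (rule key[OF F])
        show "?F (None, a) = 0" for a using image_Some_sets[OF G] by (simp add: pk_def)
        fix x assume x: "x \<in> Z"
        have fx: "fs x \<in> A" using measurable_space[OF fs, of x] x ZS by auto
        have vG: "Some -` Some ` G = G" by auto
        have le: "rate_into G x (fs x) \<le> qrate x (fs x)"
          unfolding emeasure_qt_S[OF subsetD[OF ZS x] fx, symmetric] rate_into_def
          by (rule emeasure_mono) (use sets.sets_into_space[OF G] S_sets_MS sets_qt[OF subsetD[OF ZS x] fx] in auto)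
        show "?F (Some x, fs x) = 0"
          using pk_Some(3)[OF subsetD[OF ZS x] fx image_Some_sets[OF G]] qfs[OF x] by auto
      qed
      also have "\<dots> = occ_integral n (\<lambda>x a. qrate x a * emeasure (pk S qt (Some x) a) (Some ` G))" unfolding intM'[OF F] by simp
      also have "\<dots> = occ_integral n (rate_into G)" by (rule occ_integral_cong) (simp add: pk_Some(4)[OF _ _ G])
      also have "\<dots> = emeasure (\<mu> (Suc n)) (Some ` G)" unfolding \<mu>_Some[OF G] by (rule next_state_law[OF G, symmetric])
      finally show "emeasure (dt.dt_state_law (Suc n)) (Some ` G) = emeasure (\<mu> (Suc n)) (Some ` G)" .
    qed
  qed
  have "occ_integral n (\<lambda>x a. indicator GS x * (indicator GA a * qrate x a)) = dt_prob S A qt \<gamma> \<sigma> n GS GA"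
    if GS: "GS \<in> sets (MS S)" "GS \<subseteq> S - Z" and GA: "GA \<in> sets (MA A)" for n GS GA
  proof -
    let ?F = "indicator (Some ` GS \<times> GA) :: 's option \<times> 'a \<Rightarrow> ennreal"
    have rect: "Some ` GS \<times> GA \<in> sets (Mda S A)" unfolding Mda_def using image_Some_sets[OF GS(1)] GA by simp
    have F: "?F \<in> borel_measurable (Mda S A)" using rect by simp
    let ?W = "{h \<in> space (dt_marg S A qt \<gamma> \<sigma> n). fst (h n) \<in> Some ` GS \<and> snd (h n) \<in> GA}"
    have "?W = (\<lambda>h. h n) -` (Some ` GS \<times> GA) \<inter> space (dt.Dn n)" by (auto simp: dt.space_R mem_Times_iff)
    then have W: "?W \<in> sets (dt_marg S A qt \<gamma> \<sigma> n)"
      using measurable_sets[OF dt.Dcoord[OF order_refl] rect, of n] by (simp add: dt.sets_R)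
    have "dt_prob S A qt \<gamma> \<sigma> n GS GA = (\<integral>\<^sup>+h. indicator ?W h \<partial>dt_marg S A qt \<gamma> \<sigma> n)"
      unfolding dt_prob_def by (rule nn_integral_indicator[OF W, symmetric])
    also have "\<dots> = (\<integral>\<^sup>+h. ?F (h n) \<partial>dt_marg S A qt \<gamma> \<sigma> n)"
      by (intro nn_integral_cong) (auto split: split_indicator simp: mem_Times_iff)
    also have "\<dots> = (\<integral>\<^sup>+y. \<integral>\<^sup>+a. ?F (y, a) \<partial>\<sigma> (Suc n) y \<partial>\<mu> n)"
      unfolding m_eq[symmetric] by (rule dt.nn_integral_R[OF F])
    also have "\<dots> = (\<integral>\<^sup>+z. ?F z \<partial>M' n)"
      by (rule key[OF F]) (use GS(2) in \<open>auto split: split_indicator\<close>)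
    also have "\<dots> = occ_integral n (\<lambda>x a. qrate x a * ?F (Some x, a))" by (rule intM'[OF F])
    also have "\<dots> = occ_integral n (\<lambda>x a. indicator GS x * (indicator GA a * qrate x a))"
      by (rule occ_integral_cong) (auto split: split_indicator)
    finally show ?thesis ..
  qed
  moreover have "\<sigma> (Suc n) (Some x) = return (MA A) (fs x)" if "x \<in> Z" for n x using that by (simp add: \<sigma>_def)
  ultimately show ?thesis using pol\<sigma> by blast
qed

end

section \<open>Assembly: the general construction applied to \<open>S2\<close>\<close>

theorem theorem4p1:
  fixes S :: "'s::polish_space set" and A :: "'a::polish_space set"
    and qt :: "'s \<Rightarrow> 'a \<Rightarrow> 's measure" and \<gamma> :: "'s measure"
    and N :: nat and c :: "nat \<Rightarrow> 's \<Rightarrow> 'a \<Rightarrow> real" and d :: "nat \<Rightarrow> real"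
    and fstar :: "'s \<Rightarrow> 'a"
    and \<pi> :: "nat \<Rightarrow> (nat \<Rightarrow> ennreal \<times> 's option) \<Rightarrow> real \<Rightarrow> 'a measure"
    and P :: "(nat \<Rightarrow> ennreal \<times> 's option) measure"
  assumes model: "ctmdp_model S A qt \<gamma>"
    and costs: "cost_data S A N c d"
    and cond1: "condition1 S A qt N c"
    and fstar_meas: "fstar \<in> MS S \<rightarrow>\<^sub>M MA A"
    and fstar_S2: "\<forall>x\<in>S2 S A qt N c. (\<Sum>i\<le>N. c i x (fstar x)) + qx qt S x (fstar x) = 0"
    and pol: "ct_policy S A \<pi>"
    and P: "ct_strategic_measure S qt \<gamma> \<pi> P"
    and feasible: "\<forall>j\<in>{1..N}. ct_cost A \<pi> P (c j) \<le> ennreal (d j)"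
    and finite_value: "ct_cost A \<pi> P (c 0) < \<infinity>"
    and pi_S2: "\<forall>n h s. h \<in> Hset S n \<longrightarrow> 0 < s \<longrightarrow> the (snd (h n)) \<in> S2 S A qt N c \<longrightarrow>
                   \<pi> (Suc n) h s = return (MA A) (fstar (the (snd (h n))))"
  shows "\<exists>\<sigma>. dt_markov_policy S A \<sigma> \<and>
           (\<forall>n. \<forall>x\<in>S2 S A qt N c. \<sigma> (Suc n) (Some x) = return (MA A) (fstar x)) \<and>
           (\<forall>n \<Gamma>S \<Gamma>A. \<Gamma>S \<in> sets (MS S) \<and> \<Gamma>S \<subseteq> S - S2 S A qt N c \<and> \<Gamma>A \<in> sets (MA A) \<longrightarrow>
              occ S A qt \<pi> P n \<Gamma>S \<Gamma>A = dt_prob S A qt \<gamma> \<sigma> n \<Gamma>S \<Gamma>A)"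
proof -
  interpret ctmdp_process S A qt \<gamma> \<pi> P by unfold_locales (rule model pol P)+
  let ?Z = "S2 S A qt N c"
  have cm: "(\<lambda>(x, a). c i x a) \<in> borel_measurable SA" and c0: "x \<in> S \<Longrightarrow> a \<in> A \<Longrightarrow> 0 \<le> c i x a" if "i \<le> N" for i x a
    using costs that unfolding cost_data_def by auto
  define tot where "tot x a = qx qt S x a + (\<Sum>i\<le>N. c i x a)" for x a
  have tot0: "0 \<le> tot x a" if "x \<in> S" "a \<in> A" for x a
    unfolding tot_def using that by (intro add_nonneg_nonneg sum_nonneg c0) (auto simp: qx_def)
  have bdd: "bdd_below (tot x ` A)" if "x \<in> S" for x using tot0[OF that] by (intro bdd_belowI[of _ 0]) auto
  have fA: "x \<in> S \<Longrightarrow> fstar x \<in> A" for x using measurable_space[OF fstar_meas] by simp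
  have qxm: "(\<lambda>(x, a). qx qt S x a) \<in> borel_measurable SA"
  proof -
    have "(\<lambda>(x, a). enn2real (qrate x a)) \<in> borel_measurable SA" by measurable
    then show ?thesis by (simp add: qrate_def qx_def)
  qed
  have totm: "(\<lambda>(x, a). tot x a) \<in> borel_measurable SA"
    unfolding tot_def split_beta' using qxm cm by (intro borel_measurable_add borel_measurable_sum) (auto simp: split_beta')
  \<comment> \<open>The infimum vanishes exactly when the total vanishes at \<open>fstar x\<close>.
    Measurability of \<open>S2\<close> then follows from that of \<open>fstar\<close>, without
    measuring an infimum over an uncountable action set.\<close>
  have S2_eq: "?Z = {x \<in> space (MS S). tot x (fstar x) = 0}"
  proof -
    have "(INF a\<in>A. tot x a) = 0" if x: "x \<in> S" and 0: "tot x (fstar x) = 0" for x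
    proof (rule antisym)
      show "(INF a\<in>A. tot x a) \<le> 0" using cINF_lower[OF bdd[OF x] fA[OF x]] 0 by simp
      show "0 \<le> (INF a\<in>A. tot x a)" using A_ne tot0[OF x] by (intro cINF_greatest) auto
    qed
    moreover have "tot x (fstar x) = 0" if "x \<in> ?Z" for x using bspec[OF fstar_S2 that] by (simp add: tot_def)
    ultimately show ?thesis unfolding S2_def tot_def by auto
  qed
  have Z: "?Z \<in> sets (MS S)"
  proof -
    have "(\<lambda>x. tot x (fstar x)) \<in> borel_measurable (MS S)"
      using measurable_compose[OF measurable_Pair[OF measurable_ident fstar_meas] totm] by (simp add: id_def)
    then show ?thesis unfolding S2_eq by measurable
  qed
  have qfs: "qrate x (fstar x) = 0" if x: "x \<in> ?Z" for x
  proof -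
    have xS: "x \<in> S" using x by (simp add: S2_def)
    have "0 \<le> (\<Sum>i\<le>N. c i x (fstar x))" using c0 xS fA[OF xS] by (intro sum_nonneg) auto
    moreover have "0 \<le> qx qt S x (fstar x)" by (simp add: qx_def)
    ultimately have "qx qt S x (fstar x) = 0" using bspec[OF fstar_S2 x] by linarith
    then show ?thesis by (simp add: qrate_def)
  qed
  define C where "C x a = (\<Sum>i\<le>N. ennreal (c i x a))" for x a
  have C: "(\<lambda>(x, a). C x a) \<in> borel_measurable SA"
    unfolding C_def split_beta' using cm by (intro borel_measurable_sum measurable_compose[OF _ measurable_ennreal]) (auto simp: split_beta')
  have finC: "occ_integral n C < \<infinity>" for n
  proof -
    have "occ_integral n C = (\<integral>\<^sup>+z. (\<Sum>i\<le>N. ennreal (c i (fst z) (snd z))) \<partial>sojourn_law n)"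
      unfolding nn_integral_sojourn_law[OF C, symmetric] C_def ..
    also have "\<dots> = (\<Sum>i\<le>N. \<integral>\<^sup>+z. ennreal (c i (fst z) (snd z)) \<partial>sojourn_law n)"
      by (rule nn_integral_sum) (use cm in \<open>auto simp: sets_sojourn_law split_beta' cong: measurable_cong_sets intro!: measurable_compose[OF _ measurable_ennreal]\<close>)
    also have "\<dots> = (\<Sum>i\<le>N. occ_integral n (\<lambda>x a. ennreal (c i x a)))"
    proof (rule sum.cong[OF refl])
      fix i assume "i \<in> {..N}"
      then have i: "i \<le> N" by simp
      note cm[OF i, measurable]
      have "(\<lambda>(x, a). ennreal (c i x a)) \<in> borel_measurable SA" by measurable
      from nn_integral_sojourn_law[OF this] show "(\<integral>\<^sup>+z. ennreal (c i (fst z) (snd z)) \<partial>sojourn_law n) = occ_integral n (\<lambda>x a. ennreal (c i x a))" .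
    qed
    also have "\<dots> < \<infinity>"
    proof -
      \<comment> \<open>Index 0 is covered by the finite value, the other indices by the
        constraints.\<close>
      have "occ_integral n (\<lambda>x a. ennreal (c i x a)) < \<infinity>" if i: "i \<le> N" for i
      proof -
        have "ct_cost A \<pi> P (c i) < \<infinity>"
          using finite_value bspec[OF feasible, of i] i by (cases "i = 0") (auto intro: le_less_trans[OF _ ennreal_less_top])
        then show ?thesis using occ_integral_le_ct_cost[OF cm[OF i], of n] by (rule le_less_trans[rotated])
      qed
      then show ?thesis by (simp add: less_top[symmetric])
    qed
    finally show ?thesis .
  qed
  \<comment> \<open>The lower bound is the very infimum that defines \<open>S2\<close>: it is
    nonnegative, and off \<open>S2\<close> it is nonzero, hence positive.\<close>
  have jump: "occ_integral n (\<lambda>x a. indicator G x * qrate x a) = emeasure (Q n) {h \<in> space (Pn n). snd (h n) \<in> Some ` G}"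
    if G: "G \<in> sets (MS S)" "G \<subseteq> S - ?Z" for n G
  proof (rule occ_integral_qrate_eq_state_law[OF C finC G(1), where \<delta>="\<lambda>x. INF a\<in>A. tot x a"])
    fix x assume "x \<in> G"
    then have x: "x \<in> S" "x \<notin> ?Z" using G by auto
    have "0 \<le> (INF a\<in>A. tot x a)" using A_ne tot0[OF x(1)] by (intro cINF_greatest) auto
    moreover have "(INF a\<in>A. tot x a) \<noteq> 0" using x unfolding S2_def tot_def by auto
    ultimately show "0 < (INF a\<in>A. tot x a)" by simp
    fix a assume a: "a \<in> A"
    have "ennreal (INF a\<in>A. tot x a) \<le> ennreal (tot x a)" by (intro ennreal_leI cINF_lower bdd x a)
    also have "\<dots> = qrate x a + C x a"
    proof -
      have "C x a = ennreal (\<Sum>i\<le>N. c i x a)" unfolding C_def by (rule sum_ennreal) (use c0 x a in auto)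
      then show ?thesis unfolding tot_def qrate_def using c0 x a
        by (subst ennreal_plus) (auto simp: qx_def intro!: sum_nonneg)
    qed
    finally show "ennreal (INF a\<in>A. tot x a) \<le> qrate x a + C x a" .
  qed
  have "\<exists>\<sigma>. dt_markov_policy S A \<sigma> \<and> (\<forall>n. \<forall>x\<in>?Z. \<sigma> (Suc n) (Some x) = return (MA A) (fstar x)) \<and>
    (\<forall>n GS GA. GS \<in> sets (MS S) \<and> GS \<subseteq> S - ?Z \<and> GA \<in> sets (MA A) \<longrightarrow>
       occ_integral n (\<lambda>x a. indicator GS x * (indicator GA a * qrate x a)) = dt_prob S A qt \<gamma> \<sigma> n GS GA)"
  proof (rule markov_policy_from_occupancy[OF _ Z fstar_meas qfs _ jump])
    show "closed A" using cond1 by (auto simp: condition1_def compact_imp_closed)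
    fix n h and s :: real assume "h \<in> Hset S n" "0 < s" "state_ext n h \<in> ?Z"
    then show "policy_ext n h s = return (MA A) (fstar (state_ext n h))" using pi_S2 by (simp add: policy_ext_def state_ext_def)
  qed
  then show ?thesis using occ_eq_occ_integral by (metis (no_types, lifting))
qed

end
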